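(* Suppose that $X=\sum_{m=1}^M X_m$, where $X_1,\dots,X_M$ are $C(T)$-valued random variables such that, for every $\theta\in\Theta$, the processes $X_1,\ldots,X_M$ are independent under $P_\theta$. Let $Y$ be a $C(T)$-valued random variable that is Gaussian under $Q_\theta$ for every $\theta\in\Theta$. Then, for every $\theta\in\Theta$, $$\bigl|F(\theta)-F^{\mathrm G}(\theta)\bigr|\le \bigl\|\mathbb E_\theta[X]-\mathbb E_\theta[Y]\bigr\|_\infty+\bigl\|\mathrm{Cov}_\theta(X)-\mathrm{Cov}_\theta(Y)\bigr\|_\infty+\sum_{m=1}^M\mathbb E_\theta\bigl\|X_m-\mathbb E_\theta[X_m]\bigr\|_\infty^3,$$ where $\|\mathrm{Cov}_\theta(X)-\mathrm{Cov}_\theta(Y)\|_\infty=\sup_{s,t\in T}|\mathrm{Cov}_\theta(X(s),X(t))-\mathrm{Cov}_\theta(Y(s),Y(t))|$.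
   Context: $\Theta$ is a compact parameter space and $T\subseteq\Theta$ is a compact metric space equipped with a Borel probability measure $\pi$ (the prior). $C(T)$ is the separable Banach space of real continuous functions on $T$ with norm $\|x\|_\infty=\sup_{t\in T}|x(t)|$. $(P_\theta)_{\theta\in\Theta}$ and $(Q_\theta)_{\theta\in\Theta}$ are families of probability measures on a common sample space $\Omega$. $X=(X(t))_{t\in T}$ and $Y=(Y(t))_{t\in T}$ are $C(T)$-valued random variables on $\Omega$. The free energies are $$F(\theta)=\mathbb E_{P_\theta}\Bigl[\log\int_T e^{X(t)}\pi(\mathrm dt)\Bigr],\qquad F^{\mathrm G}(\theta)=\mathbb E_{Q_\theta}\Bigl[\log\int_T e^{Y(t)}\pi(\mathrm dt)\Bigr].$$ $\mathbb E_\theta$ and $\mathrm{Cov}_\theta$ are taken under $P_\theta$ for expressions involving $X$ (or the $X_m$) and under $Q_\theta$ for expressions involving $Y$; $\mathbb E_\theta[X]$ denotes the mean function $t\mapsto\mathbb E_\theta[X(t)]$, and similarly for the others. If the third-moment sum on the right-hand side is infinite, the inequality is understood as vacuous. *)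

theory Defs
  imports "HOL-Probability.Probability"
begin

definition borel_of_topology :: "'a topology \<Rightarrow> 'a measure"
  where "borel_of_topology X = sigma (topspace X) {U. openin X U}"

text \<open>The space \<open>C(T)\<close> of real continuous functions on a compact metric space, with the metric of the
  supremum norm. Its elements are extensional functions, so only their values on \<open>mspace T\<close> matter.\<close>

definition cont_space :: "'a metric \<Rightarrow> ('a \<Rightarrow> real) metric"
  where "cont_space T = cfunspace (mtopology_of T) euclidean_metric"

definition borel_cont_space :: "'a metric \<Rightarrow> ('a \<Rightarrow> real) measure"
  where "borel_cont_space T = borel_of_topology (mtopology_of (cont_space T))"

text \<open>The supremum norm takes values in \<^typ>\<open>ennreal\<close>, so that the supremum of an unbounded function
  is \<open>\<infinity>\<close> and not an arbitrary real number.\<close>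

definition sup_norm :: "'a set \<Rightarrow> ('a \<Rightarrow> real) \<Rightarrow> ennreal"
  where "sup_norm A f = (SUP a\<in>A. ennreal \<bar>f a\<bar>)"

definition mean_fun :: "'w measure \<Rightarrow> ('w \<Rightarrow> 'a \<Rightarrow> real) \<Rightarrow> 'a \<Rightarrow> real"
  where "mean_fun P X t = (\<integral>\<omega>. X \<omega> t \<partial>P)"

definition cov_fun :: "'w measure \<Rightarrow> ('w \<Rightarrow> 'a \<Rightarrow> real) \<Rightarrow> 'a \<Rightarrow> 'a \<Rightarrow> real"
  where "cov_fun P X s t = (\<integral>\<omega>. (X \<omega> s - mean_fun P X s) * (X \<omega> t - mean_fun P X t) \<partial>P)"

text \<open>With the Lebesgue integral in \<^typ>\<open>ennreal\<close>, a third moment that does not exist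
  is \<open>\<infinity>\<close>. This includes the case that \<open>X t\<close> is not integrable for some \<open>t\<close>: its Bochner integral is
  then \<open>0\<close> by convention, and the integral below dominates the infinite third moment of \<open>X t\<close>.\<close>

definition third_moment :: "'a set \<Rightarrow> 'w measure \<Rightarrow> ('w \<Rightarrow> 'a \<Rightarrow> real) \<Rightarrow> ennreal"
  where "third_moment A P X = (\<integral>\<^sup>+\<omega>. (sup_norm A (\<lambda>t. X \<omega> t - mean_fun P X t)) ^ 3 \<partial>P)"

definition free_energy :: "'w measure \<Rightarrow> 'a measure \<Rightarrow> ('w \<Rightarrow> 'a \<Rightarrow> real) \<Rightarrow> real"
  where "free_energy P \<pi> X = (\<integral>\<omega>. ln (\<integral>t. exp (X \<omega> t) \<partial>\<pi>) \<partial>P)"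

text \<open>Constants count as Gaussian random variables of variance \<open>0\<close>.\<close>

definition gaussian_rv :: "'w measure \<Rightarrow> ('w \<Rightarrow> real) \<Rightarrow> bool"
  where "gaussian_rv P Z \<longleftrightarrow> Z \<in> borel_measurable P \<and>
    (\<exists>\<mu> \<sigma>. (\<sigma> = 0 \<and> (AE \<omega> in P. Z \<omega> = \<mu>)) \<or>
           (0 < \<sigma> \<and> distributed P lborel Z (\<lambda>z. ennreal (normal_density \<mu> \<sigma> z))))"

text \<open>All finite-dimensional distributions are multivariate normal, i.e. every finite linear
  combination of coordinates is a (possibly degenerate) Gaussian random variable. These combinations
  are particular continuous linear functionals on \<open>C(T)\<close>, so a random variable that is Gaussian in the
  sense of Banach spaces satisfies this condition.\<close>

definition gaussian_process :: "'a set \<Rightarrow> 'w measure \<Rightarrow> ('w \<Rightarrow> 'a \<Rightarrow> real) \<Rightarrow> bool"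
  where "gaussian_process A P Y \<longleftrightarrow>
    (\<forall>S c. finite S \<and> S \<subseteq> A \<longrightarrow> gaussian_rv P (\<lambda>\<omega>. \<Sum>t\<in>S. c t * Y \<omega> t))"

end

theory Submission
  imports Defs
begin

text \<open>The free energy is the expectation of \<open>\<phi>(X)\<close>, where \<open>\<phi>(x) = log \<integral> exp x d\<pi>\<close>. The derivatives of
  \<open>\<phi>\<close> are cumulants under the Gibbs measure with density proportional to \<open>exp x\<close>: the first is the Gibbs
  mean, the second the Gibbs covariance, the third a third cumulant. They are bounded by
  sup norms uniformly in \<open>x\<close>: \<open>\<phi>\<close> is 1-Lipschitz, its second derivative at a kernel \<open>C\<close> is at most
  \<open>2 \<parallel>C\<parallel>\<close>, and its third derivative in the directions \<open>h, h, k\<close> is at most \<open>2 \<parallel>h\<parallel>\<^sup>2 \<parallel>k\<parallel>\<close>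
  (\<open>third_cumulant_abs_le\<close>).

  Let \<open>X\<close> and \<open>G\<close> be independent sums of independent centred vectors. Along the path
  \<open>Z\<^sub>u = sin u X + cos u G\<close> the derivative of the expectation of \<open>\<phi>(Z\<^sub>u)\<close> is a combination of the expected Gibbs
  means of the summands. If a summand \<open>V\<close> enters \<open>Z\<^sub>u\<close> with the coefficient \<open>c\<close>, a Taylor expansion
  around \<open>Z\<^sub>u - c V\<close>, which is independent of \<open>V\<close>, replaces the mean of \<open>V\<close> by \<open>c\<close> times the second
  derivative at the covariance kernel of \<open>V\<close>, with an error of at most \<open>3 c\<^sup>2\<close> times the third moment of
  \<open>\<parallel>V\<parallel>\<close> (\<open>exchange\<close>, \<open>leave_one_out\<close>). Hence the derivative is at most \<open>2 sin u cos u\<close> times the distance of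
  the covariances, plus \<open>3 sin\<^sup>2 u cos u\<close> and \<open>3 cos\<^sup>2 u sin u\<close> times the sums of the third moments. Each of
  these three functions has the integral 1 over \<open>[0, pi/2]\<close>, and this is where the constants come from
  (\<open>comparison\<close>).

  The bound treats \<open>X\<close> and \<open>G\<close> alike, so that it also contains the third moments of the summands of \<open>G\<close>. A
  centred Gaussian vector has the law of \<open>n\<^sup>-\<^sup>1\<^sup>/\<^sup>2\<close> times the sum of \<open>n\<close> independent copies of itself; for this
  representation the third moments add up to a constant times \<open>n\<^sup>-\<^sup>1\<^sup>/\<^sup>2\<close> and vanish in the limit
  (\<open>gaussian_comparison\<close>). The equality of the two laws is a case of the Cramer-Wold theorem
  (\<open>cramer_wold\<close>), since Gaussian vectors are only known through their linear combinations.

  All this takes place on a finite set of indices. Different means are dealt with by the Lipschitz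
  property and by moving the mean of \<open>Y\<close> into the weights (\<open>finite_bound\<close>). For a compact index space, \<open>\<pi>\<close> is
  replaced by its images on finer and finer finite nets. The integrands then converge for every
  sample path by continuity, and their expectations converge because their second moments
  are bounded: those of \<open>X\<close> through the third moments of the summands, those of \<open>Y\<close> through the exponential
  moments of Gaussian variables, whose means and variances are close to those of \<open>X\<close>.\<close>

section \<open>Gibbs averages over a finite index set\<close>

locale finite_gibbs =
  fixes S :: "'i set" and w :: "'i \<Rightarrow> real"
  assumes finite_S: "finite S"
    and weight_nonneg: "\<And>i. i \<in> S \<Longrightarrow> 0 \<le> w i"
    and weight_pos: "0 < sum w S"
begin

definition partition_sum :: "('i \<Rightarrow> real) \<Rightarrow> real"
  where "partition_sum x = (\<Sum>i\<in>S. w i * exp (x i))"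

definition log_partition :: "('i \<Rightarrow> real) \<Rightarrow> real"
  where "log_partition x = ln (partition_sum x)"

definition avg :: "('i \<Rightarrow> real) \<Rightarrow> ('i \<Rightarrow> real) \<Rightarrow> real"
  where "avg x h = (\<Sum>i\<in>S. w i * exp (x i) * h i) / partition_sum x"

definition covar :: "('i \<Rightarrow> real) \<Rightarrow> ('i \<Rightarrow> real) \<Rightarrow> ('i \<Rightarrow> real) \<Rightarrow> real"
  where "covar x h k = avg x (\<lambda>i. h i * k i) - avg x h * avg x k"

text \<open>The joint third cumulant of \<open>h\<close>, \<open>h\<close> and \<open>k\<close> under the Gibbs measure; two of the three
  directions coincide in every use.\<close>

definition third_cumulant :: "('i \<Rightarrow> real) \<Rightarrow> ('i \<Rightarrow> real) \<Rightarrow> ('i \<Rightarrow> real) \<Rightarrow> real"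
  where "third_cumulant x h k = avg x (\<lambda>i. (h i - avg x h)\<^sup>2 * (k i - avg x k))"

text \<open>The second derivative of \<open>log_partition\<close>, as a linear function of a kernel. On the rank-one kernel
  \<open>h i * k j\<close> it is the Gibbs covariance of \<open>h\<close> and \<open>k\<close>; hence on the covariance kernel of a random vector it is
  the expected Gibbs variance of that vector.\<close>

definition kernel_covar :: "('i \<Rightarrow> real) \<Rightarrow> ('i \<Rightarrow> 'i \<Rightarrow> real) \<Rightarrow> real"
  where "kernel_covar x C = avg x (\<lambda>i. C i i) - avg x (\<lambda>i. avg x (C i))"

lemma partition_sum_pos: "0 < partition_sum x"
proof -
  obtain i where i: "i \<in> S" "0 < w i"
    using weight_pos weight_nonneg by (metis less_le_not_le linorder_not_le sum_nonpos)
  have "0 < w i * exp (x i)" using i by simp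
  also have "\<dots> \<le> partition_sum x"
    unfolding partition_sum_def
    by (rule member_le_sum) (use i finite_S weight_nonneg in auto)
  finally show ?thesis .
qed

lemma avg_cong: "(\<And>i. i \<in> S \<Longrightarrow> h i = k i) \<Longrightarrow> avg x h = avg x k"
  unfolding avg_def by (simp cong: sum.cong)

lemma avg_const [simp]: "avg x (\<lambda>_. c) = c"
  using partition_sum_pos[of x]
  by (simp add: avg_def partition_sum_def sum_distrib_right[symmetric])

lemma avg_add: "avg x (\<lambda>i. h i + k i) = avg x h + avg x k"
  by (simp add: avg_def distrib_left sum.distrib add_divide_distrib)

lemma avg_cmult: "avg x (\<lambda>i. c * h i) = c * avg x h"
  by (simp add: avg_def sum_distrib_left mult.left_commute)

lemma avg_minus: "avg x (\<lambda>i. - h i) = - avg x h"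
  using avg_cmult[of x "-1" h] by simp

lemma avg_diff: "avg x (\<lambda>i. h i - k i) = avg x h - avg x k"
  using avg_add[of x h "\<lambda>i. - k i"] by (simp add: avg_minus)

lemma avg_sum: "avg x (\<lambda>i. \<Sum>a\<in>A. h a i) = (\<Sum>a\<in>A. avg x (h a))"
  by (induction A rule: infinite_finite_induct) (simp_all add: avg_add)

lemma avg_mono: "(\<And>i. i \<in> S \<Longrightarrow> h i \<le> k i) \<Longrightarrow> avg x h \<le> avg x k"
  unfolding avg_def
  by (intro divide_right_mono sum_mono mult_left_mono)
     (use partition_sum_pos[of x] weight_nonneg in \<open>auto intro: less_imp_le\<close>)

lemma avg_abs: "\<bar>avg x h\<bar> \<le> avg x (\<lambda>i. \<bar>h i\<bar>)"
proof -
  have "- avg x h \<le> avg x (\<lambda>i. \<bar>h i\<bar>)"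
    unfolding avg_minus[symmetric] by (rule avg_mono) simp
  moreover have "avg x h \<le> avg x (\<lambda>i. \<bar>h i\<bar>)" by (rule avg_mono) simp
  ultimately show ?thesis by simp
qed

lemma avg_abs_le: "(\<And>i. i \<in> S \<Longrightarrow> \<bar>h i\<bar> \<le> b) \<Longrightarrow> \<bar>avg x h\<bar> \<le> b"
  using avg_abs[of x h] avg_mono[of "\<lambda>i. \<bar>h i\<bar>" "\<lambda>_. b" x] by simp

lemma covar_self: "covar x h h = avg x (\<lambda>i. (h i - avg x h)\<^sup>2)"
proof -
  have "avg x (\<lambda>i. (h i - avg x h)\<^sup>2) = avg x (\<lambda>i. h i * h i + (- 2 * avg x h) * h i + (avg x h)\<^sup>2)"
    by (simp add: power2_eq_square algebra_simps)
  also have "\<dots> = covar x h h"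
    by (simp only: avg_add avg_cmult avg_const covar_def) (simp add: power2_eq_square)
  finally show ?thesis by simp
qed

lemma covar_self_le:
  assumes "\<And>i. i \<in> S \<Longrightarrow> \<bar>h i\<bar> \<le> b"
  shows "covar x h h \<le> b\<^sup>2"
proof -
  have "avg x (\<lambda>i. h i * h i) \<le> avg x (\<lambda>_. b\<^sup>2)"
    by (rule avg_mono) (use assms in \<open>simp add: power2_eq_square[symmetric] abs_le_square_iff[symmetric], force\<close>)
  then show ?thesis by (simp add: covar_def) (smt (verit) zero_le_square)
qed

lemma third_cumulant_expand: "third_cumulant x h k = covar x (\<lambda>i. h i * h i) k - 2 * avg x h * covar x h k"
proof -
  let ?a = "avg x h" and ?b = "avg x k"
  have "third_cumulant x h k = avg x (\<lambda>i. h i * h i * k i + (- ?b) * (h i * h i) + (-2 * ?a) * (h i * k i)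
      + (2 * ?a * ?b) * h i + (?a * ?a) * k i + (- ?a * ?a * ?b))"
    unfolding third_cumulant_def by (rule arg_cong[where f="avg x"]) (auto simp: power2_eq_square algebra_simps)
  also have "\<dots> = avg x (\<lambda>i. h i * h i * k i) + (- ?b) * avg x (\<lambda>i. h i * h i) + (-2 * ?a) * avg x (\<lambda>i. h i * k i)
      + (2 * ?a * ?b) * ?a + (?a * ?a) * ?b + (- ?a * ?a * ?b)"
    by (simp only: avg_add avg_cmult avg_const)
  finally show ?thesis by (simp add: covar_def algebra_simps)
qed

text \<open>The centred \<open>k\<close> is bounded by \<open>2 * b\<close>, and what remains is the Gibbs variance of \<open>h\<close>. The factor 2 is
  crude, but it is exactly what leads to the coefficient 1 in front of the third moments.\<close>

lemma third_cumulant_abs_le: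
  assumes h: "\<And>i. i \<in> S \<Longrightarrow> \<bar>h i\<bar> \<le> a" and k: "\<And>i. i \<in> S \<Longrightarrow> \<bar>k i\<bar> \<le> b"
  shows "\<bar>third_cumulant x h k\<bar> \<le> 2 * a\<^sup>2 * b"
proof -
  have m: "\<bar>avg x k\<bar> \<le> b" by (rule avg_abs_le) (rule k)
  then have b: "0 \<le> b" by linarith
  have "\<bar>third_cumulant x h k\<bar> \<le> avg x (\<lambda>i. \<bar>(h i - avg x h)\<^sup>2 * (k i - avg x k)\<bar>)"
    unfolding third_cumulant_def by (rule avg_abs)
  also have "\<dots> \<le> avg x (\<lambda>i. (2 * b) * (h i - avg x h)\<^sup>2)"
  proof (rule avg_mono)
    fix i assume "i \<in> S"
    then have "\<bar>k i - avg x k\<bar> \<le> 2 * b" using k[of i] m by linarith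
    then show "\<bar>(h i - avg x h)\<^sup>2 * (k i - avg x k)\<bar> \<le> (2 * b) * (h i - avg x h)\<^sup>2"
      by (simp add: abs_mult mult.commute mult_right_mono)
  qed
  also have "\<dots> = 2 * b * covar x h h" by (simp add: avg_cmult covar_self)
  also have "\<dots> \<le> 2 * b * a\<^sup>2" using covar_self_le[OF h] b by (intro mult_left_mono) auto
  finally show ?thesis by (simp add: mult.commute mult.left_commute)
qed

lemma kernel_covar_outer: "kernel_covar x (\<lambda>i j. h i * k j) = covar x h k"
  using avg_cmult[of x "avg x k" h, unfolded mult.commute[of "avg x k"]]
  unfolding kernel_covar_def covar_def avg_cmult by (simp add: mult.commute)

lemma kernel_covar_diff:
  "kernel_covar x (\<lambda>i j. C i j - C' i j) = kernel_covar x C - kernel_covar x C'"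
  by (simp add: kernel_covar_def avg_diff)

lemma kernel_covar_sum:
  "kernel_covar x (\<lambda>i j. \<Sum>a\<in>A. C a i j) = (\<Sum>a\<in>A. kernel_covar x (C a))"
  by (simp add: kernel_covar_def avg_sum sum_subtractf)

lemma kernel_covar_abs_le:
  assumes "\<And>i j. i \<in> S \<Longrightarrow> j \<in> S \<Longrightarrow> \<bar>C i j\<bar> \<le> b"
  shows "\<bar>kernel_covar x C\<bar> \<le> 2 * b"
proof -
  have "\<bar>avg x (\<lambda>i. C i i)\<bar> \<le> b" "\<bar>avg x (\<lambda>i. avg x (C i))\<bar> \<le> b"
    using assms by (auto intro!: avg_abs_le)
  then show ?thesis unfolding kernel_covar_def by linarith
qed

lemma has_derivative_partition_sum:
  assumes "\<And>i. i \<in> S \<Longrightarrow> ((\<lambda>u. z u i) has_real_derivative z' i) (at u)"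
  shows "((\<lambda>u. partition_sum (z u)) has_real_derivative partition_sum (z u) * avg (z u) z') (at u)"
  using partition_sum_pos[of "z u"] unfolding partition_sum_def[abs_def] avg_def
  by (auto intro!: derivative_eq_intros assms sum.cong simp: mult_ac)

lemma has_derivative_log_partition:
  assumes "\<And>i. i \<in> S \<Longrightarrow> ((\<lambda>u. z u i) has_real_derivative z' i) (at u)"
  shows "((\<lambda>u. log_partition (z u)) has_real_derivative avg (z u) z') (at u)"
  unfolding log_partition_def[abs_def]
  using partition_sum_pos[of "z u"]
  by (intro DERIV_cong[OF DERIV_ln_divide[THEN DERIV_chain2, OF _ has_derivative_partition_sum[OF assms]]]) auto

lemma has_derivative_avg:
  assumes z: "\<And>i. i \<in> S \<Longrightarrow> ((\<lambda>u. z u i) has_real_derivative z' i) (at u)"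
  shows "((\<lambda>u. avg (z u) h) has_real_derivative covar (z u) h z') (at u)"
proof -
  let ?Z = "partition_sum (z u)" and ?N = "\<Sum>i\<in>S. w i * exp (z u i) * h i"
  have N: "((\<lambda>u. \<Sum>i\<in>S. w i * exp (z u i) * h i) has_real_derivative ?Z * avg (z u) (\<lambda>i. h i * z' i)) (at u)"
    using partition_sum_pos[of "z u"] unfolding avg_def
    by (auto intro!: derivative_eq_intros z sum.cong simp: mult_ac)
  have "((\<lambda>u. avg (z u) h) has_real_derivative
      (?Z * avg (z u) (\<lambda>i. h i * z' i) * ?Z - ?N * (?Z * avg (z u) z')) / (?Z * ?Z)) (at u)"
    unfolding avg_def[where h=h]
    by (rule DERIV_divide[OF N has_derivative_partition_sum[OF z]]) (use partition_sum_pos[of "z u"] in auto)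
  moreover have "(?Z * avg (z u) (\<lambda>i. h i * z' i) * ?Z - ?N * (?Z * avg (z u) z')) / (?Z * ?Z)
      = covar (z u) h z'"
    using partition_sum_pos[of "z u"] unfolding covar_def avg_def[where h=h] by (simp add: field_simps)
  ultimately show ?thesis by simp
qed

lemma has_derivative_covar:
  assumes "\<And>i. i \<in> S \<Longrightarrow> ((\<lambda>u. z u i) has_real_derivative z' i) (at u)"
  shows "((\<lambda>u. covar (z u) h h) has_real_derivative third_cumulant (z u) h z') (at u)"
  unfolding covar_def[where h=h and k=h] third_cumulant_expand
  by (auto intro!: derivative_eq_intros has_derivative_avg assms simp: algebra_simps)

text \<open>A perturbation of size \<open>b\<close> changes every summand of the partition sum by a factor of at most \<open>exp b\<close>.\<close>

lemma log_partition_lipschitz: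
  assumes "\<And>i. i \<in> S \<Longrightarrow> \<bar>x i - y i\<bar> \<le> b"
  shows "\<bar>log_partition x - log_partition y\<bar> \<le> b"
proof -
  have *: "log_partition x \<le> log_partition y + b" if "\<And>i. i \<in> S \<Longrightarrow> \<bar>x i - y i\<bar> \<le> b" for x y
  proof -
    have "partition_sum x \<le> (\<Sum>i\<in>S. w i * exp (y i + b))"
      unfolding partition_sum_def
      by (intro sum_mono mult_left_mono) (use that in \<open>fastforce simp: weight_nonneg\<close>)+
    also have "\<dots> = partition_sum y * exp b"
      by (simp add: partition_sum_def exp_add sum_distrib_left mult_ac)
    finally have "ln (partition_sum x) \<le> ln (partition_sum y * exp b)"
      using partition_sum_pos[of x] by (intro ln_mono) auto
    then show ?thesis
      using partition_sum_pos[of y] by (simp add: log_partition_def ln_mult)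
  qed
  have "log_partition y \<le> log_partition x + b"
    by (rule *) (use assms in \<open>simp add: abs_minus_commute\<close>)
  moreover have "log_partition x \<le> log_partition y + b" by (rule *) (rule assms)
  ultimately show ?thesis by (simp add: abs_le_iff)
qed

lemma log_partition_abs_le:
  assumes "\<And>i. i \<in> S \<Longrightarrow> \<bar>x i\<bar> \<le> b"
  shows "\<bar>log_partition x\<bar> \<le> b + \<bar>ln (sum w S)\<bar>"
  using log_partition_lipschitz[of x "\<lambda>_. 0" b] assms
  by (simp add: log_partition_def[where x="\<lambda>_. 0"] partition_sum_def)

text \<open>The derivative of the Gibbs variance is a third cumulant.\<close>

lemma covar_increment:
  assumes h: "\<And>i. i \<in> S \<Longrightarrow> \<bar>h i\<bar> \<le> a" and k: "\<And>i. i \<in> S \<Longrightarrow> \<bar>k i\<bar> \<le> b" and c: "0 \<le> c"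
  shows "\<bar>covar (\<lambda>i. x i + c * k i) h h - covar x h h\<bar> \<le> c * (2 * a\<^sup>2 * b)"
proof -
  let ?f = "\<lambda>u. covar (\<lambda>i. x i + u * k i) h h"
  have d: "(?f has_real_derivative third_cumulant (\<lambda>i. x i + u * k i) h k) (at u)" for u
    by (rule has_derivative_covar) (auto intro!: derivative_eq_intros)
  have "norm (?f c - ?f 0) \<le> (2 * a\<^sup>2 * b) * norm (c - 0)"
    by (rule field_differentiable_bound[of UNIV, OF _ d]) (auto intro: third_cumulant_abs_le h k)
  then show ?thesis using c by (simp add: mult.commute)
qed

text \<open>Taylor's formula of order two for the Gibbs mean of \<open>h\<close> in the direction of \<open>h\<close> itself: the remainder is half
  a third cumulant, and the half cancels the factor 2 of \<open>third_cumulant_abs_le\<close>.\<close>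

lemma avg_second_order:
  assumes h: "\<And>i. i \<in> S \<Longrightarrow> \<bar>h i\<bar> \<le> a" and c: "0 \<le> c"
  shows "\<bar>avg (\<lambda>i. x i + c * h i) h - avg x h - c * covar x h h\<bar> \<le> c\<^sup>2 * a ^ 3"
proof (cases "c = 0")
  case False
  with c have c: "0 < c" by simp
  let ?z = "\<lambda>u i. x i + u * h i"
  define diff where "diff n u = (if n = 0 then avg (?z u) h
     else if n = 1 then covar (?z u) h h else third_cumulant (?z u) h h)" for n :: nat and u
  have z: "((\<lambda>u. ?z u i) has_real_derivative h i) (at u)" for u i
    by (auto intro!: derivative_eq_intros)
  have "\<exists>t>0. t < c \<and> diff 0 c = (\<Sum>m<2. diff m 0 / fact m * c ^ m) + diff 2 t / fact 2 * c ^ 2"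
    by (rule Maclaurin) (use c in \<open>auto simp: diff_def less_2_cases_iff
      intro!: has_derivative_avg[OF z] has_derivative_covar[OF z]\<close>)
  then obtain t where "avg (?z c) h = avg x h + covar x h h * c + third_cumulant (?z t) h h / 2 * c\<^sup>2"
    by (auto simp: diff_def numeral_2_eq_2)
  moreover have "\<bar>third_cumulant (?z t) h h\<bar> \<le> 2 * a\<^sup>2 * a" by (rule third_cumulant_abs_le) (use h in auto)
  then have "\<bar>third_cumulant (?z t) h h / 2 * c\<^sup>2\<bar> \<le> a ^ 3 * c\<^sup>2"
    unfolding abs_mult by (intro mult_mono) (auto simp: power3_eq_cube power2_eq_square)
  ultimately show ?thesis by (simp add: mult.commute)
qed auto

end

section \<open>Exchanging one independent summand\<close>

lemma power_le_one_plus_cube: "0 \<le> (d::real) \<Longrightarrow> k \<le> 3 \<Longrightarrow> d ^ k \<le> 1 + d ^ 3"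
proof (cases "d \<le> 1")
  case True
  assume "0 \<le> d" then show ?thesis using power_le_one[of d k] True by (simp add: add_increasing2)
next
  case False
  assume "k \<le> 3" then show ?thesis using power_increasing[of k 3 d] False by linarith
qed

lemma (in prob_space) abs_integral_le:
  fixes f :: "'a \<Rightarrow> real"
  assumes "\<And>x. x \<in> space M \<Longrightarrow> \<bar>f x\<bar> \<le> b"
  shows "\<bar>\<integral>x. f x \<partial>M\<bar> \<le> b"
proof (cases "integrable M f")
  case True
  have "\<bar>\<integral>x. f x \<partial>M\<bar> \<le> (\<integral>x. \<bar>f x\<bar> \<partial>M)" by (rule integral_abs_bound)
  also have "\<dots> \<le> (\<integral>x. b \<partial>M)" using True assms by (intro integral_mono) auto
  finally show ?thesis by (simp add: prob_space)
next
  case False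
  obtain x where "x \<in> space M" using not_empty by blast
  then show ?thesis using assms[of x] not_integrable_integral_eq[OF False] by simp
qed

text \<open>By the mean value inequality the integrable bound on the derivatives also dominates all difference
  quotients.\<close>

lemma has_derivative_integral:
  fixes f :: "real \<Rightarrow> 'b \<Rightarrow> real"
  assumes int: "\<And>u. integrable M (f u)" and D: "integrable M D"
    and d: "\<And>u x. x \<in> space M \<Longrightarrow> ((\<lambda>u. f u x) has_real_derivative f' u x) (at u)"
    and bd: "\<And>u x. x \<in> space M \<Longrightarrow> \<bar>f' u x\<bar> \<le> D x"
  shows "((\<lambda>u. \<integral>x. f u x \<partial>M) has_real_derivative (\<integral>x. f' u x \<partial>M)) (at u)"
proof -
  let ?q = "\<lambda>h x. (f (u + h) x - f u x) / h"
  have lim: "(\<lambda>n. ?q (h n) x) \<longlonglongrightarrow> f' u x" if "x \<in> space M" "\<And>n. h n \<noteq> 0" "h \<longlonglongrightarrow> 0" for h x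
    using d[OF that(1), of u] that(2,3) unfolding DERIV_def tendsto_at_iff_sequentially
    by (auto simp: o_def)
  have f': "f' u \<in> borel_measurable M"
  proof (rule borel_measurable_LIMSEQ_real)
    show "(\<lambda>n. ?q (inverse (real (Suc n))) x) \<longlonglongrightarrow> f' u x" if "x \<in> space M" for x
      by (rule lim[OF that]) (simp_all only: LIMSEQ_inverse_real_of_nat, simp)
    show "?q (inverse (real (Suc n))) \<in> borel_measurable M" for n
      using borel_measurable_integrable[OF int] by measurable
  qed
  have qb: "\<bar>?q h x\<bar> \<le> D x" if "x \<in> space M" "h \<noteq> 0" for h x
  proof -
    have "norm (f (u + h) x - f u x) \<le> D x * norm (u + h - u)"
      by (rule field_differentiable_bound[of UNIV, OF _ d[OF that(1)]]) (use bd[OF that(1)] in auto)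
    then show ?thesis using that(2) by (simp add: divide_le_eq)
  qed
  show ?thesis unfolding DERIV_def tendsto_at_iff_sequentially
  proof (intro allI impI)
    fix h :: "nat \<Rightarrow> real" assume h: "\<forall>n. h n \<in> UNIV - {0}" "h \<longlonglongrightarrow> 0"
    have "(\<lambda>n. \<integral>x. ?q (h n) x \<partial>M) \<longlonglongrightarrow> (\<integral>x. f' u x \<partial>M)"
    proof (rule integral_dominated_convergence[where w=D])
      show "?q (h n) \<in> borel_measurable M" for n
        using borel_measurable_integrable[OF int] by measurable
      show "AE x in M. (\<lambda>n. ?q (h n) x) \<longlonglongrightarrow> f' u x" using h by (auto intro!: lim)
      show "AE x in M. norm (?q (h n) x) \<le> D x" for n
        using h by (auto intro!: qb simp del: abs_divide)
    qed (use f' D in auto)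
    then show "((\<lambda>h. (integral\<^sup>L M (f (u + h)) - integral\<^sup>L M (f u)) / h) \<circ> h) \<longlonglongrightarrow> integral\<^sup>L M (f' u)"
      using int by (simp add: o_def)
  qed
qed

context finite_gibbs
begin

lemma borel_measurable_partition_sum:
  assumes "\<And>i. i \<in> S \<Longrightarrow> (\<lambda>y. z y i) \<in> borel_measurable N"
  shows "(\<lambda>y. partition_sum (z y)) \<in> borel_measurable N"
  unfolding partition_sum_def using assms by (intro borel_measurable_sum) measurable

lemma borel_measurable_log_partition:
  assumes "\<And>i. i \<in> S \<Longrightarrow> (\<lambda>y. z y i) \<in> borel_measurable N"
  shows "(\<lambda>y. log_partition (z y)) \<in> borel_measurable N"
  unfolding log_partition_def using borel_measurable_partition_sum[of z, OF assms] by measurable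

lemma borel_measurable_avg:
  assumes "\<And>i. i \<in> S \<Longrightarrow> (\<lambda>y. z y i) \<in> borel_measurable N"
    and "\<And>i. i \<in> S \<Longrightarrow> (\<lambda>y. h y i) \<in> borel_measurable N"
  shows "(\<lambda>y. avg (z y) (h y)) \<in> borel_measurable N"
proof -
  have "(\<lambda>y. w i * exp (z y i) * h y i) \<in> borel_measurable N" if "i \<in> S" for i
    using assms[OF that] by measurable
  then show ?thesis
    unfolding avg_def by (intro borel_measurable_divide borel_measurable_sum borel_measurable_partition_sum assms(1))
qed

lemma borel_measurable_kernel_covar:
  assumes "\<And>i. i \<in> S \<Longrightarrow> (\<lambda>y. z y i) \<in> borel_measurable N"
  shows "(\<lambda>y. kernel_covar (z y) C) \<in> borel_measurable N"
  unfolding kernel_covar_def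
  by (intro borel_measurable_diff borel_measurable_avg assms borel_measurable_const)

lemma integral_avg:
  assumes "\<And>i. i \<in> S \<Longrightarrow> integrable N (\<lambda>y. h y i)"
  shows "(\<integral>y. avg x (h y) \<partial>N) = avg x (\<lambda>i. \<integral>y. h y i \<partial>N)"
    and "integrable N (\<lambda>y. avg x (h y))"
  unfolding avg_def using assms by auto

lemma integral_kernel_covar:
  assumes "\<And>i j. i \<in> S \<Longrightarrow> j \<in> S \<Longrightarrow> integrable N (\<lambda>y. H y i j)"
  shows "(\<integral>y. kernel_covar x (H y) \<partial>N) = kernel_covar x (\<lambda>i j. \<integral>y. H y i j \<partial>N)"
    and "integrable N (\<lambda>y. kernel_covar x (H y))"
proof -
  have 1: "integrable N (\<lambda>y. avg x (H y i))" if "i \<in> S" for i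
    by (rule integral_avg(2)) (rule assms[OF that])
  show "integrable N (\<lambda>y. kernel_covar x (H y))"
    unfolding kernel_covar_def
    by (intro Bochner_Integration.integrable_diff integral_avg(2) 1 assms)
  have "(\<integral>y. kernel_covar x (H y) \<partial>N) = (\<integral>y. avg x (\<lambda>i. H y i i) \<partial>N) - (\<integral>y. avg x (\<lambda>i. avg x (H y i)) \<partial>N)"
    unfolding kernel_covar_def
    by (intro Bochner_Integration.integral_diff integral_avg(2) 1 assms)
  also have "(\<integral>y. avg x (\<lambda>i. H y i i) \<partial>N) = avg x (\<lambda>i. \<integral>y. H y i i \<partial>N)"
    by (rule integral_avg(1)) (rule assms)
  also have "(\<integral>y. avg x (\<lambda>i. avg x (H y i)) \<partial>N) = avg x (\<lambda>i. \<integral>y. avg x (H y i) \<partial>N)"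
    by (rule integral_avg(1)) (rule 1)
  also have "\<dots> = avg x (\<lambda>i. avg x (\<lambda>j. \<integral>y. H y i j \<partial>N))"
    by (intro avg_cong integral_avg(1) assms)
  finally show "(\<integral>y. kernel_covar x (H y) \<partial>N) = kernel_covar x (\<lambda>i j. \<integral>y. H y i j \<partial>N)"
    unfolding kernel_covar_def .
qed

end

text \<open>A centred random vector together with a random bound \<open>D\<close> on its sup norm. Any such bound will do, and
  only its moments enter the estimates.\<close>

locale centered_vector = finite_gibbs S w + prob_space N
  for S :: "'i set" and w and N :: "'b measure" +
  fixes V :: "'b \<Rightarrow> 'i \<Rightarrow> real" and D :: "'b \<Rightarrow> real"
  assumes V_measurable: "\<And>i. i \<in> S \<Longrightarrow> (\<lambda>y. V y i) \<in> borel_measurable N"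
    and D_measurable [measurable]: "D \<in> borel_measurable N"
    and V_le: "\<And>y i. y \<in> space N \<Longrightarrow> i \<in> S \<Longrightarrow> \<bar>V y i\<bar> \<le> D y"
    and D3_integrable: "integrable N (\<lambda>y. D y ^ 3)"
    and V_centered: "\<And>i. i \<in> S \<Longrightarrow> (\<integral>y. V y i \<partial>N) = 0"
begin

lemma D_nonneg: "y \<in> space N \<Longrightarrow> 0 \<le> D y"
  using V_le weight_pos by (metis abs_ge_zero order_trans sum.empty less_irrefl all_not_in_conv)

lemma D_le: "y \<in> space N \<Longrightarrow> D y \<le> 1 + D y ^ 3" and D2_le: "y \<in> space N \<Longrightarrow> (D y)\<^sup>2 \<le> 1 + D y ^ 3"
  using power_le_one_plus_cube[OF D_nonneg, of y 1] power_le_one_plus_cube[OF D_nonneg, of y 2] by simp_all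

lemma D_integrable: "integrable N D" and D2_integrable: "integrable N (\<lambda>y. (D y)\<^sup>2)"
proof -
  have *: "integrable N (\<lambda>y. 1 + D y ^ 3)" using D3_integrable by simp
  have "\<bar>D y\<bar> \<le> \<bar>1 + D y ^ 3\<bar>" "\<bar>(D y)\<^sup>2\<bar> \<le> \<bar>1 + D y ^ 3\<bar>" if "y \<in> space N" for y
    using D_nonneg[OF that] D_le[OF that] D2_le[OF that] abs_of_nonneg[OF zero_le_power2[of "D y"]] by linarith+
  then show "integrable N D" "integrable N (\<lambda>y. (D y)\<^sup>2)"
    by (auto intro!: Bochner_Integration.integrable_bound[OF *] AE_I2 simp del: power_abs)
qed

lemma V_integrable: "i \<in> S \<Longrightarrow> integrable N (\<lambda>y. V y i)"
  by (rule Bochner_Integration.integrable_bound[OF D_integrable V_measurable])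
     (auto intro!: AE_I2 intro: order_trans[OF V_le])

lemma VV_integrable:
  assumes "i \<in> S" "j \<in> S"
  shows "integrable N (\<lambda>y. V y i * V y j)"
proof (rule Bochner_Integration.integrable_bound[OF D2_integrable])
  show "(\<lambda>y. V y i * V y j) \<in> borel_measurable N" using V_measurable assms by measurable
  show "AE y in N. norm (V y i * V y j) \<le> norm ((D y)\<^sup>2)"
    unfolding power2_eq_square
    by (intro AE_I2) (auto simp: abs_mult abs_of_nonneg[OF D_nonneg] intro!: mult_mono V_le assms D_nonneg)
qed

definition second_moment :: "'i \<Rightarrow> 'i \<Rightarrow> real"
  where "second_moment i j = (\<integral>y. V y i * V y j \<partial>N)"

text \<open>Two increasing functions of one random variable are positively correlated. With \<open>d\<close> an independent copy of
  \<open>D\<close>, this amounts to the inequality \<open>(D - d)\<^sup>2 * (D + d) \<ge> 0\<close>, integrated over both.\<close>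

lemma moments_le: "(\<integral>y. D y \<partial>N) * (\<integral>y. (D y)\<^sup>2 \<partial>N) \<le> (\<integral>y. D y ^ 3 \<partial>N)"
proof -
  let ?a = "\<integral>y. D y \<partial>N" and ?b = "\<integral>y. (D y)\<^sup>2 \<partial>N" and ?c = "\<integral>y. D y ^ 3 \<partial>N"
  have 1: "d * ?b + d\<^sup>2 * ?a \<le> ?c + d ^ 3" if "0 \<le> d" for d
  proof -
    have "d * ?b + d\<^sup>2 * ?a = (\<integral>y. d * (D y)\<^sup>2 + d\<^sup>2 * D y \<partial>N)"
      using D_integrable D2_integrable by simp
    also have "\<dots> \<le> (\<integral>y. D y ^ 3 + d ^ 3 \<partial>N)"
    proof (rule integral_mono)
      fix y assume "y \<in> space N"
      then have "0 \<le> (D y - d)\<^sup>2 * (D y + d)" using D_nonneg that by simp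
      then show "d * (D y)\<^sup>2 + d\<^sup>2 * D y \<le> D y ^ 3 + d ^ 3"
        by (simp add: power2_eq_square power3_eq_cube algebra_simps)
    qed (use D_integrable D2_integrable D3_integrable in auto)
    also have "\<dots> = ?c + d ^ 3" using D3_integrable by (simp add: prob_space)
    finally show ?thesis .
  qed
  have "2 * (?a * ?b) = (\<integral>y. D y * ?b + (D y)\<^sup>2 * ?a \<partial>N)"
    using D_integrable D2_integrable by simp
  also have "\<dots> \<le> (\<integral>y. ?c + D y ^ 3 \<partial>N)"
    by (rule integral_mono) (use 1 D_nonneg D_integrable D2_integrable D3_integrable in auto)
  also have "\<dots> = 2 * ?c" using D3_integrable by (simp add: prob_space)
  finally show ?thesis by simp
qed

lemma kernel_covar_second_moment:
  "kernel_covar x second_moment = (\<integral>y. covar x (V y) (V y) \<partial>N)"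
  and integrable_covar: "integrable N (\<lambda>y. covar x (V y) (V y))"
  using integral_kernel_covar[of N "\<lambda>y i j. V y i * V y j" x] VV_integrable
  unfolding kernel_covar_outer second_moment_def[abs_def] by auto

lemma second_moment_le:
  assumes "i \<in> S" "j \<in> S"
  shows "\<bar>second_moment i j\<bar> \<le> (\<integral>y. (D y)\<^sup>2 \<partial>N)"
proof -
  have "\<bar>second_moment i j\<bar> \<le> (\<integral>y. \<bar>V y i * V y j\<bar> \<partial>N)"
    unfolding second_moment_def by (rule integral_abs_bound)
  also have "\<dots> \<le> (\<integral>y. (D y)\<^sup>2 \<partial>N)"
    unfolding power2_eq_square
    by (intro integral_mono integrable_abs VV_integrable assms D2_integrable[unfolded power2_eq_square])
       (auto simp: abs_mult intro!: mult_mono V_le assms D_nonneg)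
  finally show ?thesis .
qed

text \<open>The kernel \<open>second_moment\<close> is an average of rank-one kernels over a second, independent copy of \<open>V\<close>, and for
  each of them the increment is controlled by \<open>covar_increment\<close>. The outcome is of third order: quadratic in the
  copy and linear in \<open>V y\<close>.\<close>

lemma kernel_covar_increment:
  assumes y: "y \<in> space N" and c: "0 \<le> c"
  shows "\<bar>kernel_covar (\<lambda>i. x i + c * V y i) second_moment - kernel_covar x second_moment\<bar>
    \<le> 2 * c * (\<integral>y. (D y)\<^sup>2 \<partial>N) * D y"
proof -
  let ?x' = "\<lambda>i. x i + c * V y i"
  have eq: "kernel_covar ?x' second_moment - kernel_covar x second_moment
      = (\<integral>v. covar ?x' (V v) (V v) - covar x (V v) (V v) \<partial>N)"
    unfolding kernel_covar_second_moment
    by (rule Bochner_Integration.integral_diff[symmetric]) (rule integrable_covar)+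
  have "\<bar>kernel_covar ?x' second_moment - kernel_covar x second_moment\<bar>
      \<le> (\<integral>v. \<bar>covar ?x' (V v) (V v) - covar x (V v) (V v)\<bar> \<partial>N)"
    unfolding eq by (rule integral_abs_bound)
  also have "\<dots> \<le> (\<integral>v. c * (2 * (D v)\<^sup>2 * D y) \<partial>N)"
  proof (rule integral_mono)
    show "\<bar>covar ?x' (V v) (V v) - covar x (V v) (V v)\<bar> \<le> c * (2 * (D v)\<^sup>2 * D y)" if "v \<in> space N" for v
      using covar_increment[of "V v" "D v" "V y" "D y" c x] V_le that y c by blast
    show "integrable N (\<lambda>v. \<bar>covar ?x' (V v) (V v) - covar x (V v) (V v)\<bar>)"
      by (intro integrable_abs Bochner_Integration.integrable_diff integrable_covar)
    show "integrable N (\<lambda>v. c * (2 * (D v)\<^sup>2 * D y))"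
      using D2_integrable by simp
  qed
  also have "\<dots> = 2 * c * (\<integral>y. (D y)\<^sup>2 \<partial>N) * D y" by (simp add: mult_ac)
  finally show ?thesis .
qed

text \<open>The key estimate, for a fixed value \<open>x\<close> of all other summands. In the expansion of the Gibbs mean around
  \<open>x\<close> the constant term has expectation 0 because \<open>V\<close> is centred, and the linear term yields \<open>c\<close> times the
  second derivative at \<open>x\<close>. The remainder costs one third of the bound; moving the
  second derivative from \<open>x\<close> to \<open>x + c V\<close> costs the other two thirds.\<close>

lemma exchange:
  assumes c: "0 \<le> c"
  shows "\<bar>(\<integral>y. avg (\<lambda>i. x i + c * V y i) (V y) - c * kernel_covar (\<lambda>i. x i + c * V y i) second_moment \<partial>N)\<bar>
    \<le> 3 * c\<^sup>2 * (\<integral>y. D y ^ 3 \<partial>N)"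
proof -
  let ?x = "\<lambda>y i. x i + c * V y i" and ?b = "\<integral>y. (D y)\<^sup>2 \<partial>N"
  let ?f = "\<lambda>y. avg (?x y) (V y) - c * kernel_covar (?x y) second_moment"
  let ?g = "\<lambda>y. avg x (V y) + c * covar x (V y) (V y) - c * kernel_covar x second_moment"
  let ?h = "\<lambda>y. c\<^sup>2 * D y ^ 3 + c * (2 * c * ?b * D y)"
  have V0: "integrable N (\<lambda>y. avg x (V y))" "(\<integral>y. avg x (V y) \<partial>N) = 0"
  proof -
    show "integrable N (\<lambda>y. avg x (V y))" by (rule integral_avg(2)) (rule V_integrable)
    have "(\<integral>y. avg x (V y) \<partial>N) = avg x (\<lambda>i. \<integral>y. V y i \<partial>N)"
      by (rule integral_avg(1)) (rule V_integrable)
    also have "\<dots> = avg x (\<lambda>_. 0)" by (rule avg_cong) (rule V_centered)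
    finally show "(\<integral>y. avg x (V y) \<partial>N) = 0" by simp
  qed
  have g: "integrable N ?g" "(\<integral>y. ?g y \<partial>N) = 0"
    using V0 integrable_covar[of x] by (simp_all add: kernel_covar_second_moment prob_space)
  have h: "integrable N ?h" using D3_integrable D_integrable by simp
  have fg: "\<bar>?f y - ?g y\<bar> \<le> ?h y" if y: "y \<in> space N" for y
  proof -
    have "\<bar>avg (?x y) (V y) - avg x (V y) - c * covar x (V y) (V y)\<bar> \<le> c\<^sup>2 * D y ^ 3"
      by (rule avg_second_order[OF _ c]) (rule V_le[OF y])
    moreover have "\<bar>c * (kernel_covar (?x y) second_moment - kernel_covar x second_moment)\<bar>
        \<le> c * (2 * c * ?b * D y)"
      unfolding abs_mult using c kernel_covar_increment[OF y c, of x]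
      by (simp only: abs_of_nonneg) (rule mult_left_mono)
    ultimately show ?thesis by (simp add: right_diff_distrib)
  qed
  have f: "?f \<in> borel_measurable N"
    by (intro borel_measurable_diff borel_measurable_times borel_measurable_const
        borel_measurable_avg borel_measurable_kernel_covar borel_measurable_add V_measurable)
  have int: "integrable N (\<lambda>y. ?f y - ?g y)"
    by (rule Bochner_Integration.integrable_bound[OF h])
       (use f g(1) in \<open>auto intro!: AE_I2 order_trans[OF fg abs_ge_self]\<close>)
  have "integrable N (\<lambda>y. (?f y - ?g y) + ?g y)"
    using int g(1) by (rule Bochner_Integration.integrable_add)
  then have f: "integrable N ?f" by simp
  have "\<bar>\<integral>y. ?f y \<partial>N\<bar> = \<bar>\<integral>y. ?f y - ?g y \<partial>N\<bar>"
    using f g by (subst Bochner_Integration.integral_diff) auto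
  also have "\<dots> \<le> (\<integral>y. \<bar>?f y - ?g y\<bar> \<partial>N)" by (rule integral_abs_bound)
  also have "\<dots> \<le> (\<integral>y. ?h y \<partial>N)" by (rule integral_mono) (use int h fg in auto)
  also have "\<dots> = c\<^sup>2 * (\<integral>y. D y ^ 3 \<partial>N) + 2 * c\<^sup>2 * ((\<integral>y. D y \<partial>N) * ?b)"
    using D3_integrable D_integrable by (simp add: power2_eq_square mult_ac)
  also have "\<dots> \<le> c\<^sup>2 * (\<integral>y. D y ^ 3 \<partial>N) + 2 * c\<^sup>2 * (\<integral>y. D y ^ 3 \<partial>N)"
    by (intro add_left_mono mult_left_mono moments_le) auto
  finally show ?thesis by simp
qed

end

section \<open>Interpolation between two independent sums\<close>

text \<open>The vector \<open>V j\<close> lives on the coordinate \<open>j\<close> of a product space, which makes the family independent.\<close>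

locale independent_centered_vectors = finite_gibbs S w + product_prob_space N J
  for S :: "'i set" and w and N :: "'j \<Rightarrow> 'b measure" and J :: "'j set" +
  fixes V :: "'j \<Rightarrow> 'b \<Rightarrow> 'i \<Rightarrow> real" and D :: "'j \<Rightarrow> 'b \<Rightarrow> real"
  assumes finite_J: "finite J"
    and summand: "\<And>j. j \<in> J \<Longrightarrow> centered_vector S w (N j) (V j) (D j)"
begin

definition cov :: "'j \<Rightarrow> 'i \<Rightarrow> 'i \<Rightarrow> real"
  where "cov j i k = (\<integral>y. V j y i * V j y k \<partial>N j)"

definition combination :: "('j \<Rightarrow> real) \<Rightarrow> ('j \<Rightarrow> 'b) \<Rightarrow> 'i \<Rightarrow> real"
  where "combination c y i = (\<Sum>j\<in>J. c j * V j (y j) i)"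

lemma integrable_component:
  fixes f :: "'b \<Rightarrow> real"
  assumes "j \<in> J" "integrable (N j) f"
  shows "integrable (Pi\<^sub>M J N) (\<lambda>y. f (y j))"
proof -
  have "distr (Pi\<^sub>M J N) (N j) (\<lambda>y. y j) = N j" by (rule PiM_component[OF assms(1)])
  then show ?thesis
    using integrable_distr[OF measurable_component_singleton[OF assms(1)], of N f] assms(2) by simp
qed

lemma V_component_measurable:
  assumes "j \<in> J" "i \<in> S"
  shows "(\<lambda>y. V j (y j) i) \<in> borel_measurable (Pi\<^sub>M J N)"
  by (rule measurable_compose[OF measurable_component_singleton[OF assms(1)]])
     (rule centered_vector.V_measurable[OF summand[OF assms(1)] assms(2)])

lemma combination_measurable:
  "i \<in> S \<Longrightarrow> (\<lambda>y. combination c y i) \<in> borel_measurable (Pi\<^sub>M J N)"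
  unfolding combination_def
  by (intro borel_measurable_sum borel_measurable_times borel_measurable_const V_component_measurable)

lemma space_component: "y \<in> space (Pi\<^sub>M J N) \<Longrightarrow> j \<in> J \<Longrightarrow> y j \<in> space (N j)"
  by (auto simp: space_PiM)

lemma V_component_le:
  "y \<in> space (Pi\<^sub>M J N) \<Longrightarrow> j \<in> J \<Longrightarrow> i \<in> S \<Longrightarrow> \<bar>V j (y j) i\<bar> \<le> D j (y j)"
  by (rule centered_vector.V_le[OF summand]) (auto simp: space_component)

lemma combination_le:
  assumes "y \<in> space (Pi\<^sub>M J N)" "i \<in> S"
  shows "\<bar>combination c y i\<bar> \<le> (\<Sum>j\<in>J. \<bar>c j\<bar> * D j (y j))"
  unfolding combination_def
  by (rule order_trans[OF sum_abs]) (auto simp: abs_mult intro!: sum_mono mult_left_mono V_component_le assms)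

lemma sum_D_integrable: "integrable (Pi\<^sub>M J N) (\<lambda>y. \<Sum>j\<in>J. D j (y j))"
  by (intro Bochner_Integration.integrable_sum integrable_component centered_vector.D_integrable[OF summand])

lemma avg_component_integrable:
  assumes j: "j \<in> J"
  shows "integrable (Pi\<^sub>M J N) (\<lambda>y. avg (combination c y) (V j (y j)))"
proof (rule Bochner_Integration.integrable_bound)
  show "integrable (Pi\<^sub>M J N) (\<lambda>y. D j (y j))"
    by (rule integrable_component[OF j centered_vector.D_integrable[OF summand[OF j]]])
  show "(\<lambda>y. avg (combination c y) (V j (y j))) \<in> borel_measurable (Pi\<^sub>M J N)"
    by (intro borel_measurable_avg combination_measurable V_component_measurable j)
  have "\<bar>avg (combination c y) (V j (y j))\<bar> \<le> D j (y j)" if "y \<in> space (Pi\<^sub>M J N)" for y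
    by (rule avg_abs_le) (rule V_component_le[OF that j])
  then show "AE y in Pi\<^sub>M J N. norm (avg (combination c y) (V j (y j))) \<le> norm (D j (y j))"
    by (auto intro!: AE_I2 intro: order_trans[OF _ abs_ge_self])
qed

lemma cov_le:
  assumes "j \<in> J" "i \<in> S" "k \<in> S"
  shows "\<bar>cov j i k\<bar> \<le> (\<integral>y. (D j y)\<^sup>2 \<partial>N j)"
proof -
  interpret centered_vector S w "N j" "V j" "D j" by (rule summand) fact
  show ?thesis using second_moment_le[OF assms(2,3)] by (simp add: cov_def second_moment_def)
qed

lemma kernel_covar_integrable:
  assumes "\<And>i k. i \<in> S \<Longrightarrow> k \<in> S \<Longrightarrow> \<bar>C i k\<bar> \<le> b"
  shows "integrable (Pi\<^sub>M J N) (\<lambda>y. kernel_covar (combination c y) C)"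
proof (rule P.integrable_const_bound[where B="2 * b"])
  show "AE y in Pi\<^sub>M J N. norm (kernel_covar (combination c y) C) \<le> 2 * b"
    unfolding real_norm_def by (intro AE_I2 kernel_covar_abs_le assms)
qed (intro borel_measurable_kernel_covar combination_measurable)

text \<open>By Fubini's theorem the coordinate \<open>j\<close> can be integrated first, with all the others frozen. This
  is the situation of \<open>exchange\<close>.\<close>

lemma leave_one_out:
  assumes j: "j \<in> J" and c: "0 \<le> c j"
  shows "\<bar>(\<integral>y. avg (combination c y) (V j (y j)) \<partial>Pi\<^sub>M J N)
      - c j * (\<integral>y. kernel_covar (combination c y) (cov j) \<partial>Pi\<^sub>M J N)\<bar>
    \<le> 3 * (c j)\<^sup>2 * (\<integral>y. D j y ^ 3 \<partial>N j)"
proof -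
  interpret j: centered_vector S w "N j" "V j" "D j" by (rule summand) fact
  let ?J = "J - {j}"
  interpret R: prob_space "Pi\<^sub>M ?J N" by (rule prob_space_PiM) (rule prob_space)
  let ?f = "\<lambda>y. avg (combination c y) (V j (y j)) - c j * kernel_covar (combination c y) (cov j)"
  let ?r = "\<lambda>y i. \<Sum>l\<in>?J. c l * V l (y l) i"
  have cov: "cov j = j.second_moment" by (intro ext) (simp add: cov_def j.second_moment_def)
  have ins: "insert j ?J = J" using j by auto
  have kint: "integrable (Pi\<^sub>M J N) (\<lambda>y. kernel_covar (combination c y) (cov j))"
    by (rule kernel_covar_integrable) (rule cov_le[OF j])
  have int: "integrable (Pi\<^sub>M J N) ?f"
    by (intro Bochner_Integration.integrable_diff integrable_mult_right kint avg_component_integrable j)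
  have comb: "combination c (x(j := y)) = (\<lambda>i. ?r x i + c j * V j y i)" for x y
    by (simp add: combination_def fun_eq_iff sum.remove[OF finite_J j] add.commute)
  have "(\<integral>y. avg (combination c y) (V j (y j)) \<partial>Pi\<^sub>M J N)
      - c j * (\<integral>y. kernel_covar (combination c y) (cov j) \<partial>Pi\<^sub>M J N) = (\<integral>y. ?f y \<partial>Pi\<^sub>M J N)"
    using kint avg_component_integrable[OF j] by simp
  also have "\<dots> = (\<integral>x. (\<integral>y. ?f (x(j := y)) \<partial>N j) \<partial>Pi\<^sub>M ?J N)"
    using product_integral_insert[of ?J j ?f, unfolded ins] finite_J int by simp
  finally have eq: "(\<integral>y. avg (combination c y) (V j (y j)) \<partial>Pi\<^sub>M J N)
      - c j * (\<integral>y. kernel_covar (combination c y) (cov j) \<partial>Pi\<^sub>M J N)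
      = (\<integral>x. (\<integral>y. ?f (x(j := y)) \<partial>N j) \<partial>Pi\<^sub>M ?J N)" .
  show ?thesis
    unfolding eq unfolding comb cov fun_upd_same by (rule R.abs_integral_le) (rule j.exchange[OF c])
qed

lemma log_partition_integrable:
  "integrable (Pi\<^sub>M J N) (\<lambda>y. log_partition (combination c y))"
proof (rule Bochner_Integration.integrable_bound)
  let ?b = "\<lambda>y. (\<Sum>j\<in>J. \<bar>c j\<bar> * D j (y j)) + \<bar>ln (sum w S)\<bar>"
  show "integrable (Pi\<^sub>M J N) ?b"
    by (intro Bochner_Integration.integrable_add Bochner_Integration.integrable_sum integrable_mult_right
        integrable_component centered_vector.D_integrable[OF summand] P.integrable_const)
  show "(\<lambda>y. log_partition (combination c y)) \<in> borel_measurable (Pi\<^sub>M J N)"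
    by (intro borel_measurable_log_partition combination_measurable)
  have "\<bar>log_partition (combination c y)\<bar> \<le> ?b y" if "y \<in> space (Pi\<^sub>M J N)" for y
    by (rule log_partition_abs_le) (rule combination_le[OF that])
  then show "AE y in Pi\<^sub>M J N. norm (log_partition (combination c y)) \<le> norm (?b y)"
    by (auto intro!: AE_I2 intro: order_trans[OF _ abs_ge_self])
qed

text \<open>Interpolation between the two halves of the family. With the coefficients \<open>sin u\<close> and \<open>cos u\<close> the second
  derivatives of the two halves come with the same factor \<open>sin u * cos u\<close> and opposite signs, so that only the
  difference of the covariances remains.\<close>

theorem comparison:
  assumes AB: "A \<union> B = J" "A \<inter> B = {}"
    and cov: "\<And>i k. i \<in> S \<Longrightarrow> k \<in> S \<Longrightarrow> \<bar>(\<Sum>j\<in>A. cov j i k) - (\<Sum>j\<in>B. cov j i k)\<bar> \<le> \<kappa>"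
  shows "\<bar>(\<integral>y. log_partition (\<lambda>i. \<Sum>j\<in>A. V j (y j) i) \<partial>Pi\<^sub>M J N)
      - (\<integral>y. log_partition (\<lambda>i. \<Sum>j\<in>B. V j (y j) i) \<partial>Pi\<^sub>M J N)\<bar>
    \<le> \<kappa> + (\<Sum>j\<in>J. \<integral>y. D j y ^ 3 \<partial>N j)"
proof -
  let ?P = "Pi\<^sub>M J N"
  define c where "c u j = (if j \<in> A then sin u else cos u)" for u :: real and j
  define d where "d j = (\<integral>y. D j y ^ 3 \<partial>N j)" for j
  define \<Phi> where "\<Phi> u = (\<integral>y. log_partition (combination (c u) y) \<partial>?P)" for u
  define a where "a u j = (\<integral>y. avg (combination (c u) y) (V j (y j)) \<partial>?P)" for u j
  define \<Phi>' where "\<Phi>' u = (\<Sum>j\<in>A. cos u * a u j) - (\<Sum>j\<in>B. sin u * a u j)" for u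
  \<comment> \<open>An antiderivative of the bound on \<open>\<Phi>'\<close>; its increment from \<open>0\<close> to \<open>pi / 2\<close> is the right-hand side.\<close>
  define b where "b u = \<kappa> * (sin u)\<^sup>2 + sum d A * sin u ^ 3 - sum d B * cos u ^ 3" for u
  have fin: "finite A" "finite B" using AB(1) finite_J by (metis finite_Un)+
  have sub: "A \<subseteq> J" "B \<subseteq> J" using AB(1) by auto
  have split: "(\<Sum>j\<in>J. f j) = (\<Sum>j\<in>A. f j) + (\<Sum>j\<in>B. f j)" for f :: "'j \<Rightarrow> real"
    unfolding AB(1)[symmetric] using fin AB(2) by (rule sum.union_disjoint)
  define dc where "dc u y i = (\<Sum>j\<in>J. (if j \<in> A then cos u else - sin u) * V j (y j) i)" for u y i
  have c_deriv: "((\<lambda>u. c u j) has_real_derivative (if j \<in> A then cos u else - sin u)) (at u)" for u j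
    unfolding c_def by (cases "j \<in> A") (auto intro!: derivative_eq_intros)
  have \<Phi>_deriv: "(\<Phi> has_real_derivative \<Phi>' u) (at u)" for u
  proof -
    have "(\<Phi> has_real_derivative (\<integral>y. avg (combination (c u) y) (dc u y) \<partial>?P)) (at u)"
      unfolding \<Phi>_def
    proof (rule has_derivative_integral[OF log_partition_integrable sum_D_integrable])
      fix y u assume y: "y \<in> space ?P"
      show "((\<lambda>u. log_partition (combination (c u) y)) has_real_derivative avg (combination (c u) y) (dc u y)) (at u)"
        by (rule has_derivative_log_partition)
           (auto simp: combination_def dc_def intro!: derivative_eq_intros c_deriv sum.cong)
      show "\<bar>avg (combination (c u) y) (dc u y)\<bar> \<le> (\<Sum>j\<in>J. D j (y j))"
      proof (rule avg_abs_le)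
        fix i assume i: "i \<in> S"
        show "\<bar>dc u y i\<bar> \<le> (\<Sum>j\<in>J. D j (y j))"
          unfolding dc_def
        proof (rule order_trans[OF sum_abs], rule sum_mono)
          fix j assume "j \<in> J"
          then have "\<bar>V j (y j) i\<bar> \<le> D j (y j)" by (rule V_component_le[OF y _ i])
          moreover have "\<bar>if j \<in> A then cos u else - sin u\<bar> \<le> 1" by simp
          ultimately have "\<bar>if j \<in> A then cos u else - sin u\<bar> * \<bar>V j (y j) i\<bar> \<le> 1 * D j (y j)"
            by (intro mult_mono) auto
          then show "\<bar>(if j \<in> A then cos u else - sin u) * V j (y j) i\<bar> \<le> D j (y j)"
            by (simp add: abs_mult)
        qed
      qed
    qed
    also have "(\<lambda>y. avg (combination (c u) y) (dc u y))
        = (\<lambda>y. \<Sum>j\<in>J. (if j \<in> A then cos u else - sin u) * avg (combination (c u) y) (V j (y j)))"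
      unfolding dc_def avg_sum avg_cmult ..
    also have "(\<integral>y. (\<Sum>j\<in>J. (if j \<in> A then cos u else - sin u) * avg (combination (c u) y) (V j (y j))) \<partial>?P)
        = (\<Sum>j\<in>J. (if j \<in> A then cos u else - sin u) * a u j)"
      unfolding a_def by (simp add: avg_component_integrable)
    also have "\<dots> = \<Phi>' u"
    proof -
      have "(\<Sum>j\<in>B. (if j \<in> A then cos u else - sin u) * a u j) = (\<Sum>j\<in>B. - (sin u * a u j))"
        using AB(2) by (intro sum.cong) auto
      then show ?thesis unfolding split \<Phi>'_def by (simp add: sum_negf)
    qed
    finally show ?thesis .
  qed
  have b_deriv: "(b has_real_derivative
      2 * \<kappa> * sin u * cos u + 3 * (sin u)\<^sup>2 * cos u * sum d A + 3 * (cos u)\<^sup>2 * sin u * sum d B) (at u)" for u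
    unfolding b_def[abs_def] by (auto intro!: derivative_eq_intros simp: algebra_simps power2_eq_square)
  have bound: "\<bar>\<Phi>' u\<bar> \<le> 2 * \<kappa> * sin u * cos u + 3 * (sin u)\<^sup>2 * cos u * sum d A + 3 * (cos u)\<^sup>2 * sin u * sum d B"
    if u: "0 \<le> u" "u \<le> pi / 2" for u
  proof -
    have s: "0 \<le> sin u" "0 \<le> cos u" using u by (auto intro: sin_ge_zero cos_ge_zero)
    define q where "q j = (\<integral>y. kernel_covar (combination (c u) y) (cov j) \<partial>?P)" for j
    have q_int: "integrable ?P (\<lambda>y. kernel_covar (combination (c u) y) (cov j))" if "j \<in> J" for j
      by (rule kernel_covar_integrable) (rule cov_le[OF that])
    have q: "\<bar>sum q A - sum q B\<bar> \<le> 2 * \<kappa>"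
    proof -
      have "sum q A - sum q B = (\<integral>y. (\<Sum>j\<in>A. kernel_covar (combination (c u) y) (cov j))
          - (\<Sum>j\<in>B. kernel_covar (combination (c u) y) (cov j)) \<partial>?P)"
        unfolding q_def using q_int sub by (simp add: subset_iff)
      also have "\<dots> = (\<integral>y. kernel_covar (combination (c u) y) (\<lambda>i k. (\<Sum>j\<in>A. cov j i k) - (\<Sum>j\<in>B. cov j i k)) \<partial>?P)"
        unfolding kernel_covar_diff kernel_covar_sum ..
      finally show ?thesis
        by simp (rule P.abs_integral_le, rule kernel_covar_abs_le, rule assms(3))
    qed
    have eA: "\<bar>a u j - sin u * q j\<bar> \<le> 3 * (sin u)\<^sup>2 * d j" if "j \<in> A" for j
      using leave_one_out[of j "c u"] that sub s unfolding a_def q_def d_def by (auto simp: c_def)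
    have eB: "\<bar>a u j - cos u * q j\<bar> \<le> 3 * (cos u)\<^sup>2 * d j" if "j \<in> B" for j
    proof -
      have "j \<notin> A" using that AB(2) by auto
      then show ?thesis
        using leave_one_out[of j "c u"] that sub s unfolding a_def q_def d_def by (auto simp: c_def)
    qed
    have A: "\<bar>sum (a u) A - sin u * sum q A\<bar> \<le> 3 * (sin u)\<^sup>2 * sum d A"
    proof -
      have "sum (a u) A - sin u * sum q A = (\<Sum>j\<in>A. a u j - sin u * q j)"
        by (simp add: sum_subtractf sum_distrib_left)
      moreover have "\<bar>\<Sum>j\<in>A. a u j - sin u * q j\<bar> \<le> (\<Sum>j\<in>A. 3 * (sin u)\<^sup>2 * d j)"
        by (rule order_trans[OF sum_abs]) (rule sum_mono, rule eA)
      ultimately show ?thesis by (simp add: sum_distrib_left)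
    qed
    have B: "\<bar>sum (a u) B - cos u * sum q B\<bar> \<le> 3 * (cos u)\<^sup>2 * sum d B"
    proof -
      have "sum (a u) B - cos u * sum q B = (\<Sum>j\<in>B. a u j - cos u * q j)"
        by (simp add: sum_subtractf sum_distrib_left)
      moreover have "\<bar>\<Sum>j\<in>B. a u j - cos u * q j\<bar> \<le> (\<Sum>j\<in>B. 3 * (cos u)\<^sup>2 * d j)"
        by (rule order_trans[OF sum_abs]) (rule sum_mono, rule eB)
      ultimately show ?thesis by (simp add: sum_distrib_left)
    qed
    \<comment> \<open>The second derivatives are split off; the last two terms are the errors of \<open>leave_one_out\<close>.\<close>
    have "\<Phi>' u = sin u * cos u * (sum q A - sum q B) + cos u * (sum (a u) A - sin u * sum q A)
        - sin u * (sum (a u) B - cos u * sum q B)"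
      unfolding \<Phi>'_def sum_distrib_left[symmetric] by (simp add: algebra_simps)
    moreover have "\<bar>sin u * cos u * (sum q A - sum q B)\<bar> \<le> sin u * cos u * (2 * \<kappa>)"
      "\<bar>cos u * (sum (a u) A - sin u * sum q A)\<bar> \<le> cos u * (3 * (sin u)\<^sup>2 * sum d A)"
      "\<bar>sin u * (sum (a u) B - cos u * sum q B)\<bar> \<le> sin u * (3 * (cos u)\<^sup>2 * sum d B)"
      unfolding abs_mult abs_of_nonneg[OF s(1)] abs_of_nonneg[OF s(2)]
      using s q A B by (auto intro!: mult_left_mono)
    ultimately have "\<bar>\<Phi>' u\<bar> \<le> sin u * cos u * (2 * \<kappa>) + cos u * (3 * (sin u)\<^sup>2 * sum d A)
        + sin u * (3 * (cos u)\<^sup>2 * sum d B)" by linarith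
    then show ?thesis by (simp add: mult_ac)
  qed
  have mono: "f 0 \<le> f (pi / 2)" if "\<And>u. (f has_real_derivative f' u) (at u)"
    "\<And>u. 0 \<le> u \<Longrightarrow> u \<le> pi / 2 \<Longrightarrow> 0 \<le> f' u" for f f' :: "real \<Rightarrow> real"
    by (rule DERIV_nonneg_imp_nondecreasing) (use that in auto)
  have "b 0 - \<Phi> 0 \<le> b (pi / 2) - \<Phi> (pi / 2)"
    by (rule mono[OF DERIV_diff[OF b_deriv \<Phi>_deriv]]) (use bound in \<open>force simp: abs_le_iff\<close>)
  moreover have "b 0 + \<Phi> 0 \<le> b (pi / 2) + \<Phi> (pi / 2)"
    by (rule mono[OF DERIV_add[OF b_deriv \<Phi>_deriv]]) (use bound in \<open>force simp: abs_le_iff\<close>)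
  ultimately have "\<bar>\<Phi> (pi / 2) - \<Phi> 0\<bar> \<le> \<kappa> + sum d J"
    by (simp add: b_def split)
  moreover have "combination (c (pi / 2)) y = (\<lambda>i. \<Sum>j\<in>A. V j (y j) i)" for y
  proof -
    have "(\<Sum>j\<in>B. c (pi / 2) j * V j (y j) i) = 0" for i
      using AB(2) by (intro sum.neutral) (auto simp: c_def)
    then show ?thesis by (auto simp: combination_def split c_def fun_eq_iff)
  qed
  moreover have "combination (c 0) y = (\<lambda>i. \<Sum>j\<in>B. V j (y j) i)" for y
  proof -
    have "(\<Sum>j\<in>B. c 0 j * V j (y j) i) = (\<Sum>j\<in>B. V j (y j) i)" for i
      using AB(2) by (intro sum.cong) (auto simp: c_def)
    then show ?thesis by (auto simp: combination_def split c_def fun_eq_iff)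
  qed
  ultimately show ?thesis by (simp add: \<Phi>_def d_def[abs_def])
qed

end

section \<open>Uniqueness of finite-dimensional distributions\<close>

text \<open>Equality of the characteristic functions of the images of two weighted measures under \<open>U\<close> and \<open>V\<close>. The phase
  \<open>p\<close> covers the real and the imaginary part at once, so that all integrals are real.\<close>

definition same_trig_integrals :: "'a measure \<Rightarrow> ('a \<Rightarrow> real) \<Rightarrow> ('a \<Rightarrow> real) \<Rightarrow> 'b measure \<Rightarrow> ('b \<Rightarrow> real) \<Rightarrow> ('b \<Rightarrow> real) \<Rightarrow> bool"
  where "same_trig_integrals M f U N g V \<longleftrightarrow>
    (\<forall>t p. (\<integral>x. f x * cos (t * U x + p) \<partial>M) = (\<integral>y. g y * cos (t * V y + p) \<partial>N))"

lemma integrable_weight_cos: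
  fixes f L :: "'a \<Rightarrow> real"
  assumes "integrable M f" "L \<in> borel_measurable M"
  shows "integrable M (\<lambda>x. f x * cos (L x))"
proof (rule Bochner_Integration.integrable_bound[OF assms(1)])
  show "AE x in M. norm (f x * cos (L x)) \<le> norm (f x)"
    by (intro AE_I2) (simp add: abs_mult mult_left_le)
qed (use assms in measurable)

lemma char_weighted:
  fixes f U :: "'a \<Rightarrow> real"
  assumes f: "integrable M f" "\<And>x. x \<in> space M \<Longrightarrow> 0 \<le> f x" and U: "U \<in> borel_measurable M"
  shows "char (distr (density M f) borel U) t
    = Complex (\<integral>x. f x * cos (t * U x) \<partial>M) (\<integral>x. f x * cos (t * U x + - (pi / 2)) \<partial>M)"
proof -
  note [measurable] = U borel_measurable_integrable[OF f(1)]
  have "char (distr (density M f) borel U) t = (CLINT x|M. f x *\<^sub>R iexp (t * U x))"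
    unfolding char_def by (subst integral_distr) (use f in \<open>auto simp: integral_density\<close>)
  also have "integrable M (\<lambda>x. f x *\<^sub>R iexp (t * U x))"
    by (rule Bochner_Integration.integrable_bound[OF f(1)]) auto
  note int = this
  have "(CLINT x|M. f x *\<^sub>R iexp (t * U x)) = Complex (\<integral>x. f x * cos (t * U x) \<partial>M) (\<integral>x. f x * cos (t * U x + - (pi / 2)) \<partial>M)"
  proof (rule complex_eqI)
    show "Re (CLINT x|M. f x *\<^sub>R iexp (t * U x)) = Re (Complex (\<integral>x. f x * cos (t * U x) \<partial>M) (\<integral>x. f x * cos (t * U x + - (pi / 2)) \<partial>M))"
      unfolding integral_Re[OF int, symmetric] by (simp add: Re_exp)
    show "Im (CLINT x|M. f x *\<^sub>R iexp (t * U x)) = Im (Complex (\<integral>x. f x * cos (t * U x) \<partial>M) (\<integral>x. f x * cos (t * U x + - (pi / 2)) \<partial>M))"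
      unfolding integral_Im[OF int, symmetric] by (simp add: Im_exp cos_diff)
  qed
  with calculation show ?thesis by simp
qed

text \<open>Levy's uniqueness theorem for nonnegative weights: after division by the total mass, the weights become
  probability densities.\<close>

lemma weighted_uniqueness:
  fixes f U :: "'a \<Rightarrow> real" and g V :: "'b \<Rightarrow> real"
  assumes f: "integrable M f" "\<And>x. x \<in> space M \<Longrightarrow> 0 \<le> f x" and U: "U \<in> borel_measurable M"
    and g: "integrable N g" "\<And>y. y \<in> space N \<Longrightarrow> 0 \<le> g y" and V: "V \<in> borel_measurable N"
    and eq: "same_trig_integrals M f U N g V" and B: "B \<in> sets borel"
  shows "(\<integral>x. f x * indicator B (U x) \<partial>M) = (\<integral>y. g y * indicator B (V y) \<partial>N)"
proof -
  note [measurable] = U V B borel_measurable_integrable[OF f(1)] borel_measurable_integrable[OF g(1)]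
  define m where "m = (\<integral>x. f x \<partial>M)"
  have m: "m = (\<integral>x. g x \<partial>N)"
    using eq[unfolded same_trig_integrals_def, rule_format, of 0 0] by (simp add: m_def)
  show ?thesis
  proof (cases "m = 0")
    case True
    have zero: "(\<integral>x. h x * indicator B (W x) \<partial>K) = 0"
      if h: "integrable K h" "\<And>x. x \<in> space K \<Longrightarrow> 0 \<le> h x" "(\<integral>x. h x \<partial>K) = 0"
      for K :: "'c measure" and h W :: "'c \<Rightarrow> real"
    proof -
      have "AE x in K. h x = 0" using integral_nonneg_eq_0_iff_AE[OF h(1)] h(2,3) by auto
      then have "AE x in K. h x * indicator B (W x) = 0" by eventually_elim simp
      then show ?thesis by (rule integral_eq_zero_AE)
    qed
    show ?thesis
      using zero[OF f(1,2), of U] zero[OF g(1,2), of V] True m m_def by simp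
  next
    case False
    have "0 \<le> m" unfolding m_def using f(2) by (intro integral_nonneg_AE AE_I2)
    with False have m0: "0 < m" by simp
    have real_distr: "real_distribution (distr (density K (\<lambda>x. h x / m)) borel W)"
      if h: "integrable K h" "\<And>x. x \<in> space K \<Longrightarrow> 0 \<le> h x" "(\<integral>x. h x \<partial>K) = m" and [measurable]: "W \<in> borel_measurable K"
      for K :: "'c measure" and h W :: "'c \<Rightarrow> real"
    proof -
      note [measurable] = borel_measurable_integrable[OF h(1)]
      have "prob_space (density K (\<lambda>x. h x / m))"
      proof
        have "emeasure (density K (\<lambda>x. h x / m)) (space K) = (\<integral>\<^sup>+x. ennreal (h x / m) \<partial>K)"
          by (simp add: emeasure_density cong: nn_integral_cong)
        also have "\<dots> = ennreal (\<integral>x. h x / m \<partial>K)"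
          by (rule nn_integral_eq_integral) (use h m0 in \<open>auto intro!: AE_I2\<close>)
        also have "\<dots> = 1" using h(3) m0 by simp
        finally show "emeasure (density K (\<lambda>x. h x / m)) (space (density K (\<lambda>x. h x / m))) = 1" by simp
      qed
      then show ?thesis by (intro prob_space.real_distribution_distr) simp_all
    qed
    have "char (distr (density M (\<lambda>x. f x / m)) borel U) = char (distr (density N (\<lambda>x. g x / m)) borel V)"
    proof
      fix t
      show "char (distr (density M (\<lambda>x. f x / m)) borel U) t = char (distr (density N (\<lambda>x. g x / m)) borel V) t"
        using f g m0 eq[unfolded same_trig_integrals_def, rule_format, of t 0]
          eq[unfolded same_trig_integrals_def, rule_format, of t "- (pi / 2)"]
        by (subst (1 2) char_weighted) auto
    qed
    then have eqd: "distr (density M (\<lambda>x. f x / m)) borel U = distr (density N (\<lambda>x. g x / m)) borel V"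
      using real_distr[OF f(1,2) m_def[symmetric] U] real_distr[OF g(1,2) m[symmetric] V]
      by (intro Levy_uniqueness)
    have calc: "(\<integral>z. indicator B z \<partial>distr (density K (\<lambda>x. h x / m)) borel W) = (\<integral>x. h x * indicator B (W x) \<partial>K) / m"
      if h: "integrable K h" "\<And>x. x \<in> space K \<Longrightarrow> 0 \<le> h x" and [measurable]: "W \<in> borel_measurable K"
      for K :: "'c measure" and h W :: "'c \<Rightarrow> real"
    proof -
      note [measurable] = borel_measurable_integrable[OF h(1)]
      have "(\<integral>z. indicator B z \<partial>distr (density K (\<lambda>x. h x / m)) borel W) = (\<integral>x. (h x / m) *\<^sub>R (indicator B (W x) :: real) \<partial>K)"
        using h m0 by (subst integral_distr) (auto simp: integral_density)
      then show ?thesis by (simp add: mult.commute)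
    qed
    show ?thesis using calc[OF f U] calc[OF g V] eqd m0 by simp
  qed
qed

text \<open>The characteristic function is turned into the probability of a rectangle by exchanging one exponential
  factor after the other for an indicator. To exchange the factor of the coordinate \<open>j\<close>, the
  product \<open>R\<close> of the indicators obtained so far is multiplied by the nonnegative function \<open>1 + cos (L a u + p)\<close>. By the
  product formula for the cosine, the characteristic function of \<open>u j\<close> under this weight is expressed by
  integrals that the induction hypothesis covers, and the one-dimensional theorem applies.\<close>

lemma cramer_wold_rectangle:
  fixes U :: "'a \<Rightarrow> 'i \<Rightarrow> real" and V :: "'b \<Rightarrow> 'i \<Rightarrow> real"
  assumes M: "prob_space M" and N: "prob_space N" and S: "finite S"
    and U: "\<And>i. i \<in> S \<Longrightarrow> (\<lambda>x. U x i) \<in> borel_measurable M"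
    and V: "\<And>i. i \<in> S \<Longrightarrow> (\<lambda>y. V y i) \<in> borel_measurable N"
    and eq: "\<And>a p. (\<integral>x. cos ((\<Sum>i\<in>S. a i * U x i) + p) \<partial>M) = (\<integral>y. cos ((\<Sum>i\<in>S. a i * V y i) + p) \<partial>N)"
    and A: "A \<subseteq> S" and B: "\<And>i. i \<in> S \<Longrightarrow> B i \<in> sets borel"
  shows "(\<integral>x. (\<Prod>i\<in>A. indicator (B i) (U x i)) * cos ((\<Sum>i\<in>S. a i * U x i) + p) \<partial>M)
    = (\<integral>y. (\<Prod>i\<in>A. indicator (B i) (V y i)) * cos ((\<Sum>i\<in>S. a i * V y i) + p) \<partial>N)"
proof -
  have "finite A" using A S by (rule finite_subset)
  then show ?thesis using A
  proof (induction A arbitrary: a p rule: finite_induct)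
    case empty
    then show ?case using eq by simp
  next
    case (insert j A)
    interpret M: prob_space M by fact
    interpret N: prob_space N by fact
    have j: "j \<in> S" and AS: "A \<subseteq> S" using insert.prems by auto
    define R where "R u = (\<Prod>i\<in>A. indicator (B i) (u i) :: real)" for u :: "'i \<Rightarrow> real"
    define L where "L a u = (\<Sum>i\<in>S. a i * u i)" for a u :: "'i \<Rightarrow> real"
    have IH: "(\<integral>x. R (U x) * cos (L a (U x) + p) \<partial>M) = (\<integral>y. R (V y) * cos (L a (V y) + p) \<partial>N)" for a p
      using insert.IH[OF AS, of a p] by (simp add: R_def L_def)
    have R: "0 \<le> R u" "R u \<le> 1" for u
      unfolding R_def by (auto intro!: prod_nonneg prod_le_1)
    have RM: "(\<lambda>x. R (W x)) \<in> borel_measurable K" and LM: "(\<lambda>x. L a (W x)) \<in> borel_measurable K"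
      if "\<And>i. i \<in> S \<Longrightarrow> (\<lambda>x. W x i) \<in> borel_measurable K" for K :: "'c measure" and W and a
    proof -
      have "(\<lambda>x. indicator (B i) (W x i) :: real) \<in> borel_measurable K" if "i \<in> S" for i
        using \<open>\<And>i. i \<in> S \<Longrightarrow> (\<lambda>x. W x i) \<in> borel_measurable K\<close>[OF that] B[OF that] by measurable
      then show "(\<lambda>x. R (W x)) \<in> borel_measurable K"
        unfolding R_def using AS by (intro borel_measurable_prod) auto
      show "(\<lambda>x. L a (W x)) \<in> borel_measurable K"
        unfolding L_def using that by (intro borel_measurable_sum borel_measurable_times) auto
    qed
    have Lfun: "L (\<lambda>i. (if i = j then t else 0) + s * a i) u = t * u j + s * L a u" for t s a u
    proof -
      have "(\<Sum>i\<in>S. (if i = j then t else 0) * u i) = (\<Sum>i\<in>S. if i = j then t * u i else 0)"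
        by (rule sum.cong) auto
      then show ?thesis
        using S j by (simp add: L_def distrib_right sum.distrib sum_distrib_left mult.assoc)
    qed
    have ind: "(\<lambda>x. indicator (B j) (W x j) :: real) \<in> borel_measurable K"
      if "\<And>i. i \<in> S \<Longrightarrow> (\<lambda>x. W x i) \<in> borel_measurable K" for K :: "'c measure" and W
      using that[OF j] B[OF j] by measurable
    define f where "f a p u = R u * (1 + cos (L a u + p))" for a p u
    have f0: "0 \<le> f a p u" for a p u
    proof -
      have "0 \<le> 1 + cos (L a u + p)" using cos_ge_minus_one[of "L a u + p"] by linarith
      then show ?thesis unfolding f_def using R(1) by (rule mult_nonneg_nonneg[rotated])
    qed
    have bounds: "\<bar>R u * c\<bar> \<le> 1" if "\<bar>c\<bar> \<le> 1" for u c
      using R[of u] that mult_mono[of "\<bar>R u\<bar>" 1 "\<bar>c\<bar>" 1] by (simp add: abs_mult)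
    have intg: "integrable K (\<lambda>x. f a p (W x))"
      "integrable K (\<lambda>x. R (W x) * cos (L a (W x) + p))"
      "integrable K (\<lambda>x. R (W x) * indicator (B j) (W x j))"
      "integrable K (\<lambda>x. R (W x) * indicator (B j) (W x j) * cos (L a (W x) + p))"
      if W: "\<And>i. i \<in> S \<Longrightarrow> (\<lambda>x. W x i) \<in> borel_measurable K" and K: "prob_space K"
      for K :: "'c measure" and W a p
    proof -
      interpret K: prob_space K by fact
      have RK: "integrable K (\<lambda>x. R (W x))"
        by (rule K.integrable_const_bound[where B=1]) (use R RM[OF W] in auto)
      have L: "(\<lambda>x. L a (W x) + p) \<in> borel_measurable K" using LM[OF W] by measurable
      show 1: "integrable K (\<lambda>x. R (W x) * cos (L a (W x) + p))"
        by (rule integrable_weight_cos[OF RK L])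
      show "integrable K (\<lambda>x. f a p (W x))"
        unfolding f_def using RK 1 by (simp add: distrib_left)
      show 2: "integrable K (\<lambda>x. R (W x) * indicator (B j) (W x j))"
        by (rule K.integrable_const_bound[where B=1])
           (use bounds RM[OF W] ind[OF W] in \<open>auto simp: indicator_def\<close>)
      show "integrable K (\<lambda>x. R (W x) * indicator (B j) (W x j) * cos (L a (W x) + p))"
        by (rule integrable_weight_cos[OF 2 L])
    qed
    have expand: "(\<integral>x. f a p (W x) * cos (t * W x j + q) \<partial>K)
        = (\<integral>x. R (W x) * cos (L (\<lambda>i. if i = j then t else 0) (W x) + q) \<partial>K)
        + (\<integral>x. R (W x) * cos (L (\<lambda>i. (if i = j then t else 0) + 1 * a i) (W x) + (q + p)) \<partial>K) / 2
        + (\<integral>x. R (W x) * cos (L (\<lambda>i. (if i = j then t else 0) + (- 1) * a i) (W x) + (q - p)) \<partial>K) / 2"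
      if W: "\<And>i. i \<in> S \<Longrightarrow> (\<lambda>x. W x i) \<in> borel_measurable K" and K: "prob_space K"
      for K :: "'c measure" and W a p t q
    proof -
      have "f a p u * cos (t * u j + q) = R u * cos (L (\<lambda>i. if i = j then t else 0) u + q)
        + R u * cos (L (\<lambda>i. (if i = j then t else 0) + 1 * a i) u + (q + p)) / 2
        + R u * cos (L (\<lambda>i. (if i = j then t else 0) + (- 1) * a i) u + (q - p)) / 2" for u
      proof -
        have "cos (L a u + p) * cos (t * u j + q)
            = (cos (t * u j + L a u + (q + p)) + cos (t * u j - L a u + (q - p))) / 2"
          using cos_times_cos[of "t * u j + q" "L a u + p"] by (simp add: algebra_simps)
        moreover have "L (\<lambda>i. if i = j then t else 0) u = t * u j" using Lfun[of t 0 a u] by simp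
        ultimately show ?thesis
          unfolding Lfun f_def by (simp add: distrib_left distrib_right add_divide_distrib mult.assoc)
      qed
      then show ?thesis using intg(2)[OF W K] by simp
    qed
    have key: "(\<integral>x. f a p (U x) * indicator (B j) (U x j) \<partial>M) = (\<integral>y. f a p (V y) * indicator (B j) (V y j) \<partial>N)" for a p
    proof (rule weighted_uniqueness)
      show "same_trig_integrals M (\<lambda>x. f a p (U x)) (\<lambda>x. U x j) N (\<lambda>y. f a p (V y)) (\<lambda>y. V y j)"
        unfolding same_trig_integrals_def by (intro allI) (simp only: expand[of U M, OF U M] expand[of V N, OF V N] IH)
    qed (use intg(1)[of U M, OF U M] intg(1)[of V N, OF V N] f0 U[OF j] V[OF j] B[OF j] in auto)
    have expand2: "(\<integral>x. f a p (W x) * indicator (B j) (W x j) \<partial>K)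
        = (\<integral>x. R (W x) * indicator (B j) (W x j) \<partial>K) + (\<integral>x. R (W x) * indicator (B j) (W x j) * cos (L a (W x) + p) \<partial>K)"
      if W: "\<And>i. i \<in> S \<Longrightarrow> (\<lambda>x. W x i) \<in> borel_measurable K" and K: "prob_space K"
      for K :: "'c measure" and W a p
    proof -
      have "f a p u * indicator (B j) (u j)
          = R u * indicator (B j) (u j) + R u * indicator (B j) (u j) * cos (L a u + p)" for u
        by (simp add: f_def algebra_simps)
      then show ?thesis using intg(3)[of W K] intg(4)[of W K a p] W K by simp
    qed
    \<comment> \<open>The choice \<open>a = 0\<close>, \<open>p = pi / 2\<close> makes the cosine vanish; this isolates the constant term of the weight.\<close>
    have "(\<integral>x. R (U x) * indicator (B j) (U x j) \<partial>M) = (\<integral>y. R (V y) * indicator (B j) (V y j) \<partial>N)"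
      using key[of "\<lambda>_. 0" "pi / 2"] by (simp add: expand2[of U M, OF U M] expand2[of V N, OF V N] L_def)
    then have "(\<integral>x. R (U x) * indicator (B j) (U x j) * cos (L a (U x) + p) \<partial>M)
        = (\<integral>y. R (V y) * indicator (B j) (V y j) * cos (L a (V y) + p) \<partial>N)"
      using key[of a p] by (simp add: expand2[of U M, OF U M] expand2[of V N, OF V N])
    then show ?case
      using insert.hyps by (simp add: R_def L_def mult.commute)
  qed
qed

text \<open>The choice \<open>a = 0\<close> and \<open>p = 0\<close> in the preceding lemma gives the probability of a rectangle, and rectangles generate
  the product space.\<close>

theorem cramer_wold:
  fixes U :: "'a \<Rightarrow> 'i \<Rightarrow> real" and V :: "'b \<Rightarrow> 'i \<Rightarrow> real"
  assumes M: "prob_space M" and N: "prob_space N" and S: "finite S"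
    and U: "\<And>i. i \<in> S \<Longrightarrow> (\<lambda>x. U x i) \<in> borel_measurable M"
    and V: "\<And>i. i \<in> S \<Longrightarrow> (\<lambda>y. V y i) \<in> borel_measurable N"
    and eq: "\<And>a p. (\<integral>x. cos ((\<Sum>i\<in>S. a i * U x i) + p) \<partial>M) = (\<integral>y. cos ((\<Sum>i\<in>S. a i * V y i) + p) \<partial>N)"
  shows "distr M (Pi\<^sub>M S (\<lambda>_. borel)) (\<lambda>x. \<lambda>i\<in>S. U x i) = distr N (Pi\<^sub>M S (\<lambda>_. borel)) (\<lambda>y. \<lambda>i\<in>S. V y i)"
    (is "?P = ?Q")
proof (rule measure_eqI_PiM_finite[OF S])
  interpret M: prob_space M by fact
  interpret N: prob_space N by fact
  have [measurable]: "(\<lambda>x. \<lambda>i\<in>S. U x i) \<in> measurable M (Pi\<^sub>M S (\<lambda>_. borel))"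
    "(\<lambda>y. \<lambda>i\<in>S. V y i) \<in> measurable N (Pi\<^sub>M S (\<lambda>_. borel))"
    using U V by (auto intro!: measurable_restrict)
  show "sets ?P = sets (Pi\<^sub>M S (\<lambda>_. borel))" "sets ?Q = sets (Pi\<^sub>M S (\<lambda>_. borel))" by simp_all
  show "emeasure ?P (Pi\<^sub>E S B) = emeasure ?Q (Pi\<^sub>E S B)" if B: "\<And>i. i \<in> S \<Longrightarrow> B i \<in> sets borel" for B
  proof -
    have [measurable]: "Pi\<^sub>E S B \<in> sets (Pi\<^sub>M S (\<lambda>_. borel))"
      using S B by (intro sets_PiM_I_finite) auto
    have *: "emeasure (distr K (Pi\<^sub>M S (\<lambda>_. borel)) (\<lambda>x. \<lambda>i\<in>S. W x i)) (Pi\<^sub>E S B)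
        = ennreal (\<integral>x. (\<Prod>i\<in>S. indicator (B i) (W x i)) * cos ((\<Sum>i\<in>S. 0 * W x i) + 0) \<partial>K)"
      if K: "prob_space K" and [measurable]: "(\<lambda>x. \<lambda>i\<in>S. W x i) \<in> measurable K (Pi\<^sub>M S (\<lambda>_. borel))"
      for K :: "'c measure" and W :: "'c \<Rightarrow> 'i \<Rightarrow> real"
    proof -
      interpret K: prob_space K by fact
      let ?D = "(\<lambda>x. \<lambda>i\<in>S. W x i) -` Pi\<^sub>E S B \<inter> space K"
      have D: "?D \<in> sets K" by measurable
      have "emeasure (distr K (Pi\<^sub>M S (\<lambda>_. borel)) (\<lambda>x. \<lambda>i\<in>S. W x i)) (Pi\<^sub>E S B) = emeasure K ?D"
        by (rule emeasure_distr) measurable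
      also have "\<dots> = ennreal (\<integral>x. indicator ?D x \<partial>K)"
        using D by (simp add: K.emeasure_eq_measure)
      also have "(\<integral>x. indicator ?D x \<partial>K) = (\<integral>x. (\<Prod>i\<in>S. indicator (B i) (W x i)) * cos ((\<Sum>i\<in>S. 0 * W x i) + 0) \<partial>K)"
      proof (rule Bochner_Integration.integral_cong[OF refl])
        fix x assume x: "x \<in> space K"
        show "indicator ?D x = (\<Prod>i\<in>S. indicator (B i) (W x i)) * cos ((\<Sum>i\<in>S. 0 * W x i) + 0)"
        proof (cases "\<forall>i\<in>S. W x i \<in> B i")
          case True
          then show ?thesis using x by (auto simp: indicator_def PiE_iff)
        next
          case False
          then have "(\<Prod>i\<in>S. indicator (B i) (W x i)) = (0::real)"
            using S by (intro prod_zero) (auto simp: indicator_def)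
          moreover have "x \<notin> ?D" using False by (auto simp: PiE_iff)
          ultimately show ?thesis by simp
        qed
      qed
      finally show ?thesis .
    qed
    show ?thesis
      unfolding *[OF M \<open>(\<lambda>x. \<lambda>i\<in>S. U x i) \<in> _\<close>] *[OF N \<open>(\<lambda>y. \<lambda>i\<in>S. V y i) \<in> _\<close>]
      by (subst cramer_wold_rectangle[OF M N S U V eq subset_refl B]) simp_all
  qed
  show "range (\<lambda>_::nat. space (Pi\<^sub>M S (\<lambda>_. borel :: real measure))) \<subseteq> prod_algebra S (\<lambda>_. borel)"
    using S by (auto simp: space_PiM intro!: prod_algebraI_finite)
  show "emeasure ?P (space (Pi\<^sub>M S (\<lambda>_. borel))) \<noteq> \<infinity>"
    using prob_space.emeasure_le_1[OF M.prob_space_distr[OF \<open>(\<lambda>x. \<lambda>i\<in>S. U x i) \<in> _\<close>]]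
    by (metis ennreal_one_less_top infinity_ennreal_def leD)
qed simp

section \<open>Gaussian random variables and vectors\<close>

text \<open>The constant and the nondegenerate case are unified: both are affine images of the standard normal
  distribution, with slope 0 in the constant case. All moments are computed from this representation.\<close>

lemma gaussian_rv_law:
  assumes P: "prob_space P" and Z: "gaussian_rv P Z"
  obtains \<mu> \<sigma> where "0 \<le> \<sigma>" "distr P borel Z = distr std_normal_distribution borel (\<lambda>x. \<mu> + \<sigma> * x)"
proof -
  interpret P: prob_space P by fact
  interpret N: prob_space std_normal_distribution by (rule prob_space_normal_density) simp
  have [measurable]: "Z \<in> borel_measurable P" using Z by (simp add: gaussian_rv_def)
  from Z consider (const) \<mu> where "AE \<omega> in P. Z \<omega> = \<mu>"
    | (density) \<mu> \<sigma> where "0 < \<sigma>" "distributed P lborel Z (\<lambda>z. ennreal (normal_density \<mu> \<sigma> z))"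
    unfolding gaussian_rv_def by blast
  then show thesis
  proof cases
    case const
    have "distr P borel Z = distr P borel (\<lambda>_. \<mu>)"
      by (rule distr_cong_AE) (use const in auto)
    also have "\<dots> = distr std_normal_distribution borel (\<lambda>x. \<mu> + 0 * x)"
      by (simp add: N.distr_const)
    finally show thesis by (intro that[of 0 \<mu>]) auto
  next
    case density
    have "distributed std_normal_distribution lborel (\<lambda>x. x) (\<lambda>x. ennreal (std_normal_density x))"
      unfolding distributed_def by (auto simp: distr_id2)
    from N.normal_density_affine[OF this _ , of \<sigma> \<mu>] density(1)
    have "distributed std_normal_distribution lborel (\<lambda>x. \<mu> + \<sigma> * x) (\<lambda>x. ennreal (normal_density \<mu> \<sigma> x))"
      by simp
    then have "distr std_normal_distribution lborel (\<lambda>x. \<mu> + \<sigma> * x) = distr P lborel Z"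
      using density(2) by (simp add: distributed_def)
    then have "distr std_normal_distribution borel (\<lambda>x. \<mu> + \<sigma> * x) = distr P borel Z"
      by (simp add: distr_cong[OF refl sets_lborel[symmetric] refl])
    then show thesis using density(1) by (intro that[of \<sigma> \<mu>]) auto
  qed
qed

lemma std_normal_trig:
  "(\<integral>x. cos (t * x) \<partial>std_normal_distribution) = exp (- (t\<^sup>2) / 2)"
  "(\<integral>x. sin (t * x) \<partial>std_normal_distribution) = 0"
proof -
  interpret N: prob_space std_normal_distribution by (rule prob_space_normal_density) simp
  have int: "complex_integrable std_normal_distribution (\<lambda>x. iexp (t * x))"
    by (rule N.integrable_const_bound[where B=1]) auto
  have eq: "(CLINT x|std_normal_distribution. iexp (t * x)) = complex_of_real (exp (- (t\<^sup>2) / 2))"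
    using char_std_normal_distribution by (simp add: char_def fun_eq_iff)
  show "(\<integral>x. cos (t * x) \<partial>std_normal_distribution) = exp (- (t\<^sup>2) / 2)"
    using integral_Re[OF int] unfolding eq by (simp add: Re_exp)
  show "(\<integral>x. sin (t * x) \<partial>std_normal_distribution) = 0"
    using integral_Im[OF int] unfolding eq by (simp add: Im_exp)
qed

lemma std_normal_exp:
  "integrable std_normal_distribution (\<lambda>x. exp (t * x))"
  "(\<integral>x. exp (t * x) \<partial>std_normal_distribution) = exp (t\<^sup>2 / 2)"
proof -
  have eq: "std_normal_density x *\<^sub>R exp (t * x) = exp (t\<^sup>2 / 2) * normal_density t 1 x" for x
    by (simp add: std_normal_density_def normal_density_def mult_exp_exp power2_eq_square field_simps)
  have int: "integrable lborel (\<lambda>x. exp (t\<^sup>2 / 2) * normal_density t 1 x)" by simp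
  show "integrable std_normal_distribution (\<lambda>x. exp (t * x))"
    by (subst integrable_density) (use int in \<open>auto simp: eq[simplified]\<close>)
  show "(\<integral>x. exp (t * x) \<partial>std_normal_distribution) = exp (t\<^sup>2 / 2)"
    by (subst integral_density) (auto simp: eq[simplified])
qed

lemma std_normal_power: "integrable std_normal_distribution (\<lambda>x. x ^ k)"
  by (subst integrable_density) (auto simp: integrable_std_normal_moment)

lemma std_normal_mean_var:
  "(\<integral>x. x \<partial>std_normal_distribution) = 0" "(\<integral>x. x\<^sup>2 \<partial>std_normal_distribution) = 1"
  using integral_std_normal_moment_odd[of 0] integral_std_normal_moment_even[of 1]
  by (subst integral_density; simp)+

text \<open>The polynomial moments are needed for the third-order estimates, the second identity determines the
  characteristic function, and the exponential moments control the logarithm of the partition sum.\<close>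

lemma gaussian_rv_moments:
  assumes P: "prob_space P" and Z: "gaussian_rv P Z"
  defines "\<mu> \<equiv> \<integral>\<omega>. Z \<omega> \<partial>P"
  defines "v \<equiv> \<integral>\<omega>. (Z \<omega> - \<mu>)\<^sup>2 \<partial>P"
  shows "integrable P (\<lambda>\<omega>. Z \<omega> ^ k)"
    and "(\<integral>\<omega>. cos (Z \<omega> - \<mu> + p) \<partial>P) = exp (- v / 2) * cos p"
    and "integrable P (\<lambda>\<omega>. exp (t * Z \<omega>))"
    and "(\<integral>\<omega>. exp (t * Z \<omega>) \<partial>P) = exp (t * \<mu> + t\<^sup>2 * v / 2)"
proof -
  interpret P: prob_space P by fact
  interpret N: prob_space std_normal_distribution by (rule prob_space_normal_density) simp
  have [measurable]: "Z \<in> borel_measurable P" using Z by (simp add: gaussian_rv_def)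
  obtain m s where s: "0 \<le> s" and d: "distr P borel Z = distr std_normal_distribution borel (\<lambda>x. m + s * x)"
    using gaussian_rv_law[OF P Z] .
  have int: "integrable P (\<lambda>\<omega>. g (Z \<omega>)) \<longleftrightarrow> integrable std_normal_distribution (\<lambda>x. g (m + s * x))"
    if "g \<in> borel_measurable borel" for g :: "real \<Rightarrow> real"
    using integrable_distr_eq[of Z P borel g] integrable_distr_eq[of "\<lambda>x. m + s * x" std_normal_distribution borel g] that d
    by simp
  have eq: "(\<integral>\<omega>. g (Z \<omega>) \<partial>P) = (\<integral>x. g (m + s * x) \<partial>std_normal_distribution)"
    if "g \<in> borel_measurable borel" for g :: "real \<Rightarrow> real"
    using integral_distr[of Z P borel g] integral_distr[of "\<lambda>x. m + s * x" std_normal_distribution borel g] that d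
    by simp
  have i1: "integrable std_normal_distribution (\<lambda>x. x)" using std_normal_power[of 1] by simp
  show "integrable P (\<lambda>\<omega>. Z \<omega> ^ k)"
  proof -
    have "(m + s * x) ^ k = (\<Sum>i\<le>k. (real (k choose i) * m ^ i * s ^ (k - i)) * x ^ (k - i))" for x
      by (simp add: binomial_ring power_mult_distrib mult.assoc)
    then have "integrable std_normal_distribution (\<lambda>x. (m + s * x) ^ k)"
      by (simp only:) (intro Bochner_Integration.integrable_sum integrable_mult_right std_normal_power)
    then show ?thesis using int[of "\<lambda>x. x ^ k"] by simp
  qed
  have \<mu>: "\<mu> = m"
  proof -
    have "\<mu> = (\<integral>x. m + s * x \<partial>std_normal_distribution)"
      unfolding \<mu>_def by (rule eq) simp
    also have "\<dots> = (\<integral>x. m \<partial>std_normal_distribution) + (\<integral>x. s * x \<partial>std_normal_distribution)"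
      by (intro Bochner_Integration.integral_add N.integrable_const integrable_mult_right i1)
    also have "\<dots> = m"
      using N.prob_space by (simp only: Bochner_Integration.integral_mult_right_zero std_normal_mean_var lebesgue_integral_const) simp
    finally show ?thesis .
  qed
  have v: "v = s\<^sup>2"
  proof -
    have "v = (\<integral>x. (m + s * x - m)\<^sup>2 \<partial>std_normal_distribution)"
      unfolding v_def \<mu> by (rule eq) simp
    also have "\<dots> = (\<integral>x. s\<^sup>2 * x\<^sup>2 \<partial>std_normal_distribution)"
      by (rule Bochner_Integration.integral_cong[OF refl]) (simp add: power_mult_distrib)
    also have "\<dots> = s\<^sup>2 * (\<integral>x. x\<^sup>2 \<partial>std_normal_distribution)" by (rule Bochner_Integration.integral_mult_right_zero)
    finally show ?thesis by (simp only: std_normal_mean_var mult_1_right)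
  qed
  show "integrable P (\<lambda>\<omega>. exp (t * Z \<omega>))"
  proof -
    have "integrable std_normal_distribution (\<lambda>x. exp (t * m) * exp ((t * s) * x))"
      by (intro integrable_mult_right std_normal_exp)
    then show ?thesis
      using int[of "\<lambda>z. exp (t * z)"] by (simp add: distrib_left exp_add mult.assoc)
  qed
  show "(\<integral>\<omega>. exp (t * Z \<omega>) \<partial>P) = exp (t * \<mu> + t\<^sup>2 * v / 2)"
  proof -
    have "(\<integral>\<omega>. exp (t * Z \<omega>) \<partial>P) = (\<integral>x. exp (t * (m + s * x)) \<partial>std_normal_distribution)"
      by (rule eq) simp
    also have "\<dots> = (\<integral>x. exp (t * m) * exp ((t * s) * x) \<partial>std_normal_distribution)"
      by (rule Bochner_Integration.integral_cong[OF refl]) (simp add: distrib_left exp_add mult.assoc)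
    also have "\<dots> = exp (t * m) * (\<integral>x. exp ((t * s) * x) \<partial>std_normal_distribution)"
      by (rule Bochner_Integration.integral_mult_right_zero)
    finally show ?thesis
      unfolding std_normal_exp \<mu> v by (simp add: exp_add power_mult_distrib)
  qed
  have c: "integrable std_normal_distribution (\<lambda>x. cos (s * x))" "integrable std_normal_distribution (\<lambda>x. sin (s * x))"
    by (rule N.integrable_const_bound[where B=1]; auto)+
  have "(\<integral>\<omega>. cos (Z \<omega> - \<mu> + p) \<partial>P) = (\<integral>x. cos (m + s * x - \<mu> + p) \<partial>std_normal_distribution)"
    by (rule eq) simp
  also have "\<dots> = (\<integral>x. cos p * cos (s * x) - sin p * sin (s * x) \<partial>std_normal_distribution)"
    unfolding \<mu> by (rule Bochner_Integration.integral_cong[OF refl]) (simp add: cos_add mult.commute)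
  also have "\<dots> = cos p * (\<integral>x. cos (s * x) \<partial>std_normal_distribution) - sin p * (\<integral>x. sin (s * x) \<partial>std_normal_distribution)"
    using c by (subst Bochner_Integration.integral_diff)
      (auto simp only: intro!: integrable_mult_right Bochner_Integration.integral_mult_right_zero arg_cong2[where f=minus])
  finally show "(\<integral>\<omega>. cos (Z \<omega> - \<mu> + p) \<partial>P) = exp (- v / 2) * cos p"
    unfolding std_normal_trig v by simp
qed

lemma gaussian_rv_integrable_power:
  assumes "prob_space P" "gaussian_rv P Z"
  shows "integrable P Z" "integrable P (\<lambda>\<omega>. (Z \<omega>)\<^sup>2)" "integrable P (\<lambda>\<omega>. \<bar>Z \<omega>\<bar> ^ 3)"
  using gaussian_rv_moments(1)[OF assms, of 1] gaussian_rv_moments(1)[OF assms, of 2]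
    integrable_abs[OF gaussian_rv_moments(1)[OF assms, of 3]]
  by (simp_all add: power_abs)

text \<open>The hypothesis says that the characteristic function of \<open>L\<close> takes the real value \<open>r\<close> at 1; independence turns the sum into a power.\<close>

lemma integral_cos_sum_copies:
  fixes L :: "'b \<Rightarrow> real"
  assumes Q: "prob_space Q" and L: "L \<in> borel_measurable Q"
    and char: "\<And>p. (\<integral>y. cos (L y + p) \<partial>Q) = r * cos p" and B: "finite B"
  shows "(\<integral>y. cos ((\<Sum>k\<in>B. L (y k)) + p) \<partial>Pi\<^sub>M B (\<lambda>_. Q)) = r ^ card B * cos p"
  using B
proof (induction B arbitrary: p rule: finite_induct)
  case empty
  interpret prob_space "Pi\<^sub>M {} (\<lambda>_. Q)" by (rule prob_space_PiM) (rule Q)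
  show ?case by (simp add: prob_space)
next
  case (insert k B)
  interpret product_prob_space "\<lambda>_. Q" UNIV
    using Q by (simp add: product_prob_space_def product_prob_space_axioms_def product_sigma_finite_def prob_space_imp_sigma_finite)
  interpret PI: prob_space "Pi\<^sub>M (insert k B) (\<lambda>_. Q)" by (rule prob_space_PiM) (rule Q)
  have m: "(\<lambda>y. L (y l)) \<in> borel_measurable (Pi\<^sub>M (insert k B) (\<lambda>_. Q))" if "l \<in> insert k B" for l
    by (rule measurable_compose[OF measurable_component_singleton[OF that] L])
  then have "(\<lambda>y. \<Sum>l\<in>insert k B. L (y l)) \<in> borel_measurable (Pi\<^sub>M (insert k B) (\<lambda>_. Q))"
    by (rule borel_measurable_sum)
  then have int: "integrable (Pi\<^sub>M (insert k B) (\<lambda>_. Q)) (\<lambda>y. cos ((\<Sum>l\<in>insert k B. L (y l)) + p))"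
    by (intro PI.integrable_const_bound[where B=1]) auto
  have "(\<integral>y. cos ((\<Sum>l\<in>insert k B. L (y l)) + p) \<partial>Pi\<^sub>M (insert k B) (\<lambda>_. Q))
      = (\<integral>x. (\<integral>y. cos ((\<Sum>l\<in>insert k B. L ((x(k := y)) l)) + p) \<partial>Q) \<partial>Pi\<^sub>M B (\<lambda>_. Q))"
    by (rule product_integral_insert) (use insert.hyps int in auto)
  also have "\<dots> = (\<integral>x. r * cos ((\<Sum>l\<in>B. L (x l)) + p) \<partial>Pi\<^sub>M B (\<lambda>_. Q))"
  proof (rule Bochner_Integration.integral_cong[OF refl])
    fix x
    have "(\<Sum>l\<in>insert k B. L ((x(k := y)) l)) + p = L y + ((\<Sum>l\<in>B. L (x l)) + p)" for y
    proof -
      have "(\<Sum>l\<in>B. L ((x(k := y)) l)) = (\<Sum>l\<in>B. L (x l))" using insert.hyps by (intro sum.cong) auto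
      then show ?thesis using insert.hyps by simp
    qed
    then show "(\<integral>y. cos ((\<Sum>l\<in>insert k B. L ((x(k := y)) l)) + p) \<partial>Q) = r * cos ((\<Sum>l\<in>B. L (x l)) + p)"
      by (simp only: char)
  qed
  also have "\<dots> = r ^ card (insert k B) * cos p"
    using insert by simp
  finally show ?case .
qed

text \<open>Stability of the centred normal law: a linear combination with variance \<open>v\<close> has variance \<open>v / n\<close> after
  scaling by \<open>1 / sqrt n\<close>, and \<open>n\<close> independent copies add up to \<open>v\<close> again.\<close>

lemma gaussian_distr_sum_copies:
  fixes G :: "'b \<Rightarrow> 'i \<Rightarrow> real"
  assumes Q: "prob_space Q" and S: "finite S" and B: "finite B" "B \<noteq> {}"
    and gauss: "\<And>a. gaussian_rv Q (\<lambda>y. \<Sum>i\<in>S. a i * G y i)"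
    and G: "\<And>i. i \<in> S \<Longrightarrow> (\<lambda>y. G y i) \<in> borel_measurable Q"
    and centered: "\<And>a. (\<integral>y. (\<Sum>i\<in>S. a i * G y i) \<partial>Q) = 0"
  shows "distr (Pi\<^sub>M B (\<lambda>_. Q)) (Pi\<^sub>M S (\<lambda>_. borel)) (\<lambda>y. \<lambda>i\<in>S. \<Sum>k\<in>B. G (y k) i / sqrt (card B))
    = distr Q (Pi\<^sub>M S (\<lambda>_. borel)) (\<lambda>y. \<lambda>i\<in>S. G y i)"
proof (rule cramer_wold)
  let ?n = "real (card B)"
  have n: "0 < ?n" using B by (simp add: card_gt_0_iff)
  show "prob_space (Pi\<^sub>M B (\<lambda>_. Q))" by (rule prob_space_PiM) (rule Q)
  show "(\<lambda>y. \<Sum>k\<in>B. G (y k) i / sqrt ?n) \<in> borel_measurable (Pi\<^sub>M B (\<lambda>_. Q))" if "i \<in> S" for i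
  proof -
    have "(\<lambda>y. G (y k) i) \<in> borel_measurable (Pi\<^sub>M B (\<lambda>_. Q))" if "k \<in> B" for k
      by (rule measurable_compose[OF measurable_component_singleton[OF that] G[OF \<open>i \<in> S\<close>]])
    then show ?thesis by (intro borel_measurable_sum borel_measurable_divide) auto
  qed
  fix a :: "'i \<Rightarrow> real" and p :: real
  define L where "L y = (\<Sum>i\<in>S. a i * G y i)" for y
  define v where "v = (\<integral>y. (L y)\<^sup>2 \<partial>Q)"
  have L[measurable]: "L \<in> borel_measurable Q"
    unfolding L_def using G by (intro borel_measurable_sum borel_measurable_times) auto
  have char: "(\<integral>y. cos (c * L y + q) \<partial>Q) = exp (- (c\<^sup>2 * v) / 2) * cos q" for c q
  proof -
    have "c * L y = (\<Sum>i\<in>S. (c * a i) * G y i)" for y by (simp add: L_def sum_distrib_left mult.assoc)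
    then have g: "gaussian_rv Q (\<lambda>y. c * L y)" and m: "(\<integral>y. c * L y \<partial>Q) = 0"
      using gauss[of "\<lambda>i. c * a i"] centered[of "\<lambda>i. c * a i"] by simp_all
    show ?thesis
      using gaussian_rv_moments(2)[OF Q g, of q] unfolding m by (simp add: power_mult_distrib v_def)
  qed
  have "(\<Sum>i\<in>S. a i * (\<Sum>k\<in>B. G (y k) i / sqrt ?n)) = (\<Sum>k\<in>B. (1 / sqrt ?n) * L (y k))" for y
    unfolding L_def sum_distrib_left by (subst sum.swap) (simp add: mult.commute)
  then have "(\<integral>y. cos ((\<Sum>i\<in>S. a i * (\<Sum>k\<in>B. G (y k) i / sqrt ?n)) + p) \<partial>Pi\<^sub>M B (\<lambda>_. Q))
      = (\<integral>y. cos ((\<Sum>k\<in>B. (1 / sqrt ?n) * L (y k)) + p) \<partial>Pi\<^sub>M B (\<lambda>_. Q))" by simp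
  also have "\<dots> = exp (- ((1 / sqrt ?n)\<^sup>2 * v) / 2) ^ card B * cos p"
    by (rule integral_cos_sum_copies[OF Q _ char B(1)]) measurable
  also have "exp (- ((1 / sqrt ?n)\<^sup>2 * v) / 2) ^ card B = exp (- v / 2)"
    using n by (simp add: exp_of_nat_mult[symmetric] power_divide)
  also have "exp (- v / 2) * cos p = (\<integral>y. cos ((\<Sum>i\<in>S. a i * G y i) + p) \<partial>Q)"
    using char[of 1 p] by (simp add: L_def)
  finally show "(\<integral>y. cos ((\<Sum>i\<in>S. a i * (\<Sum>k\<in>B. G (y k) i / sqrt ?n)) + p) \<partial>Pi\<^sub>M B (\<lambda>_. Q))
    = (\<integral>y. cos ((\<Sum>i\<in>S. a i * G y i) + p) \<partial>Q)" .
qed (use Q S G in auto)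

section \<open>Comparison with a Gaussian vector\<close>

context finite_gibbs
begin

lemma S_nonempty: "S \<noteq> {}"
  using weight_pos by auto

lemma log_partition_cong: "(\<And>i. i \<in> S \<Longrightarrow> x i = y i) \<Longrightarrow> log_partition x = log_partition y"
  unfolding log_partition_def partition_sum_def by (simp cong: sum.cong)

text \<open>Third moments of the coordinates suffice, because on a finite set the cube of the maximum is at most the
  sum of the cubes.\<close>

lemma centered_vector_Max:
  fixes V :: "'b \<Rightarrow> 'i \<Rightarrow> real"
  assumes N: "prob_space N"
    and V: "\<And>i. i \<in> S \<Longrightarrow> (\<lambda>y. V y i) \<in> borel_measurable N"
    and V3: "\<And>i. i \<in> S \<Longrightarrow> integrable N (\<lambda>y. \<bar>V y i\<bar> ^ 3)"
    and V0: "\<And>i. i \<in> S \<Longrightarrow> (\<integral>y. V y i \<partial>N) = 0"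
  shows "centered_vector S w N V (\<lambda>y. MAX i\<in>S. \<bar>V y i\<bar>)"
proof -
  interpret N: prob_space N by fact
  let ?D = "\<lambda>y. MAX i\<in>S. \<bar>V y i\<bar>"
  have D: "?D \<in> borel_measurable N"
    by (rule borel_measurable_Max[OF finite_S]) (intro borel_measurable_abs V)
  have le: "\<bar>V y i\<bar> \<le> ?D y" if "i \<in> S" for y i
    using finite_S that by (intro Max_ge) auto
  show ?thesis
  proof unfold_locales
    show "integrable N (\<lambda>y. ?D y ^ 3)"
    proof (rule Bochner_Integration.integrable_bound)
      show "integrable N (\<lambda>y. \<Sum>i\<in>S. \<bar>V y i\<bar> ^ 3)"
        by (intro Bochner_Integration.integrable_sum V3)
      show "(\<lambda>y. ?D y ^ 3) \<in> borel_measurable N" using D by (rule borel_measurable_power)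
      have "\<bar>?D y ^ 3\<bar> \<le> (\<Sum>i\<in>S. \<bar>V y i\<bar> ^ 3)" for y
      proof -
        have "?D y \<in> (\<lambda>i. \<bar>V y i\<bar>) ` S" by (rule Max_in) (use finite_S S_nonempty in auto)
        then obtain i where i: "i \<in> S" "?D y = \<bar>V y i\<bar>" by blast
        have "\<bar>V y i\<bar> ^ 3 \<le> (\<Sum>i\<in>S. \<bar>V y i\<bar> ^ 3)"
          using i(1) finite_S by (intro member_le_sum) auto
        then show ?thesis by (simp only: i(2) power_abs[symmetric] abs_abs abs_idempotent)
      qed
      then show "AE y in N. norm (?D y ^ 3) \<le> norm (\<Sum>i\<in>S. \<bar>V y i\<bar> ^ 3)"
        unfolding real_norm_def by (intro AE_I2) (rule order_trans[OF _ abs_ge_self])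
    qed
  qed (use V V0 D le in auto)
qed

lemma centered_vector_scale:
  assumes "centered_vector S w N V D" "0 \<le> c"
  shows "centered_vector S w N (\<lambda>y i. c * V y i) (\<lambda>y. c * D y)"
proof -
  interpret centered_vector S w N V D by fact
  show ?thesis
    using V_measurable V_le D3_integrable V_centered assms(2)
    by unfold_locales (auto simp: abs_mult power_mult_distrib intro: mult_left_mono)
qed

text \<open>The theorem \<open>comparison\<close> with the \<open>n\<close> summands \<open>G / sqrt n\<close> on the Gaussian side, for every \<open>n\<close>. Their
  covariances add up to that of \<open>G\<close>, and their third moments to \<open>\<gamma> / sqrt n\<close>, which tends to 0.\<close>

theorem gaussian_comparison:
  fixes N :: "nat \<Rightarrow> 'b measure" and Q :: "'b measure" and G :: "'b \<Rightarrow> 'i \<Rightarrow> real"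
  assumes N: "\<And>m. m \<in> {1..M} \<Longrightarrow> centered_vector S w (N m) (V m) (D m)"
    and Q: "prob_space Q"
    and gauss: "\<And>a. gaussian_rv Q (\<lambda>y. \<Sum>i\<in>S. a i * G y i)"
    and G0: "\<And>i. i \<in> S \<Longrightarrow> (\<integral>y. G y i \<partial>Q) = 0"
    and cov: "\<And>i k. i \<in> S \<Longrightarrow> k \<in> S \<Longrightarrow>
      \<bar>(\<Sum>m=1..M. \<integral>y. V m y i * V m y k \<partial>N m) - (\<integral>y. G y i * G y k \<partial>Q)\<bar> \<le> \<kappa>"
  shows "\<bar>(\<integral>y. log_partition (\<lambda>i. \<Sum>m=1..M. V m (y m) i) \<partial>Pi\<^sub>M {1..M} N) - (\<integral>y. log_partition (G y) \<partial>Q)\<bar>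
    \<le> \<kappa> + (\<Sum>m=1..M. \<integral>y. D m y ^ 3 \<partial>N m)"
proof -
  have Gi: "gaussian_rv Q (\<lambda>y. G y i)" if "i \<in> S" for i
  proof -
    have "(\<Sum>j\<in>S. (if j = i then 1 else 0) * G y j) = G y i" for y
      using finite_S that by (subst sum.remove[of S i]) auto
    then show ?thesis using gauss[of "\<lambda>j. if j = i then 1 else 0"] by simp
  qed
  have Gm: "(\<lambda>y. G y i) \<in> borel_measurable Q" if "i \<in> S" for i
    using Gi[OF that] by (simp add: gaussian_rv_def)
  note G_int = gaussian_rv_integrable_power[OF Q Gi]
  define DG where "DG y = (MAX i\<in>S. \<bar>G y i\<bar>)" for y
  have G: "centered_vector S w Q G DG"
    unfolding DG_def[abs_def] by (rule centered_vector_Max[OF Q Gm G_int(3) G0])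
  define \<gamma> where "\<gamma> = (\<integral>y. DG y ^ 3 \<partial>Q)"
  let ?E = "\<bar>(\<integral>y. log_partition (\<lambda>i. \<Sum>m=1..M. V m (y m) i) \<partial>Pi\<^sub>M {1..M} N) - (\<integral>y. log_partition (G y) \<partial>Q)\<bar>"
  let ?R = "\<kappa> + (\<Sum>m=1..M. \<integral>y. D m y ^ 3 \<partial>N m)"
  have step: "?E \<le> ?R + \<gamma> * inverse (sqrt (real n))" if n: "0 < n" for n
  proof -
    define A B where "A = {1..M}" and "B = {M+1..M+n}"
    define r where "r = inverse (sqrt (real n))"
    have r: "0 \<le> r" "real n * r\<^sup>2 = 1" "real n * r ^ 3 = r"
      using n by (auto simp: r_def power2_eq_square power3_eq_cube field_simps)
    have AB: "finite A" "finite B" "A \<inter> B = {}" "card B = n" "B \<noteq> {}"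
      using n by (auto simp: A_def B_def)
    define N' where "N' j = (if j \<in> A then N j else Q)" for j
    define V' where "V' j = (if j \<in> A then V j else (\<lambda>y i. r * G y i))" for j
    define D' where "D' j = (if j \<in> A then D j else (\<lambda>y. r * DG y))" for j
    have BA: "j \<notin> A" if "j \<in> B" for j using that AB by auto
    have N'p: "prob_space (N' j)" for j
      using N[of j] Q by (auto simp: N'_def A_def centered_vector_def)
    interpret product_prob_space N' "A \<union> B"
      using N'p by (simp add: product_prob_space_def product_prob_space_axioms_def product_sigma_finite_def prob_space_imp_sigma_finite)
    interpret ind: independent_centered_vectors S w N' "A \<union> B" V' D'
    proof (intro independent_centered_vectors.intro independent_centered_vectors_axioms.intro)
      show "finite_gibbs S w" "product_prob_space N'" by unfold_locales
      show "finite (A \<union> B)" using AB by simp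
      show "centered_vector S w (N' j) (V' j) (D' j)" if "j \<in> A \<union> B" for j
        using N[of j] centered_vector_scale[OF G r(1)] by (auto simp: N'_def V'_def D'_def A_def)
    qed
    have covA: "(\<Sum>j\<in>A. ind.cov j i k) = (\<Sum>m=1..M. \<integral>y. V m y i * V m y k \<partial>N m)" for i k
      by (simp add: ind.cov_def A_def N'_def V'_def)
    have covB: "(\<Sum>j\<in>B. ind.cov j i k) = (\<integral>y. G y i * G y k \<partial>Q)" for i k
    proof -
      have "ind.cov j i k = r\<^sup>2 * (\<integral>y. G y i * G y k \<partial>Q)" if "j \<in> B" for j
      proof -
        have "ind.cov j i k = (\<integral>y. r\<^sup>2 * (G y i * G y k) \<partial>Q)"
          using BA[OF that] by (simp add: ind.cov_def N'_def V'_def power2_eq_square mult_ac)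
        then show ?thesis by simp
      qed
      then have "(\<Sum>j\<in>B. ind.cov j i k) = (real n * r\<^sup>2) * (\<integral>y. G y i * G y k \<partial>Q)"
        using AB(4) by simp
      then show ?thesis unfolding r(2) by simp
    qed
    have DB: "(\<Sum>j\<in>B. \<integral>y. D' j y ^ 3 \<partial>N' j) = \<gamma> * r"
    proof -
      have "(\<Sum>j\<in>B. \<integral>y. D' j y ^ 3 \<partial>N' j) = (\<Sum>j\<in>B. r ^ 3 * \<gamma>)"
        using BA by (intro sum.cong) (auto simp: D'_def N'_def \<gamma>_def power_mult_distrib)
      also have "\<dots> = (real n * r ^ 3) * \<gamma>" using AB(4) by simp
      finally show ?thesis unfolding r(3) by (simp add: mult.commute)
    qed
    have DA: "(\<Sum>j\<in>A. \<integral>y. D' j y ^ 3 \<partial>N' j) = (\<Sum>m=1..M. \<integral>y. D m y ^ 3 \<partial>N m)"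
      by (simp add: A_def D'_def N'_def)
    \<comment> \<open>Each half of the family depends on its own coordinates only.\<close>
    have restr: "(\<integral>y. log_partition (\<lambda>i. \<Sum>j\<in>K. V' j (y j) i) \<partial>Pi\<^sub>M (A \<union> B) N')
        = (\<integral>y. log_partition (\<lambda>i. \<Sum>j\<in>K. V' j (y j) i) \<partial>Pi\<^sub>M K N')" if K: "K \<subseteq> A \<union> B" for K
    proof -
      have "(\<lambda>y. V' j (y j) i) \<in> borel_measurable (Pi\<^sub>M K N')" if "j \<in> K" "i \<in> S" for i j
        by (rule measurable_compose[OF measurable_component_singleton[OF that(1)]])
           (rule centered_vector.V_measurable[OF ind.summand that(2)], use that K in auto)
      then have m: "(\<lambda>y. log_partition (\<lambda>i. \<Sum>j\<in>K. V' j (y j) i)) \<in> borel_measurable (Pi\<^sub>M K N')"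
        by (intro borel_measurable_log_partition borel_measurable_sum)
      have "(\<integral>y. log_partition (\<lambda>i. \<Sum>j\<in>K. V' j (y j) i) \<partial>Pi\<^sub>M K N')
          = (\<integral>y. log_partition (\<lambda>i. \<Sum>j\<in>K. V' j (restrict y K j) i) \<partial>Pi\<^sub>M (A \<union> B) N')"
        using integral_distr[OF measurable_restrict_subset[OF K] m]
          distr_restrict[OF K, symmetric] AB(1,2) by simp
      then show ?thesis by simp
    qed
    have EA: "(\<integral>y. log_partition (\<lambda>i. \<Sum>j\<in>A. V' j (y j) i) \<partial>Pi\<^sub>M (A \<union> B) N')
        = (\<integral>y. log_partition (\<lambda>i. \<Sum>m=1..M. V m (y m) i) \<partial>Pi\<^sub>M {1..M} N)"
    proof -
      have "Pi\<^sub>M A N' = Pi\<^sub>M {1..M} N" by (rule PiM_cong) (auto simp: A_def N'_def)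
      then show ?thesis by (subst restr) (auto simp: V'_def A_def)
    qed
    have EB: "(\<integral>y. log_partition (\<lambda>i. \<Sum>j\<in>B. V' j (y j) i) \<partial>Pi\<^sub>M (A \<union> B) N') = (\<integral>y. log_partition (G y) \<partial>Q)"
    proof -
      let ?law = "\<lambda>K W. distr K (Pi\<^sub>M S (\<lambda>_. borel)) (\<lambda>y. \<lambda>i\<in>S. W y i)"
      have via_law: "(\<integral>y. log_partition (W y) \<partial>K) = (\<integral>u. log_partition u \<partial>?law K W)"
        if W: "\<And>i. i \<in> S \<Longrightarrow> (\<lambda>y. W y i) \<in> borel_measurable K" for K :: "'c measure" and W
      proof -
        have "(\<integral>u. log_partition u \<partial>?law K W) = (\<integral>y. log_partition (\<lambda>i\<in>S. W y i) \<partial>K)"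
          by (rule integral_distr) (auto intro!: measurable_restrict W borel_measurable_log_partition)
        moreover have "log_partition (\<lambda>i\<in>S. W y i) = log_partition (W y)" for y
          by (rule log_partition_cong) simp
        ultimately show ?thesis by simp
      qed
      have "(\<lambda>y. G (y j) i) \<in> borel_measurable (Pi\<^sub>M B (\<lambda>_. Q))" if "j \<in> B" "i \<in> S" for i j
        by (rule measurable_compose[OF measurable_component_singleton[OF that(1)] Gm[OF that(2)]])
      then have m: "(\<lambda>y. \<Sum>j\<in>B. G (y j) i / sqrt (card B)) \<in> borel_measurable (Pi\<^sub>M B (\<lambda>_. Q))" if "i \<in> S" for i
        using that by (intro borel_measurable_sum borel_measurable_divide) auto
      have "(\<Sum>j\<in>B. V' j (y j) i) = (\<Sum>j\<in>B. G (y j) i / sqrt (card B))" for y i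
        using BA AB(4) by (intro sum.cong) (auto simp: V'_def r_def divide_inverse mult.commute)
      moreover have "Pi\<^sub>M B N' = Pi\<^sub>M B (\<lambda>_. Q)" by (rule PiM_cong) (auto simp: N'_def BA)
      ultimately have "(\<integral>y. log_partition (\<lambda>i. \<Sum>j\<in>B. V' j (y j) i) \<partial>Pi\<^sub>M (A \<union> B) N')
          = (\<integral>y. log_partition (\<lambda>i. \<Sum>j\<in>B. G (y j) i / sqrt (card B)) \<partial>Pi\<^sub>M B (\<lambda>_. Q))"
        by (subst restr) auto
      also have "\<dots> = (\<integral>u. log_partition u \<partial>?law (Pi\<^sub>M B (\<lambda>_. Q)) (\<lambda>y i. \<Sum>j\<in>B. G (y j) i / sqrt (card B)))"
        by (rule via_law) (rule m)
      also have "?law (Pi\<^sub>M B (\<lambda>_. Q)) (\<lambda>y i. \<Sum>j\<in>B. G (y j) i / sqrt (card B)) = ?law Q G"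
      proof (rule gaussian_distr_sum_copies[OF Q finite_S AB(2,5) gauss Gm])
        show "(\<integral>y. (\<Sum>i\<in>S. a i * G y i) \<partial>Q) = 0" for a
          using G_int(1) G0 by simp
      qed
      also have "(\<integral>u. log_partition u \<partial>?law Q G) = (\<integral>y. log_partition (G y) \<partial>Q)"
        by (rule via_law[symmetric]) (rule Gm)
      finally show ?thesis .
    qed
    have "?E \<le> \<kappa> + (\<Sum>j\<in>A \<union> B. \<integral>y. D' j y ^ 3 \<partial>N' j)"
      unfolding EA[symmetric] EB[symmetric]
      by (rule ind.comparison[OF refl AB(3)]) (unfold covA covB, rule cov)
    also have "\<dots> = ?R + \<gamma> * r"
      using AB DA DB by (simp add: sum.union_disjoint)
    finally show ?thesis by (simp add: r_def)
  qed
  have "(\<lambda>n. inverse (sqrt (real (Suc n)))) \<longlonglongrightarrow> 0"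
    by (rule tendsto_inverse_0_at_top)
       (intro filterlim_compose[OF sqrt_at_top] filterlim_compose[OF filterlim_real_sequentially] filterlim_Suc)
  then have "(\<lambda>n. ?R + \<gamma> * inverse (sqrt (real (Suc n)))) \<longlonglongrightarrow> ?R + \<gamma> * 0"
    by (intro tendsto_intros)
  then have "?E \<le> ?R + \<gamma> * 0"
    by (rule LIMSEQ_le_const) (use step in blast)
  then show ?thesis by simp
qed

end

section \<open>Random continuous functions and discretisation of the index space\<close>

lemma space_borel_of_topology [simp]: "space (borel_of_topology X) = topspace X"
  unfolding borel_of_topology_def by (rule space_measure_of) (auto dest: openin_subset)

lemma openin_sets_borel_of_topology: "openin X U \<Longrightarrow> U \<in> sets (borel_of_topology X)"
  unfolding borel_of_topology_def by (subst sets_measure_of) (auto dest: openin_subset)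

lemma continuous_map_borel_measurable:
  fixes f :: "'a \<Rightarrow> 'b::topological_space"
  assumes "continuous_map X euclidean f"
  shows "f \<in> borel_measurable (borel_of_topology X)"
proof (rule borel_measurableI)
  fix U :: "'b set" assume "open U"
  then have "openin X {x \<in> topspace X. f x \<in> U}"
    using assms by (simp add: continuous_map_def)
  moreover have "f -` U \<inter> space (borel_of_topology X) = {x \<in> topspace X. f x \<in> U}" by auto
  ultimately show "f -` U \<inter> space (borel_of_topology X) \<in> sets (borel_of_topology X)"
    by (simp add: openin_sets_borel_of_topology)
qed

lemma space_borel_cont_space: "space (borel_cont_space T) = mspace (cont_space T)"
  by (simp add: borel_cont_space_def)

lemma cont_space_continuous_map:
  assumes "x \<in> mspace (cont_space T)"
  shows "continuous_map (mtopology_of T) euclidean x"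
  using assms by (simp add: cont_space_def)

lemma cont_space_bounded:
  assumes "x \<in> mspace (cont_space T)"
  obtains b where "\<And>t. t \<in> mspace T \<Longrightarrow> \<bar>x t\<bar> \<le> b"
proof -
  have "bounded (x ` mspace T)"
    using assms by (simp add: cont_space_def)
  then show thesis using that by (auto simp: bounded_iff)
qed

text \<open>Evaluation at a point is 1-Lipschitz for the sup norm, hence continuous.\<close>

lemma evaluation_borel_measurable:
  assumes t: "t \<in> mspace T"
  shows "(\<lambda>x. x t) \<in> borel_measurable (borel_cont_space T)"
  unfolding borel_cont_space_def
proof (rule continuous_map_borel_measurable)
  have "continuous_map (mtopology_of (cont_space T)) (mtopology_of euclidean_metric) (\<lambda>x. x t)"
  proof (rule Lipschitz_continuous_imp_continuous_map)
    show "Lipschitz_continuous_map (cont_space T) euclidean_metric (\<lambda>x. x t)"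
      unfolding Lipschitz_continuous_map_def
    proof (intro conjI exI[of _ 1] ballI)
      fix x y assume xy: "x \<in> mspace (cont_space T)" "y \<in> mspace (cont_space T)"
      have "mdist euclidean_metric (x t) (y t) \<le> mdist (cont_space T) x y"
        using mdist_cfunspace_imp_mdist_le[of x "mtopology_of T" euclidean_metric y "mdist (cont_space T) x y" t] xy t
        by (simp add: cont_space_def)
      then show "mdist euclidean_metric (x t) (y t) \<le> 1 * mdist (cont_space T) x y" by simp
    qed simp
  qed
  then show "continuous_map (mtopology_of (cont_space T)) euclidean (\<lambda>x. x t)" by simp
qed

lemma compact_finite_net:
  assumes T: "compact_space (mtopology_of T)" and \<epsilon>: "0 < \<epsilon>"
  shows "\<exists>K. finite K \<and> K \<subseteq> mspace T \<and> (\<forall>t\<in>mspace T. \<exists>x\<in>K. mdist T x t < \<epsilon>)"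
proof -
  have "Metric_space.mtotally_bounded (mspace T) (mdist T) (mspace T)"
    by (rule Metric_space.compactin_imp_mtotally_bounded[OF Metric_space_mspace_mdist])
       (use T in \<open>simp only: compact_space_def mtopology_of_def Metric_space.topspace_mtopology[OF Metric_space_mspace_mdist]\<close>)
  then have "\<exists>K. finite K \<and> K \<subseteq> mspace T \<and> mspace T \<subseteq> (\<Union>x\<in>K. Metric_space.mball (mspace T) (mdist T) x \<epsilon>)"
    using \<epsilon> by (simp only: Metric_space.mtotally_bounded_def[OF Metric_space_mspace_mdist])
  then obtain K where K: "finite K" "K \<subseteq> mspace T" "mspace T \<subseteq> (\<Union>x\<in>K. Metric_space.mball (mspace T) (mdist T) x \<epsilon>)"
    by (elim exE conjE)
  show ?thesis
  proof (intro exI[of _ K] conjI ballI K)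
    fix t assume "t \<in> mspace T"
    then obtain x where "x \<in> K" "t \<in> Metric_space.mball (mspace T) (mdist T) x \<epsilon>" using K(3) by (elim subsetD[THEN UN_E])
    then show "\<exists>x\<in>K. mdist T x t < \<epsilon>"
      by (intro bexI[of _ x]) (simp_all add: Metric_space.in_mball[OF Metric_space_mspace_mdist])
  qed
qed

text \<open>Each point is sent to the first member of a finite \<open>\<epsilon>\<close>-net that is close to it. Choosing the first one makes
  the map measurable.\<close>

lemma finite_measurable_retraction:
  fixes T :: "'a metric"
  assumes T: "compact_space (mtopology_of T)" and \<epsilon>: "0 < \<epsilon>"
  obtains K r where "finite K" "K \<subseteq> mspace T" "r \<in> measurable (borel_of_topology (mtopology_of T)) (count_space UNIV)"
    "\<And>t. t \<in> mspace T \<Longrightarrow> r t \<in> K" "\<And>t. t \<in> mspace T \<Longrightarrow> mdist T (r t) t < \<epsilon>"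
proof -
  obtain K where K: "finite K" "K \<subseteq> mspace T" "\<And>t. t \<in> mspace T \<Longrightarrow> \<exists>x\<in>K. mdist T x t < \<epsilon>"
    using compact_finite_net[OF T \<epsilon>] by blast
  obtain h where "bij_betw h {0..<card K} K" using ex_bij_betw_nat_finite[OF K(1)] by blast
  then have img: "h ` {0..<card K} = K" by (rule bij_betw_imp_surj_on)
  then have hK: "h i \<in> K" if "i < card K" for i
    using imageI[of i "{0..<card K}" h, unfolded img] that by simp
  have hex: "\<exists>i<card K. h i = x" if "x \<in> K" for x
  proof -
    have "x \<in> h ` {0..<card K}" using that by (simp only: img)
    then show ?thesis by auto
  qed
  define P where "P i t \<longleftrightarrow> i < card K \<and> mdist T (h i) t < \<epsilon>" for i t
  define r where "r t = h (LEAST i. P i t)" for t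
  have P: "P (LEAST i. P i t) t" if t: "t \<in> mspace T" for t
  proof (rule LeastI_ex)
    obtain x where "x \<in> K" "mdist T x t < \<epsilon>" using K(3)[OF t] by blast
    then show "\<exists>i. P i t" using hex[of x] unfolding P_def by blast
  qed
  let ?B = "borel_of_topology (mtopology_of T)"
  have "Measurable.pred ?B (P i)" for i
  proof (cases "i < card K")
    case True
    then have "h i \<in> mspace T" using hK K(2) by blast
    then have "{t \<in> space ?B. P i t} = Metric_space.mball (mspace T) (mdist T) (h i) \<epsilon>"
      using True by (auto simp: P_def Metric_space.in_mball[OF Metric_space_mspace_mdist])
    moreover have "Metric_space.mball (mspace T) (mdist T) (h i) \<epsilon> \<in> sets ?B"
      by (rule openin_sets_borel_of_topology)
         (simp add: mtopology_of_def Metric_space.openin_mball[OF Metric_space_mspace_mdist])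
    ultimately show ?thesis by (simp add: pred_def)
  next
    case False
    then have "P i = (\<lambda>_. False)" by (simp add: P_def fun_eq_iff)
    then show ?thesis by simp
  qed
  then have "(\<lambda>t. LEAST i. P i t) \<in> measurable ?B (count_space UNIV)" by (rule measurable_Least)
  then have "r \<in> measurable ?B (count_space UNIV)"
    unfolding r_def by (rule measurable_compose) simp
  moreover have "r t \<in> K" "mdist T (r t) t < \<epsilon>" if "t \<in> mspace T" for t
    using P[OF that] hK unfolding r_def P_def by blast+
  ultimately show thesis using that[of K r] K by blast
qed

text \<open>The image measure of \<open>\<pi>\<close> under \<open>r\<close> is concentrated on \<open>K\<close>; its masses become the weights of the discretised
  Gibbs measures.\<close>

lemma integral_finite_range:
  fixes g :: "'b \<Rightarrow> real"
  assumes \<pi>: "prob_space \<pi>" and r: "r \<in> measurable \<pi> (count_space UNIV)"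
    and K: "finite K" "\<And>t. t \<in> space \<pi> \<Longrightarrow> r t \<in> K"
  shows "(\<integral>t. g (r t) \<partial>\<pi>) = (\<Sum>x\<in>K. measure \<pi> (r -` {x} \<inter> space \<pi>) * g x)"
proof -
  interpret prob_space \<pi> by fact
  have s: "r -` {x} \<inter> space \<pi> \<in> sets \<pi>" for x by (rule measurable_sets[OF r]) simp
  have "(\<integral>t. g (r t) \<partial>\<pi>) = (\<integral>t. (\<Sum>x\<in>K. indicator (r -` {x} \<inter> space \<pi>) t * g x) \<partial>\<pi>)"
  proof (rule Bochner_Integration.integral_cong[OF refl])
    fix t assume t: "t \<in> space \<pi>"
    have "(\<Sum>x\<in>K. indicator (r -` {x} \<inter> space \<pi>) t * g x) = (\<Sum>x\<in>K. if r t = x then g x else 0)"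
      using t by (intro sum.cong) (auto simp: indicator_def)
    then show "g (r t) = (\<Sum>x\<in>K. indicator (r -` {x} \<inter> space \<pi>) t * g x)"
      using K t by (simp add: sum.delta)
  qed
  also have "\<dots> = (\<Sum>x\<in>K. measure \<pi> (r -` {x} \<inter> space \<pi>) * g x)"
    using s by (subst Bochner_Integration.integral_sum) (auto simp: emeasure_eq_measure intro!: integrable_real_indicator)
  finally show ?thesis .
qed

text \<open>A bound on the second moments implies uniform integrability. The difference is truncated at the level \<open>k\<close>: the
  truncated part converges by dominated convergence, and what exceeds \<open>k\<close> is at most its square divided
  by \<open>k\<close>. By Fatou's lemma the bound passes to the limit \<open>g\<close>.\<close>

lemma (in prob_space) tendsto_integral_L2_bounded:
  fixes f :: "nat \<Rightarrow> 'a \<Rightarrow> real"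
  assumes f: "\<And>n. f n \<in> borel_measurable M"
    and lim: "\<And>x. x \<in> space M \<Longrightarrow> (\<lambda>n. f n x) \<longlonglongrightarrow> g x"
    and int: "\<And>n. integrable M (\<lambda>x. (f n x)\<^sup>2)" and C: "\<And>n. (\<integral>x. (f n x)\<^sup>2 \<partial>M) \<le> C"
  shows "(\<lambda>n. \<integral>x. f n x \<partial>M) \<longlonglongrightarrow> (\<integral>x. g x \<partial>M)"
proof -
  have g: "g \<in> borel_measurable M" by (rule borel_measurable_LIMSEQ_real[OF lim f])
  note [measurable] = f g
  have "(\<integral>\<^sup>+x. ennreal ((g x)\<^sup>2) \<partial>M) = (\<integral>\<^sup>+x. liminf (\<lambda>n. ennreal ((f n x)\<^sup>2)) \<partial>M)"
    by (intro nn_integral_cong lim_imp_Liminf[symmetric] tendsto_intros lim) auto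
  also have "\<dots> \<le> liminf (\<lambda>n. \<integral>\<^sup>+x. ennreal ((f n x)\<^sup>2) \<partial>M)"
    by (rule nn_integral_liminf) measurable
  also have "\<dots> \<le> ennreal C"
    by (rule Liminf_le) (auto simp: nn_integral_eq_integral[OF int] intro!: always_eventually ennreal_leI C)
  finally have gC: "(\<integral>\<^sup>+x. ennreal ((g x)\<^sup>2) \<partial>M) \<le> ennreal C" .
  have C0: "0 \<le> C" using C[of 0] by (rule order_trans[rotated]) simp
  have g2: "integrable M (\<lambda>x. (g x)\<^sup>2)"
    by (rule integrableI_nonneg) (use gC in \<open>auto intro: le_less_trans\<close>)
  have g2C: "(\<integral>x. (g x)\<^sup>2 \<partial>M) \<le> C"
    using gC C0 by (simp add: nn_integral_eq_integral[OF g2])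
  have f1: "integrable M (f n)" for n by (rule square_integrable_imp_integrable[OF f int])
  have g1: "integrable M g" by (rule square_integrable_imp_integrable[OF g g2])
  have trunc: "\<bar>(\<integral>x. f n x \<partial>M) - (\<integral>x. g x \<partial>M)\<bar> \<le> (\<integral>x. min \<bar>f n x - g x\<bar> k \<partial>M) + 4 * C / k"
    if k: "0 < k" for n k
  proof -
    have mi: "integrable M (\<lambda>x. min \<bar>f n x - g x\<bar> k)"
      by (rule integrable_const_bound[where B=k]) (use k in auto)
    have "\<bar>(\<integral>x. f n x \<partial>M) - (\<integral>x. g x \<partial>M)\<bar> = \<bar>\<integral>x. f n x - g x \<partial>M\<bar>"
      using f1 g1 by simp
    also have "\<dots> \<le> (\<integral>x. \<bar>f n x - g x\<bar> \<partial>M)" by (rule integral_abs_bound)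
    also have "\<dots> \<le> (\<integral>x. min \<bar>f n x - g x\<bar> k + (2 / k) * ((f n x)\<^sup>2 + (g x)\<^sup>2) \<partial>M)"
    proof (rule integral_mono)
      fix x
      let ?h = "\<bar>f n x - g x\<bar>"
      show "?h \<le> min ?h k + (2 / k) * ((f n x)\<^sup>2 + (g x)\<^sup>2)"
      proof (cases "?h \<le> k")
        case False
        have "?h * k \<le> ?h * ?h" using False by (intro mult_left_mono) auto
        also have "\<dots> = (f n x - g x)\<^sup>2" by (simp add: power2_eq_square[symmetric])
        also have "\<dots> \<le> 2 * ((f n x)\<^sup>2 + (g x)\<^sup>2)"
          using sum_squares_ge_zero[of "f n x + g x" 0] by (simp add: power2_eq_square algebra_simps)
        finally have "?h \<le> (2 / k) * ((f n x)\<^sup>2 + (g x)\<^sup>2)" using k by (simp add: field_simps)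
        then show ?thesis using k by (simp add: min_def)
      qed (use k in auto)
    qed (use f1 g1 int g2 mi in auto)
    also have "\<dots> = (\<integral>x. min \<bar>f n x - g x\<bar> k \<partial>M) + (2 / k) * ((\<integral>x. (f n x)\<^sup>2 \<partial>M) + (\<integral>x. (g x)\<^sup>2 \<partial>M))"
      using mi int g2 by simp
    also have "\<dots> \<le> (\<integral>x. min \<bar>f n x - g x\<bar> k \<partial>M) + (2 / k) * (C + C)"
      using k C g2C by (intro add_left_mono mult_left_mono add_mono) auto
    finally show ?thesis by simp
  qed
  have trunc_lim: "(\<lambda>n. \<integral>x. min \<bar>f n x - g x\<bar> k \<partial>M) \<longlonglongrightarrow> 0" if k: "0 < k" for k
  proof -
    have "(\<lambda>n. \<integral>x. min \<bar>f n x - g x\<bar> k \<partial>M) \<longlonglongrightarrow> (\<integral>x. 0 \<partial>M)"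
    proof (rule integral_dominated_convergence[where w="\<lambda>_. k"])
      show "AE x in M. (\<lambda>n. min \<bar>f n x - g x\<bar> k) \<longlonglongrightarrow> 0"
      proof (rule AE_I2)
        fix x assume "x \<in> space M"
        then have "(\<lambda>n. min \<bar>f n x - g x\<bar> k) \<longlonglongrightarrow> min \<bar>g x - g x\<bar> k"
          by (intro tendsto_intros lim)
        then show "(\<lambda>n. min \<bar>f n x - g x\<bar> k) \<longlonglongrightarrow> 0" using k by simp
      qed
    qed (use k in auto)
    then show ?thesis by simp
  qed
  show ?thesis
  proof (rule LIMSEQ_I)
    fix e :: real assume e: "0 < e"
    define k where "k = (8 * C + 1) / e"
    have k: "0 < k" "4 * C / k < e / 2" using C0 e by (auto simp: k_def field_simps)
    obtain N where N: "\<And>n. N \<le> n \<Longrightarrow> norm ((\<integral>x. min \<bar>f n x - g x\<bar> k \<partial>M) - 0) < e / 2"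
      using LIMSEQ_D[OF trunc_lim[OF k(1)], of "e / 2"] e by auto
    have "norm ((\<integral>x. f n x \<partial>M) - (\<integral>x. g x \<partial>M)) < e" if "N \<le> n" for n
      using N[OF that] trunc[OF k(1), of n] k(2) by simp
    then show "\<exists>N. \<forall>n\<ge>N. norm ((\<integral>x. f n x \<partial>M) - (\<integral>x. g x \<partial>M)) < e" by blast
  qed
qed

section \<open>Moments of the summands\<close>

lemma (in prob_space) integrable_if_cube_integrable:
  fixes f :: "'a \<Rightarrow> real"
  assumes f: "f \<in> borel_measurable M" and f3: "integrable M (\<lambda>x. \<bar>f x - c\<bar> ^ 3)"
  shows "integrable M f" "integrable M (\<lambda>x. (f x - c)\<^sup>2)"
proof -
  have 1: "integrable M (\<lambda>x. 1 + \<bar>f x - c\<bar> ^ 3)" using f3 by simp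
  have b: "\<bar>f x - c\<bar> ^ k \<le> \<bar>1 + \<bar>f x - c\<bar> ^ 3\<bar>" if "k \<le> 3" for x k
    using power_le_one_plus_cube[OF abs_ge_zero that, of "f x - c"] by (rule order_trans[OF _ abs_ge_self])
  have "integrable M (\<lambda>x. f x - c)"
    by (rule Bochner_Integration.integrable_bound[OF 1]) (use f b[of 1] in auto)
  then have "integrable M (\<lambda>x. (f x - c) + c)" by (intro Bochner_Integration.integrable_add) auto
  then show "integrable M f" by simp
  show "integrable M (\<lambda>x. (f x - c)\<^sup>2)"
    by (rule Bochner_Integration.integrable_bound[OF 1]) (use f b[of 2] in auto)
qed

lemma gaussian_rv_shift:
  assumes P: "prob_space P" and Z: "gaussian_rv P Z"
  shows "gaussian_rv P (\<lambda>\<omega>. Z \<omega> + c)"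
proof -
  interpret prob_space P by fact
  have Zm: "Z \<in> borel_measurable P" using Z by (simp add: gaussian_rv_def)
  from Z consider (const) \<mu> where "AE \<omega> in P. Z \<omega> = \<mu>"
    | (density) \<mu> \<sigma> where "0 < \<sigma>" "distributed P lborel Z (\<lambda>z. ennreal (normal_density \<mu> \<sigma> z))"
    unfolding gaussian_rv_def by blast
  then show ?thesis
  proof cases
    case const
    then have "AE \<omega> in P. Z \<omega> + c = \<mu> + c" by eventually_elim simp
    then show ?thesis using Zm unfolding gaussian_rv_def
      by (intro conjI exI[of _ "\<mu> + c"] exI[of _ 0]) auto
  next
    case density
    have "distributed P lborel (\<lambda>\<omega>. Z \<omega> + c) (\<lambda>z. ennreal (normal_density (\<mu> + c) \<sigma> z))"
      using normal_density_affine[OF density(2,1), of 1 c] by (simp add: add.commute)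
    then show ?thesis using Zm density(1) unfolding gaussian_rv_def by auto
  qed
qed

lemma gaussian_rv_distr:
  assumes f: "f \<in> measurable P N" and g: "g \<in> borel_measurable N" and "gaussian_rv P (\<lambda>\<omega>. g (f \<omega>))"
  shows "gaussian_rv (distr P N f) g"
proof -
  have c: "{x \<in> space N. g x = \<mu>} \<in> sets N" for \<mu> using g by measurable
  have d: "distr (distr P N f) lborel g = distr P lborel (\<lambda>\<omega>. g (f \<omega>))"
    using distr_distr[of g N lborel f P] f g by (simp add: comp_def)
  have m: "(\<lambda>\<omega>. g (f \<omega>)) \<in> borel_measurable P" using f g by measurable
  show ?thesis
    using assms(3) g m unfolding gaussian_rv_def distributed_def d AE_distr_iff[OF f c] by simp
qed

context finite_gibbs
begin

text \<open>A deterministic shift of the vector can be absorbed into the weights.\<close>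

lemma partition_sum_tilt:
  "(\<Sum>i\<in>S. w i * exp (m i) * exp (x i)) = partition_sum (\<lambda>i. x i + m i)"
  unfolding partition_sum_def by (simp add: exp_add mult_ac)

text \<open>Since \<open>(ln z)\<^sup>2 \<le> 4 * z\<close> for \<open>z \<ge> 1\<close>, the square is controlled by the partition sum or its inverse, and by the
  Cauchy-Schwarz inequality the inverse is at most the partition sum of \<open>- x\<close>. Both have expectations that
  are explicit for Gaussian \<open>x\<close>.\<close>

lemma log_partition_sq_le:
  assumes "sum w S = 1"
  shows "(log_partition x)\<^sup>2 \<le> 4 * (partition_sum x + partition_sum (\<lambda>i. - x i))"
proof -
  have sq: "(ln z)\<^sup>2 \<le> 4 * z" if "1 \<le> z" for z :: real
  proof -
    have "ln z = 2 * ln (sqrt z)" using that by (simp add: ln_sqrt)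
    moreover have "ln (sqrt z) \<le> sqrt z" using that ln_le_minus_one[of "sqrt z"] by simp
    ultimately have "(ln z)\<^sup>2 \<le> (2 * sqrt z)\<^sup>2" using that by (intro power_mono) auto
    then show ?thesis using that by (simp add: power_mult_distrib)
  qed
  let ?Z = "partition_sum x" and ?W = "partition_sum (\<lambda>i. - x i)"
  have ZW: "1 \<le> ?Z * ?W"
  proof -
    have "(\<Sum>i\<in>S. (sqrt (w i) * exp (x i / 2)) * (sqrt (w i) * exp (- x i / 2)))\<^sup>2
        \<le> (\<Sum>i\<in>S. (sqrt (w i) * exp (x i / 2))\<^sup>2) * (\<Sum>i\<in>S. (sqrt (w i) * exp (- x i / 2))\<^sup>2)"
      by (rule Cauchy_Schwarz_ineq_sum)
    moreover have "(sqrt (w i) * exp (x i / 2)) * (sqrt (w i) * exp (- x i / 2)) = w i" if "i \<in> S" for i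
    proof -
      have "(sqrt (w i) * exp (x i / 2)) * (sqrt (w i) * exp (- x i / 2))
          = (sqrt (w i) * sqrt (w i)) * (exp (x i / 2) * exp (- x i / 2))" by (simp only: mult_ac)
      then show ?thesis using weight_nonneg[OF that] by (simp add: mult_exp_exp)
    qed
    moreover have "(sqrt (w i) * exp (z / 2))\<^sup>2 = w i * exp z" if "i \<in> S" for i z
      using weight_nonneg[OF that] by (simp add: power_mult_distrib exp_double[symmetric])
    moreover from this[of _ "- x _"]
    have "(sqrt (w i) * exp (- x i / 2))\<^sup>2 = w i * exp (- x i)" if "i \<in> S" for i
      using that by simp
    ultimately show ?thesis using assms by (simp add: partition_sum_def)
  qed
  have pos: "0 < ?Z" "0 < ?W" by (rule partition_sum_pos)+
  show ?thesis
  proof (cases "1 \<le> ?Z")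
    case True
    then show ?thesis using sq[OF True] pos by (simp add: log_partition_def)
  next
    case False
    have "1 \<le> inverse ?Z" using False pos by (simp add: one_le_inverse)
    then have "(ln ?Z)\<^sup>2 \<le> 4 * inverse ?Z" using sq[of "inverse ?Z"] pos by (simp add: ln_inverse)
    also have "inverse ?Z \<le> ?W" using ZW pos by (simp add: field_simps)
    finally show ?thesis using pos by (simp add: log_partition_def)
  qed
qed

end

text \<open>The situation for one parameter \<open>\<theta>\<close>, in the case that all terms of the bound are finite: the real numbers
  \<open>\<alpha>\<close> and \<open>\<beta>\<close> bound the distances of the means and of the covariances.\<close>

locale process_comparison = P: prob_space P + Q: prob_space Q + prior: prob_space \<pi>
  for P Q :: "'w measure" and \<pi> :: "'a measure" +
  fixes T :: "'a metric" and M :: nat and X Y :: "'w \<Rightarrow> 'a \<Rightarrow> real" and Xs :: "nat \<Rightarrow> 'w \<Rightarrow> 'a \<Rightarrow> real"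
    and \<alpha> \<beta> :: real
  assumes compact_T: "compact_space (mtopology_of T)"
    and sets_prior: "sets \<pi> = sets (borel_of_topology (mtopology_of T))"
    and X_measurable: "X \<in> measurable P (borel_cont_space T)"
    and Y_measurable: "Y \<in> measurable Q (borel_cont_space T)"
    and Xs_measurable: "\<And>m. m \<in> {1..M} \<Longrightarrow> Xs m \<in> measurable P (borel_cont_space T)"
    and X_sum: "\<And>\<omega> t. \<omega> \<in> space P \<Longrightarrow> t \<in> mspace T \<Longrightarrow> X \<omega> t = (\<Sum>m=1..M. Xs m \<omega> t)"
    and Xs_indep: "P.indep_vars (\<lambda>_. borel_cont_space T) Xs {1..M}"
    and Y_gaussian: "gaussian_process (mspace T) Q Y"
    and third_finite: "\<And>m. m \<in> {1..M} \<Longrightarrow> third_moment (mspace T) P (Xs m) < \<infinity>"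
    and mean_close: "\<And>t. t \<in> mspace T \<Longrightarrow> \<bar>mean_fun P X t - mean_fun Q Y t\<bar> \<le> \<alpha>"
    and cov_close: "\<And>s t. s \<in> mspace T \<Longrightarrow> t \<in> mspace T \<Longrightarrow> \<bar>cov_fun P X s t - cov_fun Q Y s t\<bar> \<le> \<beta>"
begin

abbreviation mean :: "nat \<Rightarrow> 'a \<Rightarrow> real" where "mean m \<equiv> mean_fun P (Xs m)"

definition third_real :: "nat \<Rightarrow> real"
  where "third_real m = enn2real (third_moment (mspace T) P (Xs m))"

text \<open>The sup norm of the centred process over a finite set of indices. Unlike the supremum over \<open>T\<close>, it is
  evidently measurable, and its third moment is at most the one over \<open>T\<close>.\<close>

definition deviation :: "'a set \<Rightarrow> nat \<Rightarrow> ('a \<Rightarrow> real) \<Rightarrow> real"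
  where "deviation K m x = (MAX t\<in>K. \<bar>x t - mean m t\<bar>)"

lemma X_eval [measurable]: "t \<in> mspace T \<Longrightarrow> (\<lambda>\<omega>. X \<omega> t) \<in> borel_measurable P"
  by (rule measurable_compose[OF X_measurable evaluation_borel_measurable])

lemma Y_eval [measurable]: "t \<in> mspace T \<Longrightarrow> (\<lambda>\<omega>. Y \<omega> t) \<in> borel_measurable Q"
  by (rule measurable_compose[OF Y_measurable evaluation_borel_measurable])

lemma Xs_eval [measurable]: "m \<in> {1..M} \<Longrightarrow> t \<in> mspace T \<Longrightarrow> (\<lambda>\<omega>. Xs m \<omega> t) \<in> borel_measurable P"
  by (rule measurable_compose[OF Xs_measurable evaluation_borel_measurable])

lemma deviation_ge: "finite K \<Longrightarrow> t \<in> K \<Longrightarrow> \<bar>x t - mean m t\<bar> \<le> deviation K m x"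
  unfolding deviation_def by (intro Max_ge) auto

lemma deviation_nonneg:
  assumes "finite K" "K \<noteq> {}"
  shows "0 \<le> deviation K m x"
proof -
  obtain t where "t \<in> K" using assms(2) by auto
  then show ?thesis by (rule order_trans[OF abs_ge_zero deviation_ge[OF assms(1)]])
qed

lemma deviation_measurable:
  assumes "finite K" "K \<subseteq> mspace T"
  shows "deviation K m \<in> borel_measurable (borel_cont_space T)"
  unfolding deviation_def[abs_def]
proof (rule borel_measurable_Max[OF assms(1)])
  fix t assume "t \<in> K"
  then have [measurable]: "(\<lambda>x. x t) \<in> borel_measurable (borel_cont_space T)"
    using assms(2) by (intro evaluation_borel_measurable) auto
  show "(\<lambda>x. \<bar>x t - mean m t\<bar>) \<in> borel_measurable (borel_cont_space T)" by measurable
qed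

lemma deviation_cube:
  assumes K: "finite K" "K \<noteq> {}" "K \<subseteq> mspace T" and m: "m \<in> {1..M}"
  shows "integrable P (\<lambda>\<omega>. deviation K m (Xs m \<omega>) ^ 3)"
    and "(\<integral>\<omega>. deviation K m (Xs m \<omega>) ^ 3 \<partial>P) \<le> third_real m"
proof -
  have [measurable]: "(\<lambda>\<omega>. deviation K m (Xs m \<omega>)) \<in> borel_measurable P"
    by (rule measurable_compose[OF Xs_measurable[OF m] deviation_measurable[OF K(1,3)]])
  note nn = deviation_nonneg[OF K(1,2)]
  have le: "ennreal (deviation K m x ^ 3) \<le> sup_norm (mspace T) (\<lambda>t. x t - mean m t) ^ 3" for x
  proof -
    have "deviation K m x \<in> (\<lambda>t. \<bar>x t - mean m t\<bar>) ` K"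
      unfolding deviation_def using K by (intro Max_in) auto
    then obtain t where t: "t \<in> K" "deviation K m x = \<bar>x t - mean m t\<bar>" by blast
    have "ennreal (deviation K m x) \<le> sup_norm (mspace T) (\<lambda>t. x t - mean m t)"
      unfolding sup_norm_def t(2) using t(1) K(3) by (intro SUP_upper) auto
    then show ?thesis using nn by (simp add: ennreal_power[symmetric] power_mono)
  qed
  have bound: "(\<integral>\<^sup>+\<omega>. ennreal (deviation K m (Xs m \<omega>) ^ 3) \<partial>P) \<le> third_moment (mspace T) P (Xs m)"
    unfolding third_moment_def by (rule nn_integral_mono) (rule le)
  show int: "integrable P (\<lambda>\<omega>. deviation K m (Xs m \<omega>) ^ 3)"
    by (rule integrableI_nonneg) (use nn bound third_finite[OF m] in \<open>auto intro: le_less_trans\<close>)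
  have "ennreal (\<integral>\<omega>. deviation K m (Xs m \<omega>) ^ 3 \<partial>P) \<le> third_moment (mspace T) P (Xs m)"
    using bound nn by (subst nn_integral_eq_integral[OF int, symmetric]) auto
  then have "enn2real (ennreal (\<integral>\<omega>. deviation K m (Xs m \<omega>) ^ 3 \<partial>P)) \<le> third_real m"
    unfolding third_real_def using third_finite[OF m] by (intro enn2real_mono) auto
  then show "(\<integral>\<omega>. deviation K m (Xs m \<omega>) ^ 3 \<partial>P) \<le> third_real m"
    using nn by (subst (asm) enn2real_ennreal) (auto intro!: integral_nonneg_AE)
qed

lemma Xs_cube:
  assumes "m \<in> {1..M}" "t \<in> mspace T"
  shows "integrable P (\<lambda>\<omega>. \<bar>Xs m \<omega> t - mean m t\<bar> ^ 3)"
    and "(\<integral>\<omega>. \<bar>Xs m \<omega> t - mean m t\<bar> ^ 3 \<partial>P) \<le> third_real m"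
  using deviation_cube[of "{t}" m] assms by (simp_all add: deviation_def)

lemma Xs_integrable:
  assumes "m \<in> {1..M}" "t \<in> mspace T"
  shows "integrable P (\<lambda>\<omega>. Xs m \<omega> t)" "integrable P (\<lambda>\<omega>. (Xs m \<omega> t - mean m t)\<^sup>2)"
  by (rule P.integrable_if_cube_integrable[OF Xs_eval[OF assms] Xs_cube(1)[OF assms]])+

lemma mean_X:
  assumes "t \<in> mspace T"
  shows "mean_fun P X t = (\<Sum>m=1..M. mean m t)"
proof -
  have "mean_fun P X t = (\<integral>\<omega>. (\<Sum>m=1..M. Xs m \<omega> t) \<partial>P)"
    unfolding mean_fun_def using assms by (intro Bochner_Integration.integral_cong) (auto simp: X_sum)
  also have "\<dots> = (\<Sum>m=1..M. mean m t)"
    unfolding mean_fun_def by (rule Bochner_Integration.integral_sum) (rule Xs_integrable(1)[OF _ assms])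
  finally show ?thesis .
qed

lemma product_integrable:
  assumes m: "m \<in> {1..M}" "s \<in> mspace T" and k: "k \<in> {1..M}" "t \<in> mspace T"
  shows "integrable P (\<lambda>\<omega>. (Xs m \<omega> s - mean m s) * (Xs k \<omega> t - mean k t))"
proof (rule Bochner_Integration.integrable_bound)
  show "integrable P (\<lambda>\<omega>. (Xs m \<omega> s - mean m s)\<^sup>2 + (Xs k \<omega> t - mean k t)\<^sup>2)"
    using Xs_integrable(2)[OF m] Xs_integrable(2)[OF k] by simp
  show "(\<lambda>\<omega>. (Xs m \<omega> s - mean m s) * (Xs k \<omega> t - mean k t)) \<in> borel_measurable P"
    using Xs_eval[OF m] Xs_eval[OF k] by measurable
  have "\<bar>a * b\<bar> \<le> a\<^sup>2 + b\<^sup>2" for a b :: real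
    using sum_squares_bound[of "\<bar>a\<bar>" "\<bar>b\<bar>"] abs_ge_zero[of "a * b"] unfolding abs_mult power2_abs by linarith
  then show "AE \<omega> in P. norm ((Xs m \<omega> s - mean m s) * (Xs k \<omega> t - mean k t))
      \<le> norm ((Xs m \<omega> s - mean m s)\<^sup>2 + (Xs k \<omega> t - mean k t)\<^sup>2)"
    by (auto intro!: AE_I2)
qed

text \<open>Evaluating the process \<open>m\<close> at \<open>s\<close> and all others at \<open>t\<close> gives a family of independent real variables.\<close>

lemma uncorrelated:
  assumes m: "m \<in> {1..M}" "s \<in> mspace T" and k: "k \<in> {1..M}" "t \<in> mspace T" and "m \<noteq> k"
  shows "(\<integral>\<omega>. (Xs m \<omega> s - mean m s) * (Xs k \<omega> t - mean k t) \<partial>P) = 0"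
proof -
  define q where "q i = (if i = m then s else t)" for i
  have q: "q i \<in> mspace T" for i using m k by (simp add: q_def)
  have "P.indep_vars (\<lambda>_. borel) (\<lambda>i \<omega>. Xs i \<omega> (q i) - mean i (q i)) {1..M}"
    by (rule P.indep_vars_compose2[OF Xs_indep])
       (intro borel_measurable_diff borel_measurable_const evaluation_borel_measurable q)
  then have "P.indep_vars (\<lambda>_. borel) (\<lambda>i \<omega>. Xs i \<omega> (q i) - mean i (q i)) (insert m {k})"
    by (rule P.indep_vars_subset) (use m k in auto)
  then have "P.indep_var borel (\<lambda>\<omega>. Xs m \<omega> (q m) - mean m (q m)) borel (\<lambda>\<omega>. \<Sum>i\<in>{k}. Xs i \<omega> (q i) - mean i (q i))"
    by (intro P.indep_vars_sum) (use assms(5) in auto)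
  then have ind: "P.indep_var borel (\<lambda>\<omega>. Xs m \<omega> s - mean m s) borel (\<lambda>\<omega>. Xs k \<omega> t - mean k t)"
    using assms(5) by (simp add: q_def)
  have "(\<integral>\<omega>. (Xs m \<omega> s - mean m s) * (Xs k \<omega> t - mean k t) \<partial>P)
      = (\<integral>\<omega>. Xs m \<omega> s - mean m s \<partial>P) * (\<integral>\<omega>. Xs k \<omega> t - mean k t \<partial>P)"
    by (rule P.indep_var_lebesgue_integral[OF ind])
       (intro Bochner_Integration.integrable_diff Xs_integrable m k P.integrable_const)+
  also have "(\<integral>\<omega>. Xs m \<omega> s - mean m s \<partial>P) = 0"
    using Xs_integrable(1)[OF m] by (simp add: mean_fun_def P.prob_space)
  finally show ?thesis by simp
qed

lemma cov_X:
  assumes s: "s \<in> mspace T" and t: "t \<in> mspace T"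
  shows "cov_fun P X s t = (\<Sum>m=1..M. cov_fun P (Xs m) s t)"
proof -
  have "cov_fun P X s t = (\<integral>\<omega>. (\<Sum>m=1..M. \<Sum>k=1..M. (Xs m \<omega> s - mean m s) * (Xs k \<omega> t - mean k t)) \<partial>P)"
    unfolding cov_fun_def mean_X[OF s] mean_X[OF t]
    by (rule Bochner_Integration.integral_cong[OF refl])
       (simp add: X_sum s t sum_subtractf[symmetric] sum_product)
  also have "\<dots> = (\<Sum>m=1..M. \<integral>\<omega>. (\<Sum>k=1..M. (Xs m \<omega> s - mean m s) * (Xs k \<omega> t - mean k t)) \<partial>P)"
    by (intro Bochner_Integration.integral_sum Bochner_Integration.integrable_sum product_integrable s t)
  also have "\<dots> = (\<Sum>m=1..M. \<Sum>k=1..M. \<integral>\<omega>. (Xs m \<omega> s - mean m s) * (Xs k \<omega> t - mean k t) \<partial>P)"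
    by (intro sum.cong refl Bochner_Integration.integral_sum product_integrable s t)
  also have "\<dots> = (\<Sum>m=1..M. \<Sum>k=1..M. if k = m then cov_fun P (Xs m) s t else 0)"
    using uncorrelated s t by (intro sum.cong refl) (auto simp: cov_fun_def)
  also have "\<dots> = (\<Sum>m=1..M. cov_fun P (Xs m) s t)"
    by (intro sum.cong refl) (simp add: sum.delta)
  finally show ?thesis .
qed

text \<open>A finite third moment forces at least one sample path to have a finite distance from the mean function, and
  sample paths are bounded.\<close>

lemma mean_bounded:
  assumes m: "m \<in> {1..M}"
  shows "\<exists>b. \<forall>t\<in>mspace T. \<bar>mean m t\<bar> \<le> b"
proof -
  let ?n = "\<lambda>\<omega>. sup_norm (mspace T) (\<lambda>t. Xs m \<omega> t - mean m t)"
  have "\<exists>\<omega>\<in>space P. ?n \<omega> < \<infinity>"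
  proof (rule ccontr)
    assume "\<not> (\<exists>\<omega>\<in>space P. ?n \<omega> < \<infinity>)"
    then have "?n \<omega> = \<infinity>" if "\<omega> \<in> space P" for \<omega> using that by (auto simp: less_top[symmetric])
    then have "third_moment (mspace T) P (Xs m) = (\<integral>\<^sup>+\<omega>. \<infinity> \<partial>P)"
      unfolding third_moment_def by (intro nn_integral_cong) simp
    then show False using third_finite[OF m] by (simp add: P.emeasure_space_1)
  qed
  then obtain \<omega> where \<omega>: "\<omega> \<in> space P" "?n \<omega> < \<infinity>" by blast
  have "Xs m \<omega> \<in> mspace (cont_space T)"
    using measurable_space[OF Xs_measurable[OF m] \<omega>(1)] by (simp add: space_borel_cont_space)
  then obtain b where b: "\<And>t. t \<in> mspace T \<Longrightarrow> \<bar>Xs m \<omega> t\<bar> \<le> b" by (rule cont_space_bounded) blast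
  have "\<bar>mean m t\<bar> \<le> b + enn2real (?n \<omega>)" if t: "t \<in> mspace T" for t
  proof -
    have "ennreal \<bar>Xs m \<omega> t - mean m t\<bar> \<le> ?n \<omega>"
      unfolding sup_norm_def using t by (intro SUP_upper) auto
    then have "enn2real (ennreal \<bar>Xs m \<omega> t - mean m t\<bar>) \<le> enn2real (?n \<omega>)"
      using \<omega>(2) by (intro enn2real_mono) auto
    then have "\<bar>Xs m \<omega> t - mean m t\<bar> \<le> enn2real (?n \<omega>)" by simp
    with b[OF t] show ?thesis by linarith
  qed
  then show ?thesis by (intro exI ballI)
qed

lemma mean_X_bounded:
  obtains b where "\<And>t. t \<in> mspace T \<Longrightarrow> \<bar>mean_fun P X t\<bar> \<le> b"
proof -
  have "\<forall>m\<in>{1..M}. \<exists>b. \<forall>t\<in>mspace T. \<bar>mean m t\<bar> \<le> b"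
    by (intro ballI mean_bounded)
  from bchoice[OF this] obtain b where "\<forall>m\<in>{1..M}. \<forall>t\<in>mspace T. \<bar>mean m t\<bar> \<le> b m"
    by (rule exE)
  then have b: "\<bar>mean m t\<bar> \<le> b m" if "m \<in> {1..M}" "t \<in> mspace T" for m t
    using that by (elim ballE) auto
  have "\<bar>mean_fun P X t\<bar> \<le> sum b {1..M}" if "t \<in> mspace T" for t
    unfolding mean_X[OF that] by (rule order_trans[OF sum_abs sum_mono]) (rule b[OF _ that])
  then show thesis by (rule that)
qed

lemma variance_X_le:
  assumes t: "t \<in> mspace T"
  shows "cov_fun P X t t \<le> (\<Sum>m=1..M. 1 + third_real m)"
  unfolding cov_X[OF t t]
proof (rule sum_mono)
  fix m assume m: "m \<in> {1..M}"
  have "cov_fun P (Xs m) t t = (\<integral>\<omega>. (Xs m \<omega> t - mean m t)\<^sup>2 \<partial>P)"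
    by (simp add: cov_fun_def power2_eq_square)
  also have "\<dots> \<le> (\<integral>\<omega>. 1 + \<bar>Xs m \<omega> t - mean m t\<bar> ^ 3 \<partial>P)"
  proof (rule integral_mono)
    show "(Xs m \<omega> t - mean m t)\<^sup>2 \<le> 1 + \<bar>Xs m \<omega> t - mean m t\<bar> ^ 3" for \<omega>
      using power_le_one_plus_cube[of "\<bar>Xs m \<omega> t - mean m t\<bar>" 2] by simp
  qed (use Xs_integrable(2)[OF m t] Xs_cube(1)[OF m t] in auto)
  also have "\<dots> \<le> 1 + third_real m"
    using Xs_cube[OF m t] by (simp add: P.prob_space)
  finally show "cov_fun P (Xs m) t t \<le> 1 + third_real m" .
qed

end

section \<open>Comparison on a finite set of indices\<close>

context process_comparison
begin

lemma deviation_integrable: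
  assumes K: "finite K" "K \<noteq> {}" "K \<subseteq> mspace T" and m: "m \<in> {1..M}"
  shows "integrable P (\<lambda>\<omega>. deviation K m (Xs m \<omega>))"
proof (rule Bochner_Integration.integrable_bound)
  show "integrable P (\<lambda>\<omega>. 1 + deviation K m (Xs m \<omega>) ^ 3)"
    using deviation_cube(1)[OF K m] by simp
  show "(\<lambda>\<omega>. deviation K m (Xs m \<omega>)) \<in> borel_measurable P"
    by (rule measurable_compose[OF Xs_measurable[OF m] deviation_measurable[OF K(1,3)]])
  have "\<bar>deviation K m x\<bar> \<le> \<bar>1 + deviation K m x ^ 3\<bar>" for x
    using power_le_one_plus_cube[OF deviation_nonneg[OF K(1,2)], of 1 m x] deviation_nonneg[OF K(1,2), of m x]
    by simp
  then show "AE \<omega> in P. norm (deviation K m (Xs m \<omega>)) \<le> norm (1 + deviation K m (Xs m \<omega>) ^ 3)"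
    by (simp only: real_norm_def) simp
qed

lemma X_le_deviation:
  assumes K: "finite K" "K \<subseteq> mspace T" and b: "\<And>t. t \<in> mspace T \<Longrightarrow> \<bar>mean_fun P X t\<bar> \<le> b"
    and \<omega>: "\<omega> \<in> space P" and t: "t \<in> K"
  shows "\<bar>X \<omega> t\<bar> \<le> (\<Sum>m=1..M. deviation K m (Xs m \<omega>)) + b"
proof -
  have tT: "t \<in> mspace T" using t K(2) by auto
  have "X \<omega> t = (\<Sum>m=1..M. Xs m \<omega> t - mean m t) + mean_fun P X t"
    by (simp add: X_sum[OF \<omega> tT] mean_X[OF tT] sum_subtractf)
  moreover have "\<bar>\<Sum>m=1..M. Xs m \<omega> t - mean m t\<bar> \<le> (\<Sum>m=1..M. deviation K m (Xs m \<omega>))"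
    by (rule order_trans[OF sum_abs sum_mono]) (rule deviation_ge[OF K(1) t])
  ultimately show ?thesis using b[OF tT] by linarith
qed

text \<open>Let the mean of \<open>Y\<close> be absorbed into the weights. Then \<open>Y\<close> itself turns into a centred Gaussian vector, and \<open>X\<close>
  into the sum of the centred \<open>Xs m\<close>, up to the difference of the means, which costs \<open>\<alpha>\<close> by the Lipschitz property.
  The laws of these processes enter \<open>gaussian_comparison\<close>.\<close>

lemma finite_bound:
  assumes "finite_gibbs K w" and KT: "K \<subseteq> mspace T"
  shows "\<bar>(\<integral>\<omega>. finite_gibbs.log_partition K w (X \<omega>) \<partial>P) - (\<integral>\<omega>. finite_gibbs.log_partition K w (Y \<omega>) \<partial>Q)\<bar>
    \<le> \<alpha> + \<beta> + (\<Sum>m=1..M. third_real m)"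
proof -
  interpret g: finite_gibbs K w by fact
  note K = g.finite_S g.S_nonempty KT
  have KT': "t \<in> mspace T" if "t \<in> K" for t using that KT by auto
  let ?C = "borel_cont_space T" and ?mY = "mean_fun Q Y"
  define w' where "w' t = w t * exp (?mY t)" for t
  have w': "0 \<le> w' t" if "t \<in> K" for t using g.weight_nonneg[OF that] by (simp add: w'_def)
  interpret g': finite_gibbs K w'
  proof
    have "0 < g.partition_sum ?mY" by (rule g.partition_sum_pos)
    then show "0 < sum w' K" by (simp add: g.partition_sum_def w'_def)
  qed (use K w' in auto)
  have lp': "g'.log_partition x = g.log_partition (\<lambda>t. x t + ?mY t)" for x
    by (simp add: g'.log_partition_def g'.partition_sum_def w'_def g.partition_sum_tilt g.log_partition_def)
  define N where "N m = distr P ?C (Xs m)" for m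
  define V where "V m x t = x t - mean m t" for m and x :: "'a \<Rightarrow> real" and t
  define G where "G x t = x t - ?mY t" for x :: "'a \<Rightarrow> real" and t
  have ev: "(\<lambda>x. x t) \<in> borel_measurable ?C" if "t \<in> K" for t
    by (rule evaluation_borel_measurable[OF KT'[OF that]])
  have evV: "(\<lambda>x. V m x t) \<in> borel_measurable ?C" if "t \<in> K" for m t
    unfolding V_def using ev[OF that] by measurable
  have evG: "(\<lambda>x. G x t) \<in> borel_measurable ?C" if "t \<in> K" for t
    unfolding G_def using ev[OF that] by measurable
  have N: "centered_vector K w' (N m) (V m) (deviation K m)" if m: "m \<in> {1..M}" for m
  proof -
    have "centered_vector K w' (N m) (V m) (\<lambda>x. MAX t\<in>K. \<bar>V m x t\<bar>)"
    proof (rule g'.centered_vector_Max)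
      show "prob_space (N m)" unfolding N_def by (rule P.prob_space_distr[OF Xs_measurable[OF m]])
      show "(\<lambda>x. V m x t) \<in> borel_measurable (N m)" if "t \<in> K" for t
        unfolding N_def using evV[OF that] by simp
      show "integrable (N m) (\<lambda>x. \<bar>V m x t\<bar> ^ 3)" if t: "t \<in> K" for t
        unfolding N_def
        by (subst integrable_distr_eq[OF Xs_measurable[OF m]])
           (use Xs_cube(1)[OF m KT'[OF t]] evV[OF t] in \<open>auto simp: V_def\<close>)
      show "(\<integral>x. V m x t \<partial>N m) = 0" if t: "t \<in> K" for t
        unfolding N_def
        by (subst integral_distr[OF Xs_measurable[OF m] evV[OF t]])
           (use Xs_integrable(1)[OF m KT'[OF t]] in \<open>simp add: V_def mean_fun_def P.prob_space\<close>)
    qed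
    then show ?thesis by (simp add: V_def deviation_def[abs_def])
  qed
  have D3: "(\<integral>x. deviation K m x ^ 3 \<partial>N m) \<le> third_real m" if m: "m \<in> {1..M}" for m
    unfolding N_def
    by (subst integral_distr[OF Xs_measurable[OF m] borel_measurable_power[OF deviation_measurable[OF K(1,3)]]])
       (rule deviation_cube(2)[OF K m])
  let ?Q' = "distr Q ?C Y"
  have Y_rv: "gaussian_rv Q (\<lambda>\<omega>. \<Sum>t\<in>K. a t * Y \<omega> t)" for a
    using Y_gaussian K(1,3) unfolding gaussian_process_def by simp
  have Y1: "gaussian_rv Q (\<lambda>\<omega>. Y \<omega> t)" if "t \<in> K" for t
    using Y_gaussian[unfolded gaussian_process_def, rule_format, of "{t}" "\<lambda>_. 1"] KT'[OF that] by simp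
  have comparison: "\<bar>(\<integral>y. g'.log_partition (\<lambda>t. \<Sum>m=1..M. V m (y m) t) \<partial>Pi\<^sub>M {1..M} N) - (\<integral>x. g'.log_partition (G x) \<partial>?Q')\<bar>
    \<le> \<beta> + (\<Sum>m=1..M. \<integral>x. deviation K m x ^ 3 \<partial>N m)"
  proof (rule g'.gaussian_comparison[OF N])
    show "prob_space ?Q'" by (rule Q.prob_space_distr[OF Y_measurable])
    show "gaussian_rv ?Q' (\<lambda>x. \<Sum>t\<in>K. a t * G x t)" for a
    proof (rule gaussian_rv_distr[OF Y_measurable])
      show "(\<lambda>x. \<Sum>t\<in>K. a t * G x t) \<in> borel_measurable ?C"
        by (intro borel_measurable_sum borel_measurable_times borel_measurable_const evG)
      have "(\<Sum>t\<in>K. a t * G (Y \<omega>) t) = (\<Sum>t\<in>K. a t * Y \<omega> t) + - (\<Sum>t\<in>K. a t * ?mY t)" for \<omega>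
        by (simp add: G_def right_diff_distrib sum_subtractf)
      then show "gaussian_rv Q (\<lambda>\<omega>. \<Sum>t\<in>K. a t * G (Y \<omega>) t)"
        by (simp only:) (rule gaussian_rv_shift[OF Q.prob_space_axioms Y_rv])
    qed
    show "(\<integral>x. G x t \<partial>?Q') = 0" if t: "t \<in> K" for t
      by (subst integral_distr[OF Y_measurable evG[OF t]])
         (use gaussian_rv_integrable_power(1)[OF Q.prob_space_axioms Y1[OF t]] in
           \<open>simp add: G_def mean_fun_def Q.prob_space\<close>)
    fix s t assume st: "s \<in> K" "t \<in> K"
    have "(\<integral>x. V m x s * V m x t \<partial>N m) = cov_fun P (Xs m) s t" if m: "m \<in> {1..M}" for m
      unfolding N_def
      by (subst integral_distr[OF Xs_measurable[OF m] borel_measurable_times[OF evV[OF st(1)] evV[OF st(2)]]])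
         (simp add: V_def cov_fun_def)
    then have "(\<Sum>m=1..M. \<integral>x. V m x s * V m x t \<partial>N m) = cov_fun P X s t"
      by (simp add: cov_X[OF KT'[OF st(1)] KT'[OF st(2)]])
    moreover have "(\<integral>x. G x s * G x t \<partial>?Q') = cov_fun Q Y s t"
      by (subst integral_distr[OF Y_measurable borel_measurable_times[OF evG[OF st(1)] evG[OF st(2)]]])
         (simp add: G_def cov_fun_def)
    ultimately show "\<bar>(\<Sum>m=1..M. \<integral>x. V m x s * V m x t \<partial>N m) - (\<integral>x. G x s * G x t \<partial>?Q')\<bar> \<le> \<beta>"
      using cov_close[OF KT'[OF st(1)] KT'[OF st(2)]] by simp
  qed
  have Y_side: "(\<integral>x. g'.log_partition (G x) \<partial>?Q') = (\<integral>\<omega>. g.log_partition (Y \<omega>) \<partial>Q)"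
    by (subst integral_distr[OF Y_measurable g'.borel_measurable_log_partition[OF evG]])
       (simp_all add: lp' G_def)
  let ?c = "\<lambda>\<omega>. g'.log_partition (\<lambda>t. \<Sum>m=1..M. V m (Xs m \<omega>) t)"
  \<comment> \<open>Independence identifies the joint law of the \<open>Xs m\<close> with a product measure. The empty family is treated separately.\<close>
  have X_side: "(\<integral>y. g'.log_partition (\<lambda>t. \<Sum>m=1..M. V m (y m) t) \<partial>Pi\<^sub>M {1..M} N) = (\<integral>\<omega>. ?c \<omega> \<partial>P)"
  proof (cases "M = 0")
    case True
    interpret E: prob_space "Pi\<^sub>M {} N" by (rule prob_spaceI) (simp add: space_PiM)
    show ?thesis using True P.prob_space E.prob_space by simp
  next
    case False
    then have ne: "{1..M} \<noteq> {}" by simp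
    have law: "Pi\<^sub>M {1..M} N = distr P (Pi\<^sub>M {1..M} (\<lambda>_. ?C)) (\<lambda>\<omega>. \<lambda>m\<in>{1..M}. Xs m \<omega>)"
      unfolding N_def using P.indep_vars_iff_distr_eq_PiM'[OF ne Xs_measurable] Xs_indep by simp
    have "(\<lambda>y. V m (y m) t) \<in> borel_measurable (Pi\<^sub>M {1..M} (\<lambda>_. ?C))" if "m \<in> {1..M}" "t \<in> K" for m t
      by (rule measurable_compose[OF measurable_component_singleton[OF that(1)] evV[OF that(2)]])
    then have "(\<lambda>y. g'.log_partition (\<lambda>t. \<Sum>m=1..M. V m (y m) t)) \<in> borel_measurable (Pi\<^sub>M {1..M} (\<lambda>_. ?C))"
      by (intro g'.borel_measurable_log_partition borel_measurable_sum)
    then show ?thesis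
      unfolding law by (subst integral_distr) (auto intro!: measurable_restrict Xs_measurable)
  qed
  have c: "\<bar>g.log_partition (X \<omega>) - ?c \<omega>\<bar> \<le> \<alpha>" if \<omega>: "\<omega> \<in> space P" for \<omega>
    unfolding lp'
  proof (rule g.log_partition_lipschitz)
    fix t assume "t \<in> K"
    then have t: "t \<in> mspace T" by (rule KT')
    have "X \<omega> t - ((\<Sum>m=1..M. V m (Xs m \<omega>) t) + ?mY t) = mean_fun P X t - ?mY t"
      by (simp add: V_def sum_subtractf X_sum[OF \<omega> t] mean_X[OF t])
    then show "\<bar>X \<omega> t - ((\<Sum>m=1..M. V m (Xs m \<omega>) t) + ?mY t)\<bar> \<le> \<alpha>"
      using mean_close[OF t] by simp
  qed
  have "(\<lambda>\<omega>. V m (Xs m \<omega>) t) \<in> borel_measurable P" if "m \<in> {1..M}" "t \<in> K" for m t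
    by (rule measurable_compose[OF Xs_measurable[OF that(1)] evV[OF that(2)]])
  then have cm: "?c \<in> borel_measurable P"
    by (intro g'.borel_measurable_log_partition borel_measurable_sum)
  obtain b where b: "\<And>t. t \<in> mspace T \<Longrightarrow> \<bar>mean_fun P X t\<bar> \<le> b" by (rule mean_X_bounded) (rule that)
  have Xint: "integrable P (\<lambda>\<omega>. g.log_partition (X \<omega>))"
  proof (rule Bochner_Integration.integrable_bound)
    let ?u = "\<lambda>\<omega>. (\<Sum>m=1..M. deviation K m (Xs m \<omega>)) + b + \<bar>ln (sum w K)\<bar>"
    show "integrable P ?u"
      by (intro Bochner_Integration.integrable_add Bochner_Integration.integrable_sum
          deviation_integrable[OF K] P.integrable_const)
    show "(\<lambda>\<omega>. g.log_partition (X \<omega>)) \<in> borel_measurable P"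
      by (intro g.borel_measurable_log_partition X_eval KT')
    have "\<bar>g.log_partition (X \<omega>)\<bar> \<le> ?u \<omega>" if "\<omega> \<in> space P" for \<omega>
      by (rule g.log_partition_abs_le) (rule X_le_deviation[OF K(1,3) b that])
    then show "AE \<omega> in P. norm (g.log_partition (X \<omega>)) \<le> norm (?u \<omega>)"
      by (auto intro!: AE_I2 intro: order_trans[OF _ abs_ge_self])
  qed
  have cint: "integrable P ?c"
  proof (rule Bochner_Integration.integrable_bound[OF _ cm])
    show "integrable P (\<lambda>\<omega>. \<bar>g.log_partition (X \<omega>)\<bar> + \<alpha>)" using Xint by simp
    show "AE \<omega> in P. norm (?c \<omega>) \<le> norm (\<bar>g.log_partition (X \<omega>)\<bar> + \<alpha>)"
    proof (rule AE_I2)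
      fix \<omega> assume "\<omega> \<in> space P"
      from c[OF this] show "norm (?c \<omega>) \<le> norm (\<bar>g.log_partition (X \<omega>)\<bar> + \<alpha>)"
        unfolding real_norm_def by linarith
    qed
  qed
  have shift: "\<bar>(\<integral>\<omega>. g.log_partition (X \<omega>) \<partial>P) - (\<integral>\<omega>. ?c \<omega> \<partial>P)\<bar> \<le> \<alpha>"
    unfolding Bochner_Integration.integral_diff[OF Xint cint, symmetric]
    by (rule P.abs_integral_le) (rule c)
  have "(\<Sum>m=1..M. \<integral>x. deviation K m x ^ 3 \<partial>N m) \<le> (\<Sum>m=1..M. third_real m)"
    by (rule sum_mono) (rule D3)
  then show ?thesis
    using comparison shift unfolding X_side Y_side by linarith
qed

text \<open>For weights of total mass 1 the logarithm of the partition sum is at most the maximum of \<open>X\<close>, and this is at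
  most a sum of deviations plus a constant. The bound \<open>C\<close> does not depend on the discretisation.\<close>

lemma X_second_moment_bounded:
  "\<exists>C. \<forall>K w. finite_gibbs K w \<and> K \<subseteq> mspace T \<and> sum w K = 1 \<longrightarrow>
    integrable P (\<lambda>\<omega>. (finite_gibbs.log_partition K w (X \<omega>))\<^sup>2) \<and>
    (\<integral>\<omega>. (finite_gibbs.log_partition K w (X \<omega>))\<^sup>2 \<partial>P) \<le> C"
proof -
  obtain b where b: "\<And>t. t \<in> mspace T \<Longrightarrow> \<bar>mean_fun P X t\<bar> \<le> b" by (rule mean_X_bounded) (rule that)
  let ?C = "2 * (real M * (\<Sum>m=1..M. 1 + third_real m)) + 2 * b\<^sup>2"
  show ?thesis
  proof (intro exI[of _ ?C] allI impI)
    fix K w assume Kw: "finite_gibbs K w \<and> K \<subseteq> mspace T \<and> sum w K = 1"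
    interpret g: finite_gibbs K w using Kw by simp
    have K: "finite K" "K \<noteq> {}" "K \<subseteq> mspace T" using g.finite_S g.S_nonempty Kw by auto
    let ?d = "\<lambda>m \<omega>. deviation K m (Xs m \<omega>)"
    let ?u = "\<lambda>\<omega>. 2 * (real M * (\<Sum>m=1..M. 1 + ?d m \<omega> ^ 3)) + 2 * b\<^sup>2"
    have u: "integrable P ?u"
      by (intro Bochner_Integration.integrable_add integrable_mult_right Bochner_Integration.integrable_sum
          deviation_cube(1)[OF K] P.integrable_const)
    have m: "(\<lambda>\<omega>. (g.log_partition (X \<omega>))\<^sup>2) \<in> borel_measurable P"
      by (intro borel_measurable_power g.borel_measurable_log_partition X_eval) (use K in auto)
    have le: "(g.log_partition (X \<omega>))\<^sup>2 \<le> ?u \<omega>" if \<omega>: "\<omega> \<in> space P" for \<omega>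
    proof -
      let ?s = "\<Sum>m=1..M. ?d m \<omega>"
      have "\<bar>g.log_partition (X \<omega>)\<bar> \<le> (?s + b) + \<bar>ln (sum w K)\<bar>"
        by (rule g.log_partition_abs_le) (rule X_le_deviation[OF K(1,3) b \<omega>])
      then have "\<bar>g.log_partition (X \<omega>)\<bar> \<le> ?s + b" using Kw by simp
      then have "(g.log_partition (X \<omega>))\<^sup>2 \<le> (?s + b)\<^sup>2"
        by (metis abs_ge_zero order_trans abs_le_square_iff abs_of_nonneg)
      also have "\<dots> \<le> 2 * ?s\<^sup>2 + 2 * b\<^sup>2"
        using zero_le_power2[of "?s - b"] by (simp add: power2_eq_square algebra_simps)
      also have "?s\<^sup>2 \<le> (\<Sum>m=1..M. (?d m \<omega>)\<^sup>2) * real (card {1..M})"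
        by (rule sum_squared_le_sum_of_squares) 
      also have "\<dots> \<le> (\<Sum>m=1..M. 1 + ?d m \<omega> ^ 3) * real M"
        by (simp, intro mult_right_mono sum_mono power_le_one_plus_cube deviation_nonneg[OF K(1,2)]) auto
      finally show ?thesis by (simp add: mult.commute)
    qed
    have int: "integrable P (\<lambda>\<omega>. (g.log_partition (X \<omega>))\<^sup>2)"
      by (rule Bochner_Integration.integrable_bound[OF u m])
         (rule AE_I2, unfold real_norm_def abs_power2, rule order_trans[OF le abs_ge_self], assumption)
    have "(\<integral>\<omega>. (g.log_partition (X \<omega>))\<^sup>2 \<partial>P) \<le> (\<integral>\<omega>. ?u \<omega> \<partial>P)"
      by (rule integral_mono[OF int u le])
    also have "\<dots> = 2 * (real M * (\<Sum>m=1..M. 1 + (\<integral>\<omega>. ?d m \<omega> ^ 3 \<partial>P))) + 2 * b\<^sup>2"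
    proof -
      have i: "integrable P (\<lambda>\<omega>. 1 + ?d m \<omega> ^ 3)" "(\<integral>\<omega>. 1 + ?d m \<omega> ^ 3 \<partial>P) = 1 + (\<integral>\<omega>. ?d m \<omega> ^ 3 \<partial>P)"
        if "m \<in> {1..M}" for m
        using deviation_cube(1)[OF K that] P.prob_space by simp_all
      have "(\<integral>\<omega>. (\<Sum>m=1..M. 1 + ?d m \<omega> ^ 3) \<partial>P) = (\<Sum>m=1..M. \<integral>\<omega>. 1 + ?d m \<omega> ^ 3 \<partial>P)"
        by (rule Bochner_Integration.integral_sum) (rule i(1))
      also have "\<dots> = (\<Sum>m=1..M. 1 + (\<integral>\<omega>. ?d m \<omega> ^ 3 \<partial>P))" by (rule sum.cong[OF refl]) (rule i(2))
      finally have s: "(\<integral>\<omega>. (\<Sum>m=1..M. 1 + ?d m \<omega> ^ 3) \<partial>P) = (\<Sum>m=1..M. 1 + (\<integral>\<omega>. ?d m \<omega> ^ 3 \<partial>P))" .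
      have "integrable P (\<lambda>\<omega>. \<Sum>m=1..M. 1 + ?d m \<omega> ^ 3)"
        by (rule Bochner_Integration.integrable_sum) (rule i(1))
      then show ?thesis
        using P.prob_space by (subst Bochner_Integration.integral_add) (simp_all only: s integrable_mult_right
          P.integrable_const Bochner_Integration.integral_mult_right_zero lebesgue_integral_const scaleR_one)
    qed
    also have "\<dots> \<le> ?C"
      by (intro add_right_mono mult_left_mono sum_mono add_left_mono deviation_cube(2)[OF K]) auto
    finally show "integrable P (\<lambda>\<omega>. (g.log_partition (X \<omega>))\<^sup>2) \<and> (\<integral>\<omega>. (g.log_partition (X \<omega>))\<^sup>2 \<partial>P) \<le> ?C"
      using int by simp
  qed
qed

text \<open>By \<open>log_partition_sq_le\<close> it suffices to bound the exponential moments of the Gaussian variables \<open>Y t\<close> uniformly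
  in \<open>t\<close>. Their means and variances are bounded because those of \<open>X\<close> are.\<close>

lemma Y_second_moment_bounded:
  "\<exists>C. \<forall>K w. finite_gibbs K w \<and> K \<subseteq> mspace T \<and> sum w K = 1 \<longrightarrow>
    integrable Q (\<lambda>\<omega>. (finite_gibbs.log_partition K w (Y \<omega>))\<^sup>2) \<and>
    (\<integral>\<omega>. (finite_gibbs.log_partition K w (Y \<omega>))\<^sup>2 \<partial>Q) \<le> C"
proof -
  obtain b where b: "\<And>t. t \<in> mspace T \<Longrightarrow> \<bar>mean_fun P X t\<bar> \<le> b" by (rule mean_X_bounded) (rule that)
  define v where "v = (\<Sum>m=1..M. 1 + third_real m) + \<beta>"
  define E where "E = exp (b + \<alpha> + v / 2)"
  have Y1: "gaussian_rv Q (\<lambda>\<omega>. Y \<omega> t)" if "t \<in> mspace T" for t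
    using Y_gaussian[unfolded gaussian_process_def, rule_format, of "{t}" "\<lambda>_. 1"] that by simp
  have exp_int: "integrable Q (\<lambda>\<omega>. exp (c * Y \<omega> t))" and exp_le: "(\<integral>\<omega>. exp (c * Y \<omega> t) \<partial>Q) \<le> E"
    if t: "t \<in> mspace T" and c: "\<bar>c\<bar> = 1" for t c
  proof -
    note moments = gaussian_rv_moments(3,4)[OF Q.prob_space_axioms Y1[OF t]]
    show "integrable Q (\<lambda>\<omega>. exp (c * Y \<omega> t))" by (rule moments(1))
    have var: "(\<integral>\<omega>. (Y \<omega> t - (\<integral>\<omega>. Y \<omega> t \<partial>Q))\<^sup>2 \<partial>Q) = cov_fun Q Y t t"
      by (simp add: cov_fun_def mean_fun_def power2_eq_square)
    have c2: "c\<^sup>2 = 1" using c by (metis power2_abs one_power2)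
    have "c * mean_fun Q Y t \<le> \<bar>c * mean_fun Q Y t\<bar>" by (rule abs_ge_self)
    then have "c * mean_fun Q Y t \<le> b + \<alpha>"
      using mean_close[OF t] b[OF t] c unfolding abs_mult by simp
    moreover have "cov_fun Q Y t t \<le> v"
      using cov_close[OF t t] variance_X_le[OF t] unfolding v_def by linarith
    ultimately show "(\<integral>\<omega>. exp (c * Y \<omega> t) \<partial>Q) \<le> E"
      unfolding moments(2) var E_def c2 by (simp add: mean_fun_def)
  qed
  show ?thesis
  proof (intro exI[of _ "4 * (E + E)"] allI impI)
    fix K w assume Kw: "finite_gibbs K w \<and> K \<subseteq> mspace T \<and> sum w K = 1"
    interpret g: finite_gibbs K w using Kw by simp
    have K: "finite K" "t \<in> K \<Longrightarrow> t \<in> mspace T" for t using g.finite_S Kw by auto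
    have part_int: "integrable Q (\<lambda>\<omega>. g.partition_sum (\<lambda>t. c * Y \<omega> t))"
      and part_le: "(\<integral>\<omega>. g.partition_sum (\<lambda>t. c * Y \<omega> t) \<partial>Q) \<le> E" if c: "\<bar>c\<bar> = 1" for c
    proof -
      show "integrable Q (\<lambda>\<omega>. g.partition_sum (\<lambda>t. c * Y \<omega> t))"
        unfolding g.partition_sum_def
        by (intro Bochner_Integration.integrable_sum integrable_mult_right exp_int K c)
      have "(\<integral>\<omega>. g.partition_sum (\<lambda>t. c * Y \<omega> t) \<partial>Q) = (\<Sum>t\<in>K. w t * (\<integral>\<omega>. exp (c * Y \<omega> t) \<partial>Q))"
        unfolding g.partition_sum_def using exp_int[OF K(2) c]
        by (subst Bochner_Integration.integral_sum) auto
      also have "\<dots> \<le> (\<Sum>t\<in>K. w t * E)"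
        by (intro sum_mono mult_left_mono exp_le K c g.weight_nonneg)
      also have "\<dots> = E" using Kw by (simp add: sum_distrib_right[symmetric])
      finally show "(\<integral>\<omega>. g.partition_sum (\<lambda>t. c * Y \<omega> t) \<partial>Q) \<le> E" .
    qed
    let ?u = "\<lambda>\<omega>. 4 * (g.partition_sum (Y \<omega>) + g.partition_sum (\<lambda>t. - Y \<omega> t))"
    have p: "integrable Q (\<lambda>\<omega>. g.partition_sum (Y \<omega>))" "(\<integral>\<omega>. g.partition_sum (Y \<omega>) \<partial>Q) \<le> E"
      "integrable Q (\<lambda>\<omega>. g.partition_sum (\<lambda>t. - Y \<omega> t))" "(\<integral>\<omega>. g.partition_sum (\<lambda>t. - Y \<omega> t) \<partial>Q) \<le> E"
      using part_int[of 1] part_le[of 1] part_int[of "-1"] part_le[of "-1"] by simp_all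
    have m: "(\<lambda>\<omega>. (g.log_partition (Y \<omega>))\<^sup>2) \<in> borel_measurable Q"
      by (intro borel_measurable_power g.borel_measurable_log_partition Y_eval K)
    have le: "(g.log_partition (Y \<omega>))\<^sup>2 \<le> ?u \<omega>" for \<omega>
      by (rule g.log_partition_sq_le) (use Kw in simp)
    have u: "integrable Q ?u" using p by simp
    have int: "integrable Q (\<lambda>\<omega>. (g.log_partition (Y \<omega>))\<^sup>2)"
      by (rule Bochner_Integration.integrable_bound[OF u m])
         (rule AE_I2, unfold real_norm_def abs_power2, rule order_trans[OF le abs_ge_self])
    have "(\<integral>\<omega>. (g.log_partition (Y \<omega>))\<^sup>2 \<partial>Q) \<le> (\<integral>\<omega>. ?u \<omega> \<partial>Q)"
      by (rule integral_mono[OF int u le])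
    also have "\<dots> \<le> 4 * (E + E)" using p by simp
    finally show "integrable Q (\<lambda>\<omega>. (g.log_partition (Y \<omega>))\<^sup>2) \<and> (\<integral>\<omega>. (g.log_partition (Y \<omega>))\<^sup>2 \<partial>Q) \<le> 4 * (E + E)"
      using int by simp
  qed
qed

end

section \<open>Passage to the full index space\<close>

context process_comparison
begin

lemma space_prior: "space \<pi> = mspace T"
  using sets_eq_imp_space_eq[OF sets_prior] by simp

text \<open>The weights are the masses of the cells of a finite partition whose cells shrink to points. For a continuous
  \<open>x\<close> the discretised integrands converge pointwise and boundedly, and the limit of the integrals is positive, so
  that the logarithm is continuous there.\<close>

lemma discretisation:
  obtains K w where "\<And>n::nat. finite_gibbs (K n) (w n)" "\<And>n. K n \<subseteq> mspace T" "\<And>n. sum (w n) (K n) = 1"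
    "\<And>x. x \<in> mspace (cont_space T) \<Longrightarrow>
      (\<lambda>n. finite_gibbs.log_partition (K n) (w n) x) \<longlonglongrightarrow> ln (\<integral>t. exp (x t) \<partial>\<pi>)"
proof -
  let ?B = "borel_of_topology (mtopology_of T)"
  define good where "good n K r \<longleftrightarrow> finite K \<and> K \<subseteq> mspace T \<and> r \<in> measurable ?B (count_space UNIV)
    \<and> (\<forall>t\<in>mspace T. r t \<in> K) \<and> (\<forall>t\<in>mspace T. mdist T (r t) t < inverse (real (Suc n)))" for n :: nat and K r
  have "\<forall>n. \<exists>p. good n (fst p) (snd p)"
  proof
    fix n
    obtain K r where "finite K" "K \<subseteq> mspace T" "r \<in> measurable ?B (count_space UNIV)"
      "\<And>t. t \<in> mspace T \<Longrightarrow> r t \<in> K" "\<And>t. t \<in> mspace T \<Longrightarrow> mdist T (r t) t < inverse (real (Suc n))"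
      by (rule finite_measurable_retraction[OF compact_T, of "inverse (real (Suc n))"]) auto
    then have "good n K r" unfolding good_def by simp
    then show "\<exists>p. good n (fst p) (snd p)" by (intro exI[of _ "(K, r)"]) simp
  qed
  from choice[OF this] obtain p where "\<forall>n. good n (fst (p n)) (snd (p n))" by (rule exE)
  then have p: "good n (fst (p n)) (snd (p n))" for n by (rule spec)
  define K r where "K n = fst (p n)" and "r n = snd (p n)" for n
  have K: "finite (K n)" "K n \<subseteq> mspace T" and r: "r n \<in> measurable ?B (count_space UNIV)"
    and rK: "t \<in> mspace T \<Longrightarrow> r n t \<in> K n" and rd: "t \<in> mspace T \<Longrightarrow> mdist T (r n t) t < inverse (real (Suc n))" for n t
    using p[of n] unfolding good_def K_def r_def by simp_all
  have r\<pi>: "r n \<in> measurable \<pi> (count_space UNIV)" for n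
    using r[of n] sets_prior by (simp cong: measurable_cong_sets)
  define w where "w n s = measure \<pi> (r n -` {s} \<inter> space \<pi>)" for n s
  have sum_w: "(\<Sum>s\<in>K n. w n s * g s) = (\<integral>t. g (r n t) \<partial>\<pi>)" for g n
    unfolding w_def by (rule integral_finite_range[symmetric, OF prior.prob_space_axioms r\<pi> K(1)]) (simp add: space_prior rK)
  have w1: "sum (w n) (K n) = 1" for n
    using sum_w[of n "\<lambda>_. 1"] prior.prob_space by simp
  have gibbs: "finite_gibbs (K n) (w n)" for n
    by (rule finite_gibbs.intro[OF K(1)]) (simp add: w_def, simp add: w1)
  have lp: "finite_gibbs.log_partition (K n) (w n) x = ln (\<integral>t. exp (x (r n t)) \<partial>\<pi>)" for n x
    using sum_w[of n "\<lambda>s. exp (x s)"]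
    by (simp add: finite_gibbs.log_partition_def[OF gibbs] finite_gibbs.partition_sum_def[OF gibbs])
  have "(\<lambda>n. finite_gibbs.log_partition (K n) (w n) x) \<longlonglongrightarrow> ln (\<integral>t. exp (x t) \<partial>\<pi>)"
    if x: "x \<in> mspace (cont_space T)" for x
  proof -
    note cont = cont_space_continuous_map[OF x]
    obtain b where b: "\<And>t. t \<in> mspace T \<Longrightarrow> \<bar>x t\<bar> \<le> b" by (rule cont_space_bounded[OF x]) (rule that)
    have xm: "x \<in> borel_measurable \<pi>"
      using continuous_map_borel_measurable[OF cont] sets_prior by (simp cong: measurable_cong_sets)
    have xr: "(\<lambda>n. x (r n t)) \<longlonglongrightarrow> x t" if t: "t \<in> mspace T" for t
    proof -
      have "limitin (mtopology_of T) (\<lambda>n. r n t) t sequentially"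
        unfolding mtopology_of_def Metric_space.limitin_metric[OF Metric_space_mspace_mdist]
      proof (intro conjI allI impI t)
        fix \<epsilon> :: real assume "0 < \<epsilon>"
        then have "\<forall>\<^sub>F n in sequentially. inverse (real (Suc n)) < \<epsilon>"
          using LIMSEQ_inverse_real_of_nat by (rule order_tendstoD(2)[rotated])
        then show "\<forall>\<^sub>F n in sequentially. r n t \<in> mspace T \<and> mdist T (r n t) t < \<epsilon>"
        proof eventually_elim
          case (elim n)
          show ?case using subsetD[OF K(2) rK[OF t]] less_trans[OF rd[OF t] elim] by (rule conjI)
        qed
      qed
      from continuous_map_limit[OF cont this] show ?thesis
        by (simp add: limitin_canonical_iff comp_def)
    qed
    have xb: "x t \<le> b" "- b \<le> x t" if "t \<in> space \<pi>" for t
      using b[of t] that unfolding space_prior by linarith+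
    have int: "integrable \<pi> (\<lambda>t. exp (x t))"
      by (rule prior.integrable_const_bound[where B="exp b"])
         (use xm xb in \<open>auto intro!: AE_I2\<close>)
    have "exp (- b) = (\<integral>t. exp (- b) \<partial>\<pi>)" using prior.prob_space by simp
    also have "\<dots> \<le> (\<integral>t. exp (x t) \<partial>\<pi>)"
      by (rule integral_mono[OF _ int]) (use xb in auto)
    finally have pos: "0 < (\<integral>t. exp (x t) \<partial>\<pi>)" by (rule less_le_trans[OF exp_gt_zero])
    have "(\<lambda>n. \<integral>t. exp (x (r n t)) \<partial>\<pi>) \<longlonglongrightarrow> (\<integral>t. exp (x t) \<partial>\<pi>)"
    proof (rule integral_dominated_convergence[where w="\<lambda>_. exp b"])
      show "(\<lambda>t. exp (x (r n t))) \<in> borel_measurable \<pi>" for n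
        by (rule measurable_compose[OF r\<pi>]) simp
      show "AE t in \<pi>. (\<lambda>n. exp (x (r n t))) \<longlonglongrightarrow> exp (x t)"
        by (intro AE_I2 tendsto_exp xr) (simp add: space_prior)
      show "AE t in \<pi>. norm (exp (x (r n t))) \<le> exp b" for n
      proof (rule AE_I2)
        fix t assume "t \<in> space \<pi>"
        then have "r n t \<in> mspace T" using rK K(2) by (auto simp: space_prior)
        from b[OF this] show "norm (exp (x (r n t))) \<le> exp b" by simp
      qed
    qed (use xm in auto)
    then show ?thesis unfolding lp by (rule tendsto_ln) (use pos in simp)
  qed
  then show thesis using that[of K w] gibbs K(2) w1 by blast
qed

text \<open>The bound on finite sets of indices does not depend on the discretisation; both expectations converge by the
  uniform bounds on the second moments.\<close>

lemma free_energy_close: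
  "\<bar>free_energy P \<pi> X - free_energy Q \<pi> Y\<bar> \<le> \<alpha> + \<beta> + (\<Sum>m=1..M. third_real m)"
proof -
  obtain K w where gibbs: "\<And>n::nat. finite_gibbs (K n) (w n)" and KT: "\<And>n. K n \<subseteq> mspace T"
    and w1: "\<And>n. sum (w n) (K n) = 1"
    and lim: "\<And>x. x \<in> mspace (cont_space T) \<Longrightarrow>
      (\<lambda>n. finite_gibbs.log_partition (K n) (w n) x) \<longlonglongrightarrow> ln (\<integral>t. exp (x t) \<partial>\<pi>)"
    by (rule discretisation) (rule that)
  let ?lp = "\<lambda>n. finite_gibbs.log_partition (K n) (w n)"
  have cond: "finite_gibbs (K n) (w n) \<and> K n \<subseteq> mspace T \<and> sum (w n) (K n) = 1" for n
    using gibbs KT w1 by simp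
  have KT': "t \<in> K n \<Longrightarrow> t \<in> mspace T" for t n using KT[of n] by auto
  have "\<exists>C. \<forall>n. integrable P (\<lambda>\<omega>. (?lp n (X \<omega>))\<^sup>2) \<and> (\<integral>\<omega>. (?lp n (X \<omega>))\<^sup>2 \<partial>P) \<le> C"
    using X_second_moment_bounded by (rule ex_forward) (use cond in simp)
  then obtain CX where "\<forall>n. integrable P (\<lambda>\<omega>. (?lp n (X \<omega>))\<^sup>2) \<and> (\<integral>\<omega>. (?lp n (X \<omega>))\<^sup>2 \<partial>P) \<le> CX"
    by (rule exE)
  then have CX: "integrable P (\<lambda>\<omega>. (?lp n (X \<omega>))\<^sup>2)" "(\<integral>\<omega>. (?lp n (X \<omega>))\<^sup>2 \<partial>P) \<le> CX" for n
    by simp_all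
  have limX: "(\<lambda>n. \<integral>\<omega>. ?lp n (X \<omega>) \<partial>P) \<longlonglongrightarrow> free_energy P \<pi> X"
    unfolding free_energy_def
  proof (rule P.tendsto_integral_L2_bounded[OF _ _ CX])
    show "(\<lambda>\<omega>. ?lp n (X \<omega>)) \<in> borel_measurable P" for n
      by (intro finite_gibbs.borel_measurable_log_partition[OF gibbs] X_eval KT')
    show "(\<lambda>n. ?lp n (X \<omega>)) \<longlonglongrightarrow> ln (\<integral>t. exp (X \<omega> t) \<partial>\<pi>)" if "\<omega> \<in> space P" for \<omega>
      by (rule lim) (use measurable_space[OF X_measurable that] in \<open>simp add: space_borel_cont_space\<close>)
  qed
  have "\<exists>C. \<forall>n. integrable Q (\<lambda>\<omega>. (?lp n (Y \<omega>))\<^sup>2) \<and> (\<integral>\<omega>. (?lp n (Y \<omega>))\<^sup>2 \<partial>Q) \<le> C"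
    using Y_second_moment_bounded by (rule ex_forward) (use cond in simp)
  then obtain CY where "\<forall>n. integrable Q (\<lambda>\<omega>. (?lp n (Y \<omega>))\<^sup>2) \<and> (\<integral>\<omega>. (?lp n (Y \<omega>))\<^sup>2 \<partial>Q) \<le> CY"
    by (rule exE)
  then have CY: "integrable Q (\<lambda>\<omega>. (?lp n (Y \<omega>))\<^sup>2)" "(\<integral>\<omega>. (?lp n (Y \<omega>))\<^sup>2 \<partial>Q) \<le> CY" for n
    by simp_all
  have "(\<lambda>n. \<integral>\<omega>. ?lp n (Y \<omega>) \<partial>Q) \<longlonglongrightarrow> free_energy Q \<pi> Y"
    unfolding free_energy_def
  proof (rule Q.tendsto_integral_L2_bounded[OF _ _ CY])
    show "(\<lambda>\<omega>. ?lp n (Y \<omega>)) \<in> borel_measurable Q" for n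
      by (intro finite_gibbs.borel_measurable_log_partition[OF gibbs] Y_eval KT')
    show "(\<lambda>n. ?lp n (Y \<omega>)) \<longlonglongrightarrow> ln (\<integral>t. exp (Y \<omega> t) \<partial>\<pi>)" if "\<omega> \<in> space Q" for \<omega>
      by (rule lim) (use measurable_space[OF Y_measurable that] in \<open>simp add: space_borel_cont_space\<close>)
  qed
  with limX have "(\<lambda>n. \<bar>(\<integral>\<omega>. ?lp n (X \<omega>) \<partial>P) - (\<integral>\<omega>. ?lp n (Y \<omega>) \<partial>Q)\<bar>)
      \<longlonglongrightarrow> \<bar>free_energy P \<pi> X - free_energy Q \<pi> Y\<bar>"
    by (intro tendsto_rabs tendsto_diff)
  then show ?thesis
    by (rule LIMSEQ_le_const2) (intro exI allI impI finite_bound gibbs KT)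
qed

end

theorem theorem4:
  fixes \<Theta> :: "'a topology" and T :: "'a metric" and \<pi> :: "'a measure"
    and \<Omega> :: "'w measure" and P Q :: "'a \<Rightarrow> 'w measure"
    and M :: nat and X Y :: "'w \<Rightarrow> 'a \<Rightarrow> real" and Xs :: "nat \<Rightarrow> 'w \<Rightarrow> 'a \<Rightarrow> real"
  assumes "compact_space \<Theta>"
    and "mspace T \<subseteq> topspace \<Theta>"
    and "compact_space (mtopology_of T)"
    and "prob_space \<pi>"
    and "sets \<pi> = sets (borel_of_topology (mtopology_of T))"
    and "\<And>\<theta>. \<theta> \<in> topspace \<Theta> \<Longrightarrow> prob_space (P \<theta>) \<and> sets (P \<theta>) = sets \<Omega>"
    and "\<And>\<theta>. \<theta> \<in> topspace \<Theta> \<Longrightarrow> prob_space (Q \<theta>) \<and> sets (Q \<theta>) = sets \<Omega>"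
    and "X \<in> measurable \<Omega> (borel_cont_space T)"
    and "Y \<in> measurable \<Omega> (borel_cont_space T)"
    and "\<And>m. m \<in> {1..M} \<Longrightarrow> Xs m \<in> measurable \<Omega> (borel_cont_space T)"
    and "\<And>\<omega> t. \<omega> \<in> space \<Omega> \<Longrightarrow> t \<in> mspace T \<Longrightarrow> X \<omega> t = (\<Sum>m=1..M. Xs m \<omega> t)"
    and "\<And>\<theta>. \<theta> \<in> topspace \<Theta> \<Longrightarrow> prob_space.indep_vars (P \<theta>) (\<lambda>_. borel_cont_space T) Xs {1..M}"
    and "\<And>\<theta>. \<theta> \<in> topspace \<Theta> \<Longrightarrow> gaussian_process (mspace T) (Q \<theta>) Y"
  shows "\<forall>\<theta>\<in>topspace \<Theta>.
    ennreal \<bar>free_energy (P \<theta>) \<pi> X - free_energy (Q \<theta>) \<pi> Y\<bar>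
      \<le> sup_norm (mspace T) (\<lambda>t. mean_fun (P \<theta>) X t - mean_fun (Q \<theta>) Y t)
        + sup_norm (mspace T \<times> mspace T) (\<lambda>(s, t). cov_fun (P \<theta>) X s t - cov_fun (Q \<theta>) Y s t)
        + (\<Sum>m=1..M. third_moment (mspace T) (P \<theta>) (Xs m))"
proof
  fix \<theta> assume \<theta>: "\<theta> \<in> topspace \<Theta>"
  have sets: "sets (P \<theta>) = sets \<Omega>" "sets (Q \<theta>) = sets \<Omega>" using assms(6,7)[OF \<theta>] by simp_all
  have space: "space (P \<theta>) = space \<Omega>" using sets(1) by (rule sets_eq_imp_space_eq)
  define A where "A = sup_norm (mspace T) (\<lambda>t. mean_fun (P \<theta>) X t - mean_fun (Q \<theta>) Y t)"
  define B where "B = sup_norm (mspace T \<times> mspace T) (\<lambda>(s, t). cov_fun (P \<theta>) X s t - cov_fun (Q \<theta>) Y s t)"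
  let ?m3 = "\<lambda>m. third_moment (mspace T) (P \<theta>) (Xs m)"
  have sup: "\<bar>f a\<bar> \<le> enn2real (sup_norm S f)" if "a \<in> S" "sup_norm S f < \<infinity>" for S :: "'c set" and f a
  proof -
    have "ennreal \<bar>f a\<bar> \<le> sup_norm S f" unfolding sup_norm_def using that(1) by (rule SUP_upper)
    then have "enn2real (ennreal \<bar>f a\<bar>) \<le> enn2real (sup_norm S f)"
      using that(2) by (intro enn2real_mono) auto
    then show ?thesis by simp
  qed
  have "ennreal \<bar>free_energy (P \<theta>) \<pi> X - free_energy (Q \<theta>) \<pi> Y\<bar> \<le> A + B + (\<Sum>m=1..M. ?m3 m)"
  \<comment> \<open>If one term on the right is infinite, there is nothing to show.\<close>
  proof (cases "A < \<infinity> \<and> B < \<infinity> \<and> (\<forall>m\<in>{1..M}. ?m3 m < \<infinity>)")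
    case True
    then have fin: "A < \<infinity>" "B < \<infinity>" "\<And>m. m \<in> {1..M} \<Longrightarrow> ?m3 m < \<infinity>" by auto
    interpret process_comparison "P \<theta>" "Q \<theta>" \<pi> T M X Y Xs "enn2real A" "enn2real B"
    proof (intro process_comparison.intro process_comparison_axioms.intro)
      show "prob_space (P \<theta>)" "prob_space (Q \<theta>)" using assms(6,7)[OF \<theta>] by simp_all
      show "X \<in> measurable (P \<theta>) (borel_cont_space T)" "Y \<in> measurable (Q \<theta>) (borel_cont_space T)"
        using assms(8,9) sets by (simp_all cong: measurable_cong_sets)
      show "Xs m \<in> measurable (P \<theta>) (borel_cont_space T)" if "m \<in> {1..M}" for m
        using assms(10)[OF that] sets by (simp cong: measurable_cong_sets)
      show "X \<omega> t = (\<Sum>m=1..M. Xs m \<omega> t)" if "\<omega> \<in> space (P \<theta>)" "t \<in> mspace T" for \<omega> t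
        using assms(11) that unfolding space by simp
      show "\<bar>mean_fun (P \<theta>) X t - mean_fun (Q \<theta>) Y t\<bar> \<le> enn2real A" if "t \<in> mspace T" for t
        using sup[OF that fin(1)[unfolded A_def]] by (simp add: A_def)
      show "\<bar>cov_fun (P \<theta>) X s t - cov_fun (Q \<theta>) Y s t\<bar> \<le> enn2real B" if "s \<in> mspace T" "t \<in> mspace T" for s t
        using sup[OF _ fin(2)[unfolded B_def], of "(s, t)"] that by (simp add: B_def)
    qed (use assms(3,4,5) assms(12,13)[OF \<theta>] fin(3) in auto)
    have "ennreal \<bar>free_energy (P \<theta>) \<pi> X - free_energy (Q \<theta>) \<pi> Y\<bar>
        \<le> ennreal (enn2real A + enn2real B + (\<Sum>m=1..M. third_real m))"
      by (rule ennreal_leI[OF free_energy_close])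
    also have "\<dots> = ennreal (enn2real A) + ennreal (enn2real B) + (\<Sum>m=1..M. ennreal (third_real m))"
      by (simp add: ennreal_plus sum_nonneg third_real_def sum_ennreal)
    also have "\<dots> = A + B + (\<Sum>m=1..M. ?m3 m)"
      using fin by (simp add: third_real_def)
    finally show ?thesis .
  next
    case False
    then have "A = \<infinity> \<or> B = \<infinity> \<or> (\<exists>m\<in>{1..M}. ?m3 m = \<infinity>)" by (auto simp: less_top[symmetric])
    moreover have "?m3 m \<le> (\<Sum>m=1..M. ?m3 m)" if "m \<in> {1..M}" for m
      by (rule member_le_sum[OF that]) auto
    ultimately have "A + B + (\<Sum>m=1..M. ?m3 m) = \<infinity>"
      by (auto simp: top_unique)
    then show ?thesis by (simp only: infinity_ennreal_def top_greatest)
  qed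
  then show "ennreal \<bar>free_energy (P \<theta>) \<pi> X - free_energy (Q \<theta>) \<pi> Y\<bar>
      \<le> sup_norm (mspace T) (\<lambda>t. mean_fun (P \<theta>) X t - mean_fun (Q \<theta>) Y t)
        + sup_norm (mspace T \<times> mspace T) (\<lambda>(s, t). cov_fun (P \<theta>) X s t - cov_fun (Q \<theta>) Y s t)
        + (\<Sum>m=1..M. third_moment (mspace T) (P \<theta>) (Xs m))"
    unfolding A_def B_def .
qed

end
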